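(* There exist absolute constants $c_0,K_0,C_0>0$ such that the following holds. Let $n\ge 2$, let $\xi_n$ be an integer-valued random variable with $$\max_{x\in\mathbf Z}\mathbf P(\xi_n=x)=1-\alpha_n\le 1-\frac{C_0\log n}{n},$$ and let $M=(x_{ij})$ be the random $n\times n$ integer matrix with $x_{ii}=0$ and off-diagonal entries i.i.d. copies of $\xi_n$, with Laplacian $L_{n\times n}=L_M$. Then for any choice of $n-1$ columns of $L_{n\times n}$, with probability at least $1-K_0e^{-c_0\alpha_n n}$ the $n\times(n-1)$ matrix $L_{n\times(n-1)}$ formed by these columns has rank $n-1$ over $\mathbf R$.
   Context: For an $n\times n$ integer matrix $M=(x_{ij})$ with zero diagonal, its Laplacian $L_M=(L_{ij})$ is defined by $L_{ij}=-x_{ij}$ for $i\ne j$ and $L_{ii}=\sum_{k=1}^n x_{ki}$ (so every column sums to $0$). No boundedness of $\xi_n$ is assumed. *)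

theory Defs
  imports
    "HOL-Probability.Probability"
    "HOL-Probability.Product_PMF"
    "Jordan_Normal_Form.DL_Rank"
    "Jordan_Normal_Form.DL_Submatrix"
begin

text \<open>
  An integer-valued random variable enters only through its law, an \<^typ>\<open>int pmf\<close>.
\<close>

definition max_prob :: "int pmf \<Rightarrow> real" where
  "max_prob p = (SUP x. pmf p x)"

text \<open>The supremum is a maximum.\<close>

lemma max_prob_attained:
  "\<exists>x. pmf p x = max_prob p" and pmf_le_max_prob: "pmf p y \<le> max_prob p"
proof -
  have bdd: "bdd_above (range (pmf p))"
    by (rule bdd_aboveI[of _ 1]) (auto simp: pmf_le_1)
  show le: "pmf p y \<le> max_prob p" for y
    unfolding max_prob_def by (rule cSUP_upper[OF _ bdd]) simp
  obtain x0 where x0: "pmf p x0 > 0"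
    using set_pmf_not_empty[of p] pmf_positive[of _ p] by blast
  define S where "S = {x. pmf p x \<ge> pmf p x0}"
  have "finite S"
  proof (rule ccontr)
    assume inf: "infinite S"
    obtain N :: nat where N: "1 < real N * pmf p x0"
      using reals_Archimedean3[OF x0] by blast
    obtain T where T: "T \<subseteq> S" "finite T" "card T = N"
      using infinite_arbitrarily_large[OF inf] by blast
    have "real N * pmf p x0 \<le> (\<Sum>x\<in>T. pmf p x)"
      using T sum_bounded_below[of T "pmf p x0" "pmf p"] by (auto simp: S_def)
    also have "\<dots> = measure_pmf.prob p T"
      using T by (simp add: measure_measure_pmf_finite)
    finally show False using N measure_pmf.prob_le_1[of p T] by linarith
  qed
  moreover have "x0 \<in> S" by (simp add: S_def)
  ultimately have ne: "finite (pmf p ` S)" "pmf p ` S \<noteq> {}" by auto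
  from Max_in[OF ne] obtain x where xS: "x \<in> S" and xM: "Max (pmf p ` S) = pmf p x"
    by (elim imageE)
  have x: "pmf p z \<le> pmf p x" if "z \<in> S" for z
    unfolding xM[symmetric] using ne(1) that by (intro Max_ge) auto
  have "pmf p z \<le> pmf p x" for z
    using x[of z] xS by (cases "z \<in> S") (auto simp: S_def)
  hence "max_prob p \<le> pmf p x"
    unfolding max_prob_def by (intro cSUP_least) auto
  with le[of x] show "\<exists>x. pmf p x = max_prob p" by (intro exI[of _ x]) simp
qed

text \<open>
  The joint law of the off-diagonal entries is the product law on the index set of
  off-diagonal positions.
\<close>

definition random_matrix :: "nat \<Rightarrow> int pmf \<Rightarrow> int mat pmf" where
  "random_matrix n p =
     map_pmf (\<lambda>x. mat n n (\<lambda>(i, j). if i = j then 0 else x (i, j)))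
       (Pi_pmf {(i, j). i < n \<and> j < n \<and> i \<noteq> j} 0 (\<lambda>_. p))"

definition laplacian :: "int mat \<Rightarrow> int mat" where
  "laplacian M = mat (dim_row M) (dim_row M)
     (\<lambda>(i, j). if i = j then (\<Sum>k<dim_row M. M $$ (k, i)) else - M $$ (i, j))"

end

theory Submission
  imports Defs "HOL-Library.Function_Algebras" "HOL-Number_Theory.Cong"
begin

text \<open>
  The columns \<open>X\<^sub>j\<close> of the Laplacian are independent vectors in the space of vectors with
  coordinate sum 0, and a normal vector \<open>w\<close> is orthogonal to \<open>X\<^sub>j\<close> iff
  \<open>\<Sum>\<^sub>i x\<^sub>i\<^sub>j (w\<^sub>j - w\<^sub>i) = 0\<close>. Expose the columns in order and consider the first one
  lying in the rational span of its predecessors. If there are fewer than \<open>n/2\<close> predecessors, their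
  span has large codimension and fixing some coordinates of the new column determines the others
  (Odlyzko). Otherwise complete the span to a hyperplane \<open>V\<close> with normal \<open>w\<close>. If \<open>w\<close> is constant
  outside a small set, take such a \<open>w\<close> of minimal support \<open>S\<close>: it is determined by \<open>|S| - 1\<close> columns,
  and a union bound applies. Otherwise replace the entry law by the lazy law of \<open>b (\<xi> - \<xi>')\<close> with a rare
  Bernoulli variable \<open>b\<close>. A Fourier comparison modulo large primes shows that, up to an error
  \<open>exp (- c \<alpha> n)\<close>, a lazy column hits \<open>V\<close> with a probability exceeding that of a true column by a
  factor as large as we please; the swapping argument of Kahn, Komlos and Szemeredi, spanning \<open>V\<close> by
  lazy columns in place of true ones, then beats all union bounds.
\<close>

subsection \<open>Linear algebra over the rationals\<close>

text \<open>As \<xi> may be unbounded, there can be infinitely many possible hyperplanes, so no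
  union bound over hyperplanes or normal vectors is possible. Union bounds therefore run only over
  index sets and over subsets of one fixed basis, at a cost of about \<open>4 ^ n\<close>. The
  swapping argument allows this and pays with a gain \<open>(4 / k) ^ r\<close>, where
  \<open>r\<close> is about \<open>n / 4\<close> and \<open>k\<close> is a huge constant.
  Unboundedness is also why the primes of the Fourier analysis must tend to infinity. Sparse normals
  need separate treatment because the error of the comparison is exponentially small only in
  \<alpha> times the number of coordinates in which the normal differs from \<open>w j\<close>. The
  logarithmic lower bound on \<alpha> n pays for the polynomial losses: the union over columns and
  the choice of small supports. Linear algebra stays over the rationals, where denominators can be
  cleared and orthogonality becomes an integer linear equation; the reals enter only with the
  rank.\<close>

definition qscale :: "rat \<Rightarrow> ('i \<Rightarrow> rat) \<Rightarrow> 'i \<Rightarrow> rat" where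
  "qscale c f = (\<lambda>i. c * f i)"

lemma qscale_apply: "qscale c f i = c * f i"
  by (simp add: qscale_def)

global_interpretation ratfun: vector_space qscale
  by unfold_locales (auto simp: algebra_simps fun_eq_iff qscale_apply)

global_interpretation ratfunctional: vector_space_pair qscale "(*) :: rat \<Rightarrow> rat \<Rightarrow> rat"
  by unfold_locales (auto simp: algebra_simps fun_eq_iff qscale_apply)

text \<open>Elimination at coordinate \<open>k\<close>: the linear map
  \<open>u - qscale (u k / g k) g\<close> kills \<open>g\<close> and fixes every vector vanishing at
  \<open>k\<close>, so it carries the span of \<open>insert g G\<close> into the span of the reduced
  vectors.\<close>

lemma span_pivot:
  fixes g :: "'i \<Rightarrow> rat"
  assumes g: "g k \<noteq> 0" and u: "u \<in> ratfun.span (insert g G)" and uk: "u k = 0"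
  shows "u \<in> ratfun.span ((\<lambda>h. h - qscale (h k / g k) g) ` G)"
proof -
  let ?T = "ratfun.span ((\<lambda>h. h - qscale (h k / g k) g) ` G)"
  have "u - qscale (u k / g k) g \<in> ?T"
    using u
  proof (induction rule: ratfun.span_induct_alt)
    case base
    have "(0::'i \<Rightarrow> rat) - qscale ((0::'i \<Rightarrow> rat) k / g k) g = 0" by (rule ext) (simp add: qscale_apply)
    then show ?case by (simp only: ratfun.span_zero)
  next
    case (step c x y)
    have 1: "x - qscale (x k / g k) g \<in> ?T"
    proof (cases "x = g")
      case True
      then have "x - qscale (x k / g k) g = 0" using g by (auto simp: fun_eq_iff qscale_apply)
      then show ?thesis by (simp only: ratfun.span_zero)
    next
      case False
      then show ?thesis using step(1) by (intro ratfun.span_base) auto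
    qed
    have "qscale c x + y - qscale ((qscale c x + y) k / g k) g
      = qscale c (x - qscale (x k / g k) g) + (y - qscale (y k / g k) g)"
      by (rule ext) (simp add: ring_distribs add_divide_distrib qscale_apply)
    moreover have "\<dots> \<in> ?T"
      using step(2) 1 by (intro ratfun.span_add ratfun.span_scale)
    ultimately show ?case by (simp only:)
  qed
  moreover have "u - qscale (u k / g k) g = u" using uk by (auto simp: fun_eq_iff qscale_apply)
  ultimately show ?thesis by (simp only:)
qed

text \<open>Row reduction: every pivot removes one generator and contributes one coordinate to
  \<open>D\<close>. Applied to differences, it says that two vectors of the span agreeing on
  \<open>D\<close> agree on all of \<open>I\<close>.\<close>

lemma span_determining_coordinates:
  fixes G :: "('i \<Rightarrow> rat) set"
  assumes "finite G" "card G \<le> m"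
  shows "\<exists>D\<subseteq>I. finite D \<and> card D \<le> m \<and>
    (\<forall>u\<in>ratfun.span G. (\<forall>i\<in>D. u i = 0) \<longrightarrow> (\<forall>i\<in>I. u i = 0))"
  using assms
proof (induction m arbitrary: G)
  case 0
  then have "G = {}" by simp
  then show ?case by (intro exI[of _ "{}"]) auto
next
  case (Suc m)
  show ?case
  proof (cases "\<forall>u\<in>ratfun.span G. \<forall>i\<in>I. u i = 0")
    case True
    then show ?thesis by (intro exI[of _ "{}"]) auto
  next
    case False
    have "\<exists>g\<in>G. \<exists>k\<in>I. g k \<noteq> 0"
    proof (rule ccontr)
      assume a: "\<not> ?thesis"
      have "\<forall>i\<in>I. u i = 0" if "u \<in> ratfun.span G" for u
        using that
      proof (induction rule: ratfun.span_induct_alt)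
        case (step c x y)
        then show ?case using a by (simp add: qscale_apply)
      qed simp
      with False show False by blast
    qed
    then obtain g k where gk: "g \<in> G" "k \<in> I" "g k \<noteq> 0" by blast
    define G' where "G' = (\<lambda>h. h - qscale (h k / g k) g) ` (G - {g})"
    have "card (G - {g}) \<le> m" using Suc gk by simp
    then have c: "card G' \<le> m" unfolding G'_def
      using Suc.prems card_image_le[of "G - {g}" "\<lambda>h. h - qscale (h k / g k) g"] by simp
    have "finite G'" using Suc.prems by (simp add: G'_def)
    from Suc.IH[OF this c] obtain D where D: "D \<subseteq> I" "finite D" "card D \<le> m"
      "\<And>u. u\<in>ratfun.span G' \<Longrightarrow> (\<forall>i\<in>D. u i = 0) \<Longrightarrow> (\<forall>i\<in>I. u i = 0)" by metis
    show ?thesis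
    proof (intro exI[of _ "insert k D"] conjI ballI impI)
      show "insert k D \<subseteq> I" "finite (insert k D)" using D gk by auto
      show "card (insert k D) \<le> Suc m" using D by (simp add: card_insert_if)
      fix u i assume u: "u \<in> ratfun.span G" "\<forall>i\<in>insert k D. u i = 0" "i \<in> I"
      have "u \<in> ratfun.span (insert g (G - {g}))" using u gk by (simp add: insert_absorb)
      then have "u \<in> ratfun.span G'" unfolding G'_def
        using gk u(2) by (intro span_pivot) simp_all
      then show "u i = 0" using D(4) u(2,3) by simp
    qed
  qed
qed

text \<open>Used contrapositively: a dependent or repeating family has a member in the span of its
  predecessors. Injectivity comes along because a repeated vector lies in that span.\<close>

lemma independent_family_ordered:
  fixes X :: "nat \<Rightarrow> 'i \<Rightarrow> rat"
  assumes "finite J" "\<And>i. i \<in> J \<Longrightarrow> X i \<notin> ratfun.span (X ` {j \<in> J. j < i})"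
  shows "inj_on X J \<and> ratfun.independent (X ` J)"
  using assms
proof (induction J rule: finite_linorder_max_induct)
  case empty
  then show ?case by (simp add: ratfun.independent_empty)
next
  case (insert b A)
  have *: "{j \<in> insert b A. j < i} = {j \<in> A. j < i}" if "i \<in> A" for i
    using that insert(2) by force
  have "{j \<in> insert b A. j < b} = A" using insert(2) by auto
  then have b: "X b \<notin> ratfun.span (X ` A)" using insert.prems[of b] by simp
  have IH: "inj_on X A \<and> ratfun.independent (X ` A)"
  proof (rule insert.IH)
    fix i assume "i \<in> A"
    then show "X i \<notin> ratfun.span (X ` {j \<in> A. j < i})" using insert.prems[of i] *[of i] by simp
  qed
  have "X b \<notin> X ` A" using b ratfun.span_base[of "X b" "X ` A"] by metis
  moreover have "b \<notin> A" using insert(2) by auto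
  ultimately show ?case using IH b ratfun.independent_insertI[of "X b" "X ` A"] by simp
qed

definition unitq :: "nat \<Rightarrow> nat \<Rightarrow> rat" where
  "unitq i = (\<lambda>j. if j = i then 1 else 0)"

definition dotp :: "nat \<Rightarrow> (nat \<Rightarrow> rat) \<Rightarrow> (nat \<Rightarrow> rat) \<Rightarrow> rat" where
  "dotp n w v = (\<Sum>i<n. w i * v i)"

lemma sum_fun_apply: "sum f A x = (\<Sum>a\<in>A. f a x)" for f :: "'a \<Rightarrow> 'b \<Rightarrow> 'c::comm_monoid_add"
  by (induction A rule: infinite_finite_induct) auto

lemma unitq_expansion:
  assumes "\<forall>i\<ge>n. v i = 0"
  shows "v = (\<Sum>i<n. qscale (v i) (unitq i))"
proof
  fix x
  have "(\<Sum>i<n. qscale (v i) (unitq i)) x = (\<Sum>i<n. if x = i then v i else 0)"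
    unfolding sum_fun_apply by (rule sum.cong) (simp_all add: qscale_apply unitq_def)
  also have "\<dots> = v x" using assms by (simp add: sum.delta' not_less)
  finally show "v x = (\<Sum>i<n. qscale (v i) (unitq i)) x" by simp
qed

text \<open>A functional that is 1 at \<open>v\<close> and 0 on a basis of the span exists by linear
  extension; its values on the unit vectors are the coordinates of \<open>w\<close>.\<close>

lemma separating_vector:
  assumes S: "\<And>s. s \<in> S \<Longrightarrow> \<forall>i\<ge>n. s i = 0" and v: "\<forall>i\<ge>n. v i = 0" "v \<notin> ratfun.span S"
  obtains w where "dotp n w v = 1" "\<And>s. s \<in> ratfun.span S \<Longrightarrow> dotp n w s = 0"
proof -
  obtain B where B: "B \<subseteq> S" "ratfun.independent B" "S \<subseteq> ratfun.span B"
    using ratfun.maximal_independent_subset[of S] by blast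
  have sB: "ratfun.span B = ratfun.span S"
    using B by (metis ratfun.span_mono ratfun.span_span subset_antisym)
  then have "v \<notin> B" "ratfun.independent (insert v B)"
    using v B by (auto simp: ratfun.independent_insert dest: ratfun.span_base)
  from ratfunctional.linear_independent_extend[OF this(2), of "\<lambda>x. if x = v then 1 else 0"]
  obtain g where g: "Vector_Spaces.linear qscale (*) g"
    "\<forall>x\<in>insert v B. g x = (if x = v then 1 else 0)" by blast
  interpret g: Vector_Spaces.linear qscale "(*) :: rat \<Rightarrow> rat \<Rightarrow> rat" g by (rule g(1))
  have dot: "dotp n (\<lambda>i. g (unitq i)) x = g x" if "\<forall>i\<ge>n. x i = 0" for x
    by (subst (2) unitq_expansion[OF that]) (simp add: g.sum g.scale dotp_def mult.commute)
  have suppS: "\<forall>i\<ge>n. s i = 0" if "s \<in> ratfun.span S" for s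
    using that
  proof (induction rule: ratfun.span_induct_alt)
    case (step c x y)
    then show ?case using S by (simp add: qscale_apply)
  qed simp
  have gS: "g s = 0" if "s \<in> ratfun.span B" for s
    using that
  proof (induction rule: ratfun.span_induct_alt)
    case base
    then show ?case by (rule g.zero)
  next
    case (step c x y)
    then have "g x = 0" using g(2) \<open>v \<notin> B\<close> by auto
    then show ?case using step by (simp only: g.add g.scale mult_zero_right add_0)
  qed
  show thesis
    by (rule that[of "\<lambda>i. g (unitq i)"]) (use dot v suppS gS sB g(2) in auto)
qed

text \<open>Serves to transfer independence from the rationals to the reals: such a \<open>w\<close>
  extracts a single coefficient from a real linear relation.\<close>

lemma dual_vector:
  assumes "inj_on X J" "ratfun.independent (X ` J)" "\<And>j. j \<in> J \<Longrightarrow> \<forall>i\<ge>n. X j i = 0" "j \<in> J"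
  obtains w where "dotp n w (X j) = 1" "\<And>l. l \<in> J \<Longrightarrow> l \<noteq> j \<Longrightarrow> dotp n w (X l) = 0"
proof -
  have "X ` (J - {j}) = X ` J - {X j}"
    using assms(1,4) by (auto simp: inj_on_def)
  then have *: "X j \<notin> ratfun.span (X ` (J - {j}))"
    using assms(2,4) unfolding ratfun.dependent_def by auto
  obtain w where w: "dotp n w (X j) = 1" "\<And>s. s \<in> ratfun.span (X ` (J - {j})) \<Longrightarrow> dotp n w s = 0"
    using separating_vector[OF _ _ *, of n] assms(3,4) by (metis (no_types, lifting) DiffE imageE)
  show thesis
    by (rule that[of w], rule w(1), rule w(2), rule ratfun.span_base) auto
qed

section \<open>The space of vectors with coordinate sum 0 and its hyperplanes\<close>

definition sum0 :: "nat \<Rightarrow> (nat \<Rightarrow> rat) set" where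
  "sum0 n = {v. (\<forall>i\<ge>n. v i = 0) \<and> (\<Sum>i<n. v i) = 0}"

definition sum0_basis :: "nat \<Rightarrow> (nat \<Rightarrow> rat) set" where
  "sum0_basis n = (\<lambda>i. unitq i - unitq 0) ` {1..<n}"

lemma subspace_sum0: "ratfun.subspace (sum0 n)"
  by (auto simp: ratfun.subspace_def sum0_def qscale_apply sum.distrib simp flip: sum_distrib_left)

lemma sum0_basis_in: "sum0_basis n \<subseteq> sum0 n"
  by (auto simp: sum0_basis_def sum0_def unitq_def sum_subtractf)

lemma finite_sum0_basis [simp]: "finite (sum0_basis n)"
  by (simp add: sum0_basis_def)

lemma span_sum0_basis: "ratfun.span (sum0_basis n) = sum0 n"
proof
  show "ratfun.span (sum0_basis n) \<subseteq> sum0 n"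
    by (rule ratfun.span_minimal[OF sum0_basis_in subspace_sum0])
  show "sum0 n \<subseteq> ratfun.span (sum0_basis n)"
  proof
    fix v assume v: "v \<in> sum0 n"
    have "v = (\<Sum>i\<in>{1..<n}. qscale (v i) (unitq i - unitq 0))"
    proof
      fix x
      have "(\<Sum>i\<in>{1..<n}. qscale (v i) (unitq i - unitq 0)) x
        = (\<Sum>i\<in>{1..<n}. v i * unitq i x) - (\<Sum>i\<in>{1..<n}. v i) * unitq 0 x"
        by (simp add: sum_fun_apply qscale_apply sum_subtractf right_diff_distrib sum_distrib_right)
      also have "(\<Sum>i\<in>{1..<n}. v i * unitq i x) = (if x \<in> {1..<n} then v x else 0)"
        by (simp add: unitq_def if_distrib sum.delta cong: if_cong)
      also have "\<dots> - (\<Sum>i\<in>{1..<n}. v i) * unitq 0 x = v x"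
      proof (cases "n = 0")
        case True
        then show ?thesis using v by (simp add: sum0_def)
      next
        case False
        then have "(\<Sum>i<n. v i) = v 0 + (\<Sum>i\<in>{1..<n}. v i)"
          by (simp add: lessThan_atLeast0 sum.atLeast_Suc_lessThan)
        then have "(\<Sum>i\<in>{1..<n}. v i) = - v 0" using v by (simp add: sum0_def)
        then show ?thesis using v by (auto simp: unitq_def sum0_def not_less)
      qed
      finally show "v x = (\<Sum>i\<in>{1..<n}. qscale (v i) (unitq i - unitq 0)) x" by (rule sym)
    qed
    also have "\<dots> \<in> ratfun.span (sum0_basis n)"
      unfolding sum0_basis_def
      by (intro ratfun.span_sum ratfun.span_scale ratfun.span_base) auto
    finally show "v \<in> ratfun.span (sum0_basis n)" .
  qed
qed

lemma independent_sum0_basis: "ratfun.independent (sum0_basis n)" and card_sum0_basis: "card (sum0_basis n) = n - 1"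
proof -
  define X where "X = (\<lambda>i. unitq i - unitq 0)"
  have "inj_on X {1..<n} \<and> ratfun.independent (X ` {1..<n})"
  proof (rule independent_family_ordered)
    fix i assume i: "i \<in> {1..<n}"
    have "u i = 0" if "u \<in> ratfun.span (X ` {j \<in> {1..<n}. j < i})" for u
      using that
    proof (induction rule: ratfun.span_induct_alt)
      case (step c x y)
      then show ?case using i by (auto simp: qscale_apply X_def unitq_def)
    qed simp
    moreover have "X i i = 1" using i by (simp add: X_def unitq_def)
    ultimately show "X i \<notin> ratfun.span (X ` {j \<in> {1..<n}. j < i})" by force
  qed simp
  then show "ratfun.independent (sum0_basis n)" "card (sum0_basis n) = n - 1"
    by (auto simp: sum0_basis_def X_def card_image)
qed

text \<open>Extend \<open>B\<close> to a basis of \<open>sum0 n\<close> by vectors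
  \<open>unitq i - unitq 0\<close> and leave out one added vector \<open>f\<close>; then
  \<open>w\<close> reads off the coefficient of \<open>f\<close>. As \<open>F\<close> is drawn from
  a fixed set of \<open>n - 1\<close> vectors, a later union bound over \<open>F\<close> costs at
  most a factor \<open>2 ^ n\<close>.\<close>

lemma hyperplane_completion:
  assumes B: "ratfun.independent B" "finite B" "B \<subseteq> sum0 n" "card B < n - 1"
  obtains F w where "F \<subseteq> sum0_basis n" "F \<inter> B = {}" "card F = n - 2 - card B"
    "ratfun.independent (B \<union> F)"
    "\<And>h. h \<in> sum0 n \<Longrightarrow> h \<in> ratfun.span (B \<union> F) \<longleftrightarrow> dotp n w h = 0"
    "\<exists>h\<in>sum0 n. dotp n w h \<noteq> 0"
proof -
  obtain B' where B': "B \<subseteq> B'" "B' \<subseteq> B \<union> sum0_basis n" "ratfun.independent B'"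
    "B \<union> sum0_basis n \<subseteq> ratfun.span B'"
    using ratfun.maximal_independent_subset_extend[of B "B \<union> sum0_basis n"] B by blast
  have H: "ratfun.span B' = sum0 n"
  proof
    show "ratfun.span B' \<subseteq> sum0 n"
      by (rule ratfun.span_minimal[OF _ subspace_sum0]) (use B' B sum0_basis_in in blast)
    show "sum0 n \<subseteq> ratfun.span B'"
      unfolding span_sum0_basis[symmetric]
      by (rule ratfun.span_minimal) (use B' in \<open>auto simp: ratfun.subspace_span\<close>)
  qed
  have fin: "finite B'" using B' B(2) finite_subset by fastforce
  have "card B' = ratfun.dim (sum0 n)"
    using B' H by (metis ratfun.dim_span_eq_card_independent)
  also have "\<dots> = n - 1"
    by (metis card_sum0_basis independent_sum0_basis ratfun.dim_span_eq_card_independent span_sum0_basis)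
  finally have c: "card B' = n - 1" .
  then have "B' \<noteq> B" using B by auto
  then obtain f where f: "f \<in> B'" "f \<notin> B" using B' by blast
  define F where "F = B' - B - {f}"
  have BF: "B \<union> F = B' - {f}" using B' f by (auto simp: F_def)
  have ins: "insert f (B \<union> F) = B'" using f BF by auto
  have fn: "f \<notin> ratfun.span (B \<union> F)"
    using B'(3) f unfolding BF ratfun.dependent_def by auto
  have sub: "B \<union> F \<subseteq> sum0 n" "f \<in> sum0 n"
    using H ratfun.span_superset[of B'] f BF by auto
  obtain w where w: "dotp n w f = 1" "\<And>s. s \<in> ratfun.span (B \<union> F) \<Longrightarrow> dotp n w s = 0"
    using separating_vector[OF _ _ fn, of n] sub by (auto simp: sum0_def subset_iff)
  show thesis
  proof (rule that[of F w])
    show "F \<subseteq> sum0_basis n" "F \<inter> B = {}" using B' by (auto simp: F_def)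
    have "card F = card (B' - B) - 1" using f by (simp add: F_def)
    also have "card (B' - B) = card B' - card B" using B' B fin by (intro card_Diff_subset) auto
    finally show "card F = n - 2 - card B" using c by simp
    show "ratfun.independent (B \<union> F)" unfolding BF by (rule ratfun.independent_mono[OF B'(3)]) (rule Diff_subset)
    show "\<exists>h\<in>sum0 n. dotp n w h \<noteq> 0" using w(1) sub by (intro bexI[of _ f]) auto
    fix h assume h: "h \<in> sum0 n"
    then obtain k where k: "h - qscale k f \<in> ratfun.span (B \<union> F)"
      using ratfun.span_breakdown_eq[of h f "B \<union> F"] H unfolding ins by blast
    have "dotp n w (h - qscale k f) = dotp n w h - k * dotp n w f"
      by (simp add: dotp_def qscale_apply sum_subtractf right_diff_distrib sum_distrib_left algebra_simps)
    then have "dotp n w h = k" using w k by simp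
    moreover have "h - qscale 0 f = h" by (auto simp: fun_eq_iff qscale_apply)
    ultimately show "h \<in> ratfun.span (B \<union> F) \<longleftrightarrow> dotp n w h = 0"
      using w(2)[of h] k by auto
  qed
qed

text \<open>Exchange: \<open>Y\<close> and \<open>F\<close> are extended by some of the
  \<open>X l\<close> to a basis of the same span, and comparing dimensions shows that exactly
  \<open>card Y\<close> indices of \<open>L\<close> are freed. The freed columns are the source of
  the gain in the swapping argument.\<close>

lemma steinitz_completion:
  assumes X: "inj_on X L" "finite L" and F: "finite F" "F \<inter> X ` L = {}" "ratfun.independent (X ` L \<union> F)"
    and Y: "finite Y" "Y \<inter> F = {}" "ratfun.independent (Y \<union> F)" "Y \<subseteq> ratfun.span (X ` L \<union> F)"
  obtains K where "K \<subseteq> L" "card K + card Y = card L" "ratfun.span (X ` K \<union> Y \<union> F) = ratfun.span (X ` L \<union> F)"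
proof -
  obtain B' where B': "Y \<union> F \<subseteq> B'" "B' \<subseteq> Y \<union> F \<union> X ` L" "ratfun.independent B'"
    "Y \<union> F \<union> X ` L \<subseteq> ratfun.span B'"
    using ratfun.maximal_independent_subset_extend[of "Y \<union> F" "Y \<union> F \<union> X ` L"] Y by blast
  have sp: "ratfun.span B' = ratfun.span (X ` L \<union> F)"
  proof
    show "ratfun.span B' \<subseteq> ratfun.span (X ` L \<union> F)"
      using B'(2) Y(4) ratfun.span_superset[of "X ` L \<union> F"]
      by (intro ratfun.span_minimal[OF _ ratfun.subspace_span]) blast
    show "ratfun.span (X ` L \<union> F) \<subseteq> ratfun.span B'"
      using B'(4) by (intro ratfun.span_minimal[OF _ ratfun.subspace_span]) blast
  qed
  then have c: "card B' = card (X ` L \<union> F)"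
    using B' F by (metis ratfun.dim_span_eq_card_independent)
  define K where "K = {l \<in> L. X l \<in> B' - (Y \<union> F)}"
  have XK: "X ` K = B' - (Y \<union> F)" using B' by (auto simp: K_def)
  have KL: "K \<subseteq> L" by (auto simp: K_def)
  then have "card K = card (X ` K)" using X by (metis card_image inj_on_subset)
  also have "\<dots> = card B' - card (Y \<union> F)"
    unfolding XK using B' Y F by (intro card_Diff_subset) auto
  finally have "card K = card (X ` L \<union> F) - card (Y \<union> F)" using c by simp
  moreover have "card (X ` L \<union> F) = card L + card F"
    using X F by (subst card_Un_disjoint) (auto simp: card_image)
  moreover have "card (Y \<union> F) = card Y + card F" using Y F by (intro card_Un_disjoint) auto
  moreover have "card (Y \<union> F) \<le> card B'"
    using B' X Y F finite_subset[OF B'(2)] by (intro card_mono) auto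
  ultimately have "card K + card Y = card L" using c by simp
  moreover have "X ` K \<union> Y \<union> F = B'" using XK B' by auto
  ultimately show thesis using KL sp by (intro that[of K]) auto
qed

subsection \<open>Product distributions and small ball probabilities\<close>

lemma Pi_pmf_conditioning_nn:
  assumes A: "finite A" "B \<subseteq> A"
    and le: "\<And>f. (\<integral>\<^sup>+g. Q (\<lambda>x. if x \<in> B then g x else f x) \<partial>Pi_pmf B d p) \<le> c"
  shows "(\<integral>\<^sup>+f. Q f \<partial>Pi_pmf A d p) \<le> c"
proof -
  have "Pi_pmf A d p = Pi_pmf (B \<union> (A - B)) d p" using A by (simp add: Un_absorb1)
  also have "\<dots> = map_pmf (\<lambda>(f,g) x. if x \<in> B then f x else g x) (pair_pmf (Pi_pmf B d p) (Pi_pmf (A - B) d p))"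
    using A finite_subset by (intro Pi_pmf_union) auto
  also have "\<dots> = map_pmf (\<lambda>(f,g) x. if x \<in> B then g x else f x) (pair_pmf (Pi_pmf (A - B) d p) (Pi_pmf B d p))"
    by (subst pair_commute_pmf) (simp add: pmf.map_comp o_def case_prod_unfold cong: if_cong)
  finally have "(\<integral>\<^sup>+f. Q f \<partial>Pi_pmf A d p)
    = (\<integral>\<^sup>+f. (\<integral>\<^sup>+g. Q (\<lambda>x. if x \<in> B then g x else f x) \<partial>Pi_pmf B d p) \<partial>Pi_pmf (A - B) d p)"
    by (simp add: nn_integral_pair_pmf' case_prod_beta cong: if_cong)
  also have "\<dots> \<le> (\<integral>\<^sup>+f. c \<partial>Pi_pmf (A - B) d p)"
    by (intro nn_integral_mono le)
  also have "\<dots> = c" by (simp add: measure_pmf.emeasure_space_1)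
  finally show ?thesis .
qed

lemma Pi_pmf_conditioning:
  assumes A: "finite A" "B \<subseteq> A" "c \<ge> 0"
    and le: "\<And>f. measure_pmf.prob (Pi_pmf B d p) {g. Q (\<lambda>x. if x \<in> B then g x else f x)} \<le> c"
  shows "measure_pmf.prob (Pi_pmf A d p) {f. Q f} \<le> c"
proof -
  have "(\<integral>\<^sup>+f. indicator {f. Q f} f \<partial>Pi_pmf A d p) \<le> ennreal c"
  proof (rule Pi_pmf_conditioning_nn[OF A(1,2)])
    fix f
    have "(\<integral>\<^sup>+g. indicator {f. Q f} (\<lambda>x. if x \<in> B then g x else f x) \<partial>Pi_pmf B d p)
      = (\<integral>\<^sup>+g. indicator {g. Q (\<lambda>x. if x \<in> B then g x else f x)} g \<partial>Pi_pmf B d p)"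
      by (intro nn_integral_cong) (simp add: indicator_def)
    also have "\<dots> = ennreal (measure_pmf.prob (Pi_pmf B d p) {g. Q (\<lambda>x. if x \<in> B then g x else f x)})"
      by (simp add: measure_pmf.emeasure_eq_measure)
    also have "\<dots> \<le> ennreal c" using le by (intro ennreal_leI)
    finally show "(\<integral>\<^sup>+g. indicator {f. Q f} (\<lambda>x. if x \<in> B then g x else f x) \<partial>Pi_pmf B d p) \<le> ennreal c" .
  qed
  then show ?thesis using A(3) by (simp add: measure_pmf.emeasure_eq_measure)
qed

lemma Pi_pmf_box:
  assumes "finite A"
  shows "measure_pmf.prob (Pi_pmf A d p) {f. \<forall>x\<in>A. f x \<in> S x} = (\<Prod>x\<in>A. measure_pmf.prob (p x) (S x))"
  using measure_Pi_pmf_Pi[OF assms, of d p S] by (simp add: Pi_def Ball_def)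

lemma Pi_pmf_marginal:
  assumes "finite A" "B \<subseteq> A" "\<And>f g. (\<And>x. x \<in> B \<Longrightarrow> f x = g x) \<Longrightarrow> Q f = Q g"
  shows "measure_pmf.prob (Pi_pmf A d p) {f. Q f} = measure_pmf.prob (Pi_pmf B d p) {f. Q f}"
proof -
  have "(\<lambda>f x. if x \<in> B then f x else d) -` {f. Q f} = {f. Q f}"
    using assms(3)[of "\<lambda>x. if x \<in> B then _ x else d"] by fastforce
  then show ?thesis by (subst Pi_pmf_subset[OF assms(1,2)]) simp
qed

lemma prob_union_le:
  assumes "finite I" "E \<subseteq> (\<Union>i\<in>I. F i)" "\<And>i. i \<in> I \<Longrightarrow> measure_pmf.prob M (F i) \<le> b i"
  shows "measure_pmf.prob M E \<le> (\<Sum>i\<in>I. b i)"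
proof -
  have "measure_pmf.prob M E \<le> measure_pmf.prob M (\<Union>i\<in>I. F i)"
    using assms(2) by (intro measure_pmf.finite_measure_mono) auto
  also have "\<dots> \<le> (\<Sum>i\<in>I. measure_pmf.prob M (F i))"
    using assms(1) by (intro measure_pmf.finite_measure_subadditive_finite) auto
  also have "\<dots> \<le> (\<Sum>i\<in>I. b i)" by (intro sum_mono assms(3))
  finally show ?thesis .
qed

text \<open>Once the coordinates in \<open>D\<close> are frozen, two solutions differ by a vector of
  the span that vanishes on \<open>D\<close>, hence on \<open>I\<close>; so each other coordinate
  has at most one admissible value. The injection \<open>h\<close> absorbs the sign with which
  entries occur in a Laplacian column.\<close>

lemma prob_span_le:
  fixes h :: "'b \<Rightarrow> rat" and p :: "'a \<Rightarrow> 'b pmf" and \<rho> :: real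
  assumes I: "finite I" and G: "finite G" "card G \<le> m" and h: "inj h"
    and p: "\<And>i x. i \<in> I \<Longrightarrow> pmf (p i) x \<le> \<rho>" and \<rho>: "0 \<le> \<rho>" "\<rho> \<le> 1"
  shows "measure_pmf.prob (Pi_pmf I d p) {x. \<exists>v\<in>ratfun.span G. \<forall>i\<in>I. v i = h (x i)} \<le> \<rho> ^ (card I - m)"
proof -
  obtain D where D: "D \<subseteq> I" "finite D" "card D \<le> m"
    "\<And>u. u \<in> ratfun.span G \<Longrightarrow> \<forall>i\<in>D. u i = 0 \<Longrightarrow> \<forall>i\<in>I. u i = 0"
    using span_determining_coordinates[OF G, of I] by metis
  show ?thesis
  proof (rule Pi_pmf_conditioning[where B = "I - D"])
    fix f :: "'a \<Rightarrow> 'b"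
    let ?Q = "\<lambda>x. \<exists>v\<in>ratfun.span G. \<forall>i\<in>I. v i = h (x i)"
    let ?m = "\<lambda>g x. if x \<in> I - D then g x else f x"
    show "measure_pmf.prob (Pi_pmf (I - D) d p) {g. ?Q (?m g)} \<le> \<rho> ^ (card I - m)"
    proof (cases "\<exists>g. ?Q (?m g)")
      case True
      then obtain t v where v: "v \<in> ratfun.span G" "\<forall>i\<in>I. v i = h (?m t i)" by blast
      have "{g. ?Q (?m g)} \<subseteq> {g. \<forall>i\<in>I - D. g i \<in> {t i}}"
      proof safe
        fix g u i assume u: "u \<in> ratfun.span G" "\<forall>i\<in>I. u i = h (?m g i)" and i: "i \<in> I" "i \<notin> D"
        have "u - v \<in> ratfun.span G" using u v by (intro ratfun.span_diff)
        moreover have "\<forall>i\<in>D. (u - v) i = 0" using u v D(1) by (auto simp: subset_iff)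
        ultimately have "(u - v) i = 0" using D(4) i by blast
        then show "g i = t i" using u v i h by (auto simp: inj_def)
      qed
      then have "measure_pmf.prob (Pi_pmf (I - D) d p) {g. ?Q (?m g)}
        \<le> measure_pmf.prob (Pi_pmf (I - D) d p) {g. \<forall>i\<in>I - D. g i \<in> {t i}}"
        by (intro measure_pmf.finite_measure_mono) auto
      also have "\<dots> = (\<Prod>i\<in>I - D. measure_pmf.prob (p i) {t i})"
        using I by (intro Pi_pmf_box) auto
      also have "\<dots> \<le> (\<Prod>i\<in>I - D. \<rho>)"
        using p by (intro prod_mono) (auto simp: measure_pmf_single)
      also have "\<dots> = \<rho> ^ (card I - card D)" using D I by (simp add: card_Diff_subset)
      also have "\<dots> \<le> \<rho> ^ (card I - m)" using D(3) \<rho> by (intro power_decreasing) auto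
      finally show ?thesis .
    next
      case False
      then have e: "{g. ?Q (?m g)} = {}" by blast
      show ?thesis unfolding e using \<rho> by simp
    qed
  qed (use I \<rho> in auto)
qed

text \<open>If an atom of mass \<open>q\<close> of a sum is at least 3/4, adding one more summand
  lowers it to at most \<open>(1 - \<alpha>) q + \<alpha> (1 - q)\<close>.\<close>

lemma prob_linear_form_le:
  fixes u :: "'i \<Rightarrow> rat" and \<alpha> :: real and t :: rat
  assumes "finite S" "\<And>i. i \<in> S \<Longrightarrow> u i \<noteq> 0" "\<And>x. pmf p x \<le> 1 - \<alpha>" "0 \<le> \<alpha>" "\<alpha> \<le> 1"
  shows "measure_pmf.prob (Pi_pmf S d (\<lambda>_. p)) {x. (\<Sum>i\<in>S. of_int (x i) * u i) = t} \<le> max (3/4) (1 - \<alpha> * card S / 2)"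
  using assms(1,2)
proof (induction S arbitrary: t rule: finite_induct)
  case empty
  then show ?case by simp
next
  case (insert a S)
  let ?Z = "\<lambda>x. \<Sum>i\<in>S. of_int (x i) * u i"
  let ?M = "Pi_pmf S d (\<lambda>_. p)"
  let ?P = "\<lambda>s. measure_pmf.prob ?M {x. ?Z x = s}"
  define b where "b = max (3/4) (1 - \<alpha> * card S / 2)"
  have IH: "?P s \<le> b" for s using insert by (auto simp: b_def)
  have ua: "u a \<noteq> 0" using insert by auto
  have "measure_pmf.prob (Pi_pmf (insert a S) d (\<lambda>_. p)) {x. (\<Sum>i\<in>insert a S. of_int (x i) * u i) = t}
    = measure_pmf.prob (pair_pmf p ?M) {(y, x). ?Z x = t - of_int y * u a}"
  proof -
    have "(\<Sum>i\<in>S. of_int (if i = a then y else x i) * u i) = ?Z x" for y x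
      using insert(2) by (intro sum.cong) auto
    then have "(\<lambda>(y, f). f(a := y)) -` {x. (\<Sum>i\<in>insert a S. of_int (x i) * u i) = t} = {(y, x). ?Z x = t - of_int y * u a}"
      using insert(1,2) by (auto simp: fun_upd_apply algebra_simps)
    then show ?thesis using insert(1,2) by (subst Pi_pmf_insert) simp_all
  qed
  also have "\<dots> = measure_pmf.expectation p (\<lambda>y. ?P (t - of_int y * u a))"
  proof -
    have "ennreal (measure_pmf.prob (pair_pmf p ?M) {(y, x). ?Z x = t - of_int y * u a})
      = (\<integral>\<^sup>+z. indicator {(y, x). ?Z x = t - of_int y * u a} z \<partial>pair_pmf p ?M)"
      by (simp add: measure_pmf.emeasure_eq_measure)
    also have "\<dots> = (\<integral>\<^sup>+y. \<integral>\<^sup>+x. indicator {x. ?Z x = t - of_int y * u a} x \<partial>?M \<partial>p)"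
      by (simp add: nn_integral_pair_pmf' indicator_def)
    also have "\<dots> = (\<integral>\<^sup>+y. ennreal (?P (t - of_int y * u a)) \<partial>p)"
      by (simp add: measure_pmf.emeasure_eq_measure)
    also have "\<dots> = ennreal (measure_pmf.expectation p (\<lambda>y. ?P (t - of_int y * u a)))"
      by (intro nn_integral_eq_integral measure_pmf.integrable_const_bound[where B = 1]) auto
    finally show ?thesis by (subst (asm) ennreal_inj) (auto intro!: integral_nonneg_AE)
  qed
  also have "\<dots> \<le> max (3/4) (1 - \<alpha> * card (insert a S) / 2)"
  proof (cases "\<exists>s. ?P s > 3/4")
    case False
    have "measure_pmf.expectation p (\<lambda>y. ?P (t - of_int y * u a)) \<le> measure_pmf.expectation p (\<lambda>y. 3/4)"
      using False by (intro integral_mono measure_pmf.integrable_const_bound[where B = 1]) (auto simp: not_less)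
    then show ?thesis by simp
  next
    case True
    then obtain s where s: "?P s > 3/4" by blast
    define q where "q = ?P s"
    have b: "b = 1 - \<alpha> * card S / 2" "q \<le> 1 - \<alpha> * card S / 2"
      using IH[of s] s by (auto simp: b_def q_def)
    have other: "?P r \<le> 1 - q" if "r \<noteq> s" for r
    proof -
      have "?P r + ?P s = measure_pmf.prob ?M ({x. ?Z x = r} \<union> {x. ?Z x = s})"
        using that by (intro measure_pmf.finite_measure_Union[symmetric]) auto
      also have "\<dots> \<le> 1" by simp
      finally show ?thesis by (simp add: q_def)
    qed
    let ?y = "(t - s) / u a"
    define A where "A = {y. of_int y = ?y}"
    have sA: "t - of_int y * u a = s \<longleftrightarrow> y \<in> A" for y
      using ua by (auto simp: A_def field_simps)
    have pA: "measure_pmf.prob p A \<le> 1 - \<alpha>"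
    proof (cases "A = {}")
      case True
      then show ?thesis using assms by simp
    next
      case False
      then obtain y where "y \<in> A" by blast
      then have "A = {y}" by (force simp: A_def)
      then show ?thesis using assms(3)[of y] by (simp add: measure_pmf_single)
    qed
    have "measure_pmf.expectation p (\<lambda>y. ?P (t - of_int y * u a))
      \<le> measure_pmf.expectation p (\<lambda>y. (1 - q) + (2 * q - 1) * indicator A y)"
    proof (intro integral_mono measure_pmf.integrable_const_bound[where B = 1])
      fix y show "?P (t - of_int y * u a) \<le> (1 - q) + (2 * q - 1) * indicator A y"
        using other sA[of y] by (auto simp: indicator_def q_def)
    qed (use s in \<open>auto simp: indicator_def q_def abs_le_iff\<close>)
    also have "\<dots> = (1 - q) + (2 * q - 1) * measure_pmf.prob p A"
    proof -
      have "integrable p (\<lambda>y. (2 * q - 1) * indicat_real A y)"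
        by (intro integrable_mult_right measure_pmf.integrable_const_bound[where B = 1]) auto
      then show ?thesis by (subst Bochner_Integration.integral_add) simp_all
    qed
    also have "\<dots> \<le> (1 - q) + (2 * q - 1) * (1 - \<alpha>)"
      using pA s by (intro add_left_mono mult_left_mono) (auto simp: q_def)
    also have "\<dots> = q - \<alpha> * (2 * q - 1)" by (simp add: algebra_simps)
    also have "\<dots> \<le> q - \<alpha> * (1 / 2)" using s assms by (intro diff_left_mono mult_left_mono) (auto simp: q_def)
    also have "\<dots> \<le> 1 - \<alpha> * card (insert a S) / 2"
      using b insert(1,2) by (simp add: algebra_simps add_divide_distrib)
    finally show ?thesis by simp
  qed
  finally show ?case .
qed

subsection \<open>Characteristic functions modulo a prime\<close>

lemma integrable_bounded_pmf:
  fixes f :: "'a \<Rightarrow> 'b :: {banach, second_countable_topology}"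
  assumes "\<And>x. norm (f x) \<le> B"
  shows "integrable (measure_pmf p) f"
  using assms by (intro measure_pmf.integrable_const_bound[where B = B]) auto

lemma expectation_prod_Pi_pmf_bounded:
  fixes f :: "'i \<Rightarrow> 'b \<Rightarrow> complex"
  assumes "finite I" "\<And>i x. i \<in> I \<Longrightarrow> norm (f i x) \<le> 1"
  shows "measure_pmf.expectation (Pi_pmf I d p) (\<lambda>y. \<Prod>i\<in>I. f i (y i)) = (\<Prod>i\<in>I. measure_pmf.expectation (p i) (f i))"
proof (cases "I = {}")
  case True
  then show ?thesis by simp
next
  case False
  let ?E = "measure_pmf.expectation (Pi_pmf I d p)"
  have "?E (\<lambda>y. \<Prod>i\<in>I. f i (y i)) = (\<Prod>i\<in>I. ?E (\<lambda>y. f i (y i)))"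
  proof (rule prob_space.indep_vars_lebesgue_integral)
    show "prob_space.indep_vars (measure_pmf (Pi_pmf I d p)) (\<lambda>_. borel) (\<lambda>i y. f i (y i)) I"
      by (rule prob_space.indep_vars_compose2[OF measure_pmf.prob_space_axioms indep_vars_Pi_pmf[OF assms(1)]]) auto
    show "integrable (measure_pmf (Pi_pmf I d p)) (\<lambda>y. f i (y i))" if "i \<in> I" for i
      using assms(2)[OF that] by (intro measure_pmf.integrable_const_bound[where B = 1]) auto
  qed (use assms measure_pmf.prob_space_axioms in auto)
  also have "\<dots> = (\<Prod>i\<in>I. measure_pmf.expectation (p i) (f i))"
  proof (intro prod.cong refl)
    fix i assume i: "i \<in> I"
    have "?E (\<lambda>y. f i (y i)) = measure_pmf.expectation (map_pmf (\<lambda>y. y i) (Pi_pmf I d p)) (f i)"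
      by simp
    also have "map_pmf (\<lambda>y. y i) (Pi_pmf I d p) = p i"
      using assms(1) i by (simp add: Pi_pmf_component)
    finally show "?E (\<lambda>y. f i (y i)) = measure_pmf.expectation (p i) (f i)" .
  qed
  finally show ?thesis .
qed

text \<open>The Fourier transform of the law reduced modulo \<open>m\<close>, at frequency
  \<open>t\<close>.\<close>

definition chi :: "int pmf \<Rightarrow> nat \<Rightarrow> int \<Rightarrow> complex" where
  "chi q m t = measure_pmf.expectation q (\<lambda>x. cis (2 * pi * t * x / m))"

lemma integrable_cis [simp]: "integrable (measure_pmf q) (\<lambda>x. cis (f x))"
  by (intro measure_pmf.integrable_const_bound[where B = 1]) auto

lemma norm_chi_le: "norm (chi q m t) \<le> 1"
proof -
  have "norm (chi q m t) \<le> measure_pmf.expectation q (\<lambda>x. norm (cis (2 * pi * t * x / m)))"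
    unfolding chi_def by (rule integral_norm_bound)
  then show ?thesis by simp
qed

lemma cis_multiple_2pi: "cis (2 * pi * of_int k) = 1"
  by (simp add: complex_eq_iff cos_int_2pin sin_int_2pin)

lemma cis_periodic:
  fixes x :: int
  assumes "m > 0" "t mod int m = s mod int m"
  shows "cis (2 * pi * t * x / m) = cis (2 * pi * s * x / m)"
proof -
  obtain k where k: "t = s + k * int m"
    using assms(2) by (metis mod_eq_dvd_iff dvd_def diff_eq_eq add.commute mult.commute)
  have "2 * pi * t * x / m = 2 * pi * s * x / m + 2 * pi * of_int (k * x)"
    using assms(1) by (simp add: k field_simps)
  then show ?thesis by (simp only: cis_mult[symmetric] cis_multiple_2pi mult_1_right)
qed

lemma chi_periodic: "m > 0 \<Longrightarrow> t mod int m = s mod int m \<Longrightarrow> chi q m t = chi q m s"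
  unfolding chi_def by (intro Bochner_Integration.integral_cong refl cis_periodic)

lemma sum_roots_of_unity:
  fixes x :: int
  assumes m: "m > 0"
  shows "(\<Sum>t<m. cis (2 * pi * real t * x / m)) = (if int m dvd x then of_nat m else 0)"
proof (cases "int m dvd x")
  case True
  then obtain k where k: "x = int m * k" by blast
  have "cis (2 * pi * t * x / m) = 1" for t :: nat
  proof -
    have "2 * pi * t * x / m = 2 * pi * of_int (int t * k)" using m k by (simp add: field_simps)
    then show ?thesis by (simp only: cis_multiple_2pi)
  qed
  then show ?thesis using True by simp
next
  case False
  define z where "z = cis (2 * pi * x / m)"
  have zt: "cis (2 * pi * real t * x / m) = z ^ t" for t :: nat
  proof -
    have "2 * pi * real t * x / m = real t * (2 * pi * x / m)" by simp
    then show ?thesis using Complex.DeMoivre[of "2 * pi * x / m" t] by (simp only: z_def)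
  qed
  have "z ^ m = 1"
  proof -
    have "real m * (2 * pi * x / m) = 2 * pi * x" using m by simp
    then show ?thesis using Complex.DeMoivre[of "2 * pi * x / m" m] by (simp only: z_def cis_multiple_2pi)
  qed
  moreover have "z \<noteq> 1"
  proof
    assume "z = 1"
    then have "cos (2 * pi * x / m) = 1" by (simp add: z_def complex_eq_iff)
    then obtain k :: int where "2 * pi * x / m = k * (2 * pi)"
      by (auto simp: cos_one_2pi_int)
    then have "real_of_int x = of_int (k * int m)" using m by (simp add: field_simps)
    then have "x = k * int m" by (simp only: of_int_eq_iff)
    then show False using False by simp
  qed
  ultimately have "(\<Sum>t<m. z ^ t) = 0" by (simp add: sum_gp_strict geometric_sum)
  then show ?thesis using False by (simp add: zt)
qed

text \<open>Fourier inversion on the cyclic group of order \<open>m\<close>, evaluated at the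
  residue 0.\<close>

lemma prob_dvd_eq:
  assumes m: "m > 0"
  shows "complex_of_real (measure_pmf.prob q {x. int m dvd x}) = (\<Sum>t<m. chi q m (int t)) / m"
proof -
  have "(\<Sum>t<m. chi q m (int t)) = measure_pmf.expectation q (\<lambda>x. \<Sum>t<m. cis (2 * pi * real t * x / m))"
    unfolding chi_def by (subst Bochner_Integration.integral_sum) auto
  also have "\<dots> = measure_pmf.expectation q (\<lambda>x. of_nat m * complex_of_real (indicator {x. int m dvd x} x))"
    unfolding sum_roots_of_unity[OF m] by (intro Bochner_Integration.integral_cong) (auto simp: indicator_def)
  also have "\<dots> = of_nat m * complex_of_real (measure_pmf.expectation q (indicator {x. int m dvd x}))"
    by (simp only: integral_mult_right_zero integral_complex_of_real)
  finally show ?thesis using m by simp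
qed

lemma chi_linear_form:
  assumes "finite I"
  shows "chi (map_pmf (\<lambda>x. \<Sum>i\<in>I. a i * x i) (Pi_pmf I d p)) m t = (\<Prod>i\<in>I. chi (p i) m (a i * t))"
proof -
  have "cis (\<Sum>i\<in>J. f i) = (\<Prod>i\<in>J. cis (f i))" for f and J :: "'a set"
    by (induction J rule: infinite_finite_induct) (auto simp: cis_mult[symmetric])
  then have "cis (2 * pi * t * (\<Sum>i\<in>I. a i * x i) / m) = (\<Prod>i\<in>I. cis (2 * pi * (a i * t) * x i / m))" for x
    by (simp add: sum_distrib_left sum_divide_distrib mult_ac flip: )
  then have "chi (map_pmf (\<lambda>x. \<Sum>i\<in>I. a i * x i) (Pi_pmf I d p)) m t
    = measure_pmf.expectation (Pi_pmf I d p) (\<lambda>x. \<Prod>i\<in>I. cis (2 * pi * (a i * t) * x i / m))"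
    by (simp add: chi_def)
  also have "\<dots> = (\<Prod>i\<in>I. chi (p i) m (a i * t))"
    unfolding chi_def by (subst expectation_prod_Pi_pmf_bounded) (use assms in \<open>auto simp: mult_ac\<close>)
  finally show ?thesis .
qed

section \<open>Symmetrised and lazy entry laws\<close>

definition symm_pmf :: "int pmf \<Rightarrow> int pmf" where
  "symm_pmf p = map_pmf (\<lambda>f. f 1 - f 2) (Pi_pmf {1, 2::nat} 0 (\<lambda>_. p))"

text \<open>For \<mu> between 0 and 1 the transform of this law is real and at least 1 - \<mu>, so
  for small \<mu> Fourier inversion has no cancellation and can be bounded below termwise. Writing
  the three variables as one product over \<open>{0, 1, 2}\<close> brings them within reach of the
  product formula for expectations.\<close>

definition lazy_pmf :: "real \<Rightarrow> int pmf \<Rightarrow> int pmf" where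
  "lazy_pmf \<mu> p = map_pmf (\<lambda>f. f 0 * (f 1 - f 2))
    (Pi_pmf {0, 1, 2::nat} 0 (\<lambda>i. if i = 0 then map_pmf of_bool (bernoulli_pmf \<mu>) else p))"

lemma chi_minus: "chi q m (- t) = cnj (chi q m t)"
  unfolding chi_def by (simp flip: integral_cnj cis_cnj)

lemma chi_symm: "chi (symm_pmf p) m t = complex_of_real ((norm (chi p m t))\<^sup>2)"
proof -
  have "symm_pmf p = map_pmf (\<lambda>x. \<Sum>i\<in>{1,2}. (if i = 1 then 1 else -1) * x i) (Pi_pmf {1, 2::nat} 0 (\<lambda>_. p))"
    by (simp add: symm_pmf_def)
  then have "chi (symm_pmf p) m t = (\<Prod>i\<in>{1, 2::nat}. chi p m ((if i = 1 then 1 else -1) * t))"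
    by (simp only: chi_linear_form finite.intros)
  then show ?thesis unfolding complex_norm_square by (simp add: chi_minus)
qed

lemma chi_lazy:
  assumes \<mu>: "0 \<le> \<mu>" "\<mu> \<le> 1"
  shows "chi (lazy_pmf \<mu> p) m t = complex_of_real (1 - \<mu> + \<mu> * (norm (chi p m t))\<^sup>2)"
proof -
  define P where "P = Pi_pmf {0, 1, 2::nat} (0::int) (\<lambda>i. if i = 0 then map_pmf of_bool (bernoulli_pmf \<mu>) else p)"
  let ?e = "\<lambda>t x. cis (2 * pi * real_of_int t * real_of_int x / m)"
  \<comment> \<open>As the Bernoulli variable is 0 or 1, the exponential splits into two products
    over independent coordinates: \<open>g\<close> covers the value 1, and \<open>h\<close> the
    value 0, where the exponential is 1.\<close>
  define g where "g = (\<lambda>i x. if i = 0 then of_bool (x = (1::int)) else ?e (if i = (1::nat) then t else -t) x)"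
  define h where "h = (\<lambda>i x. if i = (0::nat) then of_bool (x = (0::int)) else (1::complex))"
  have ng: "norm (g i x) \<le> 1" for i x by (simp add: g_def)
  have nh: "norm (h i x) \<le> 1" for i x by (simp add: h_def)
  have bern: "measure_pmf.expectation (bernoulli_pmf \<mu>) F = \<mu> *\<^sub>R F True + (1 - \<mu>) *\<^sub>R F False" for F :: "bool \<Rightarrow> complex"
    by (subst integral_measure_pmf[of UNIV]) (use \<mu> in \<open>auto simp: UNIV_bool\<close>)
  have supp: "f 0 \<in> {0, 1}" if "f \<in> set_pmf P" for f
  proof -
    have "f \<in> PiE_dflt {0,1,2::nat} 0 (set_pmf \<circ> (\<lambda>i. if i = 0 then map_pmf of_bool (bernoulli_pmf \<mu>) else p))"
      using that unfolding P_def by (subst (asm) set_Pi_pmf) (simp_all only: finite.intros)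
    then have "f 0 \<in> set_pmf (map_pmf of_bool (bernoulli_pmf \<mu>))" unfolding PiE_dflt_def by auto
    then show ?thesis by (auto simp: of_bool_def split: if_splits)
  qed
  have "chi (lazy_pmf \<mu> p) m t = measure_pmf.expectation P (\<lambda>f. ?e t (f 0 * (f 1 - f 2)))"
    by (simp add: chi_def lazy_pmf_def P_def)
  also have "\<dots> = measure_pmf.expectation P (\<lambda>f. (\<Prod>i\<in>{0,1,2}. g i (f i)) + (\<Prod>i\<in>{0,1,2}. h i (f i)))"
  proof (rule integral_cong_AE)
    show "AE f in P. ?e t (f 0 * (f 1 - f 2)) = (\<Prod>i\<in>{0,1,2}. g i (f i)) + (\<Prod>i\<in>{0,1,2}. h i (f i))"
    proof (simp only: AE_measure_pmf_iff, intro ballI)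
      fix f assume f: "f \<in> set_pmf P"
      show "?e t (f 0 * (f 1 - f 2)) = (\<Prod>i\<in>{0,1,2}. g i (f i)) + (\<Prod>i\<in>{0,1,2}. h i (f i))"
        using supp[OF f] by (auto simp: g_def h_def cis_mult right_diff_distrib diff_divide_distrib)
    qed
  qed auto
  also have "\<dots> = measure_pmf.expectation P (\<lambda>f. \<Prod>i\<in>{0,1,2}. g i (f i)) + measure_pmf.expectation P (\<lambda>f. \<Prod>i\<in>{0,1,2}. h i (f i))"
  proof (rule Bochner_Integration.integral_add)
    have nb: "norm (\<Prod>i\<in>A. g i (f i)) \<le> 1" "norm (\<Prod>i\<in>A. h i (f i)) \<le> 1" for f A
      unfolding prod_norm[symmetric] using ng nh by (simp_all add: prod_le_1)
    show "integrable P (\<lambda>f. \<Prod>i\<in>{0,1,2}. g i (f i))" "integrable P (\<lambda>f. \<Prod>i\<in>{0,1,2}. h i (f i))"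
      by (rule integrable_bounded_pmf[where B = 1], rule nb)+
  qed
  also have "measure_pmf.expectation P (\<lambda>f. \<Prod>i\<in>{0,1,2}. g i (f i)) = \<mu> * (chi p m t * chi p m (-t))"
    unfolding P_def using \<mu>
    by (subst expectation_prod_Pi_pmf_bounded) (auto simp: ng g_def chi_def bern scaleR_conv_of_real)
  also have "measure_pmf.expectation P (\<lambda>f. \<Prod>i\<in>{0,1,2}. h i (f i)) = 1 - \<mu>"
    unfolding P_def using \<mu>
    by (subst expectation_prod_Pi_pmf_bounded) (auto simp: nh h_def bern scaleR_conv_of_real)
  finally show ?thesis
    by (simp only: chi_minus complex_norm_square[symmetric] of_real_add of_real_mult of_real_diff of_real_1 add.commute)
qed

lemma pmf_symm_le:
  assumes "\<And>x. pmf p x \<le> 1 - \<alpha>" "\<alpha> \<le> 1"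
  shows "pmf (symm_pmf p) x \<le> 1 - \<alpha>"
proof -
  have "pmf (symm_pmf p) x = measure_pmf.prob (Pi_pmf {1, 2::nat} 0 (\<lambda>_. p)) {f. f 1 - f 2 = x}"
    unfolding symm_pmf_def pmf_map by (simp add: vimage_def)
  also have "\<dots> \<le> 1 - \<alpha>"
  proof (rule Pi_pmf_conditioning[where B = "{1}"])
    fix f :: "nat \<Rightarrow> int"
    have e: "{g :: nat \<Rightarrow> int. (if 1 \<in> {1::nat} then g 1 else f 1) - (if 2 \<in> {1::nat} then g 2 else f 2) = x} = {g. \<forall>i\<in>{1}. g i \<in> {x + f 2}}"
      by auto
    have "measure_pmf.prob (Pi_pmf {1::nat} 0 (\<lambda>_. p)) {g. (if 1 \<in> {1::nat} then g 1 else f 1) - (if 2 \<in> {1::nat} then g 2 else f 2) = x}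
      = measure_pmf.prob (Pi_pmf {1::nat} 0 (\<lambda>_. p)) {g. \<forall>i\<in>{1}. g i \<in> {x + f 2}}"
      unfolding e ..
    also have "\<dots> \<le> 1 - \<alpha>"
      using assms by (subst Pi_pmf_box) (auto simp: measure_pmf_single)
    finally show "measure_pmf.prob (Pi_pmf {1::nat} 0 (\<lambda>_. p)) {g. (if 1 \<in> {1::nat} then g 1 else f 1) - (if 2 \<in> {1::nat} then g 2 else f 2) = x} \<le> 1 - \<alpha>" .
  qed (use assms in auto)
  finally show ?thesis .
qed

text \<open>The value 0 is missed whenever the Bernoulli variable is 1 and the two copies differ, an
  event of probability at least \<mu> \<alpha>. Any other value requires the Bernoulli variable to
  be 1, so has probability at most \<mu> \<le> 1/2 \<le> 1 - \<mu> \<alpha>.\<close>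

lemma pmf_lazy_le:
  assumes "\<And>x. pmf p x \<le> 1 - \<alpha>" "0 \<le> \<alpha>" "\<alpha> \<le> 1" and \<mu>: "0 \<le> \<mu>" "\<mu> \<le> 1/2"
  shows "pmf (lazy_pmf \<mu> p) x \<le> 1 - \<mu> * \<alpha>"
proof -
  let ?q = "\<lambda>i::nat. if i = 0 then map_pmf of_bool (bernoulli_pmf \<mu>) else p"
  have b1: "measure_pmf.prob (map_pmf of_bool (bernoulli_pmf \<mu>)) {1::int} = \<mu>"
  proof -
    have v: "of_bool -` {1::int} = {True}" by auto
    show ?thesis unfolding measure_map_pmf v using \<mu> by (simp add: measure_pmf_single)
  qed
  have \<mu>\<alpha>: "\<mu> * \<alpha> \<le> 1/2" using mult_mono[of \<mu> "1/2" \<alpha> 1] assms by auto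
  have "pmf (lazy_pmf \<mu> p) x = measure_pmf.prob (Pi_pmf {0, 1, 2::nat} 0 ?q) {f. f 0 * (f 1 - f 2) = x}"
    unfolding lazy_pmf_def pmf_map by (simp add: vimage_def)
  also have "\<dots> \<le> 1 - \<mu> * \<alpha>"
  proof (cases "x = 0")
    case True
    show ?thesis
    proof (rule Pi_pmf_conditioning[where B = "{0, 1}"])
      fix f :: "nat \<Rightarrow> int"
      let ?E = "{g. \<forall>i\<in>{0, 1::nat}. g i \<in> (if i = 0 then {1} else - {f 2})}"
      let ?P = "Pi_pmf {0, 1::nat} 0 ?q"
      have "measure_pmf.prob ?P {g. (if 0 \<in> {0, 1::nat} then g 0 else f 0) * ((if 1 \<in> {0, 1::nat} then g 1 else f 1) - (if 2 \<in> {0, 1::nat} then g 2 else f 2)) = x}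
        \<le> measure_pmf.prob ?P (- ?E)"
        using True by (intro measure_pmf.finite_measure_mono) auto
      also have "\<dots> = 1 - measure_pmf.prob ?P ?E"
        using measure_pmf.prob_compl[of ?E ?P] by (simp add: Compl_eq_Diff_UNIV)
      also have "measure_pmf.prob ?P ?E = \<mu> * measure_pmf.prob p (- {f 2})"
        by (subst Pi_pmf_box) (auto simp: b1 simp del: measure_map_pmf)
      also have "measure_pmf.prob p (- {f 2}) = 1 - pmf p (f 2)"
        using measure_pmf.prob_compl[of "{f 2}" p] by (simp add: Compl_eq_Diff_UNIV measure_pmf_single)
      also have "1 - \<mu> * (1 - pmf p (f 2)) \<le> 1 - \<mu> * \<alpha>"
        using assms(1)[of "f 2"] \<mu> by (intro diff_left_mono mult_left_mono) auto
      finally show "measure_pmf.prob ?P {g. (if 0 \<in> {0, 1::nat} then g 0 else f 0) * ((if 1 \<in> {0, 1::nat} then g 1 else f 1) - (if 2 \<in> {0, 1::nat} then g 2 else f 2)) = x} \<le> 1 - \<mu> * \<alpha>" .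
    qed (use \<mu>\<alpha> in auto)
  next
    case False
    have "measure_pmf.prob (Pi_pmf {0, 1, 2::nat} 0 ?q) {f. f 0 * (f 1 - f 2) = x}
      \<le> measure_pmf.prob (Pi_pmf {0, 1, 2::nat} 0 ?q) {f. \<forall>i\<in>{0,1,2}. f i \<in> (if i = 0 then - {0} else UNIV)}"
      using False by (intro measure_pmf.finite_measure_mono) auto
    also have "\<dots> = measure_pmf.prob (map_pmf of_bool (bernoulli_pmf \<mu>)) (- {0::int})"
      by (subst Pi_pmf_box) auto
    also have "\<dots> = \<mu>"
    proof -
      have v: "of_bool -` (- {0::int}) = {True}" by auto
      show ?thesis unfolding measure_map_pmf v using \<mu> by (simp add: measure_pmf_single)
    qed
    finally show ?thesis using \<mu>\<alpha> \<mu> by simp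
  qed
  finally show ?thesis .
qed

text \<open>Lets inequalities for \<open>1 - cos\<close> pass to the transform by averaging.\<close>

lemma one_minus_norm_chi:
  "1 - (norm (chi p m t))\<^sup>2 = measure_pmf.expectation (symm_pmf p) (\<lambda>x. 1 - cos (2 * pi * t * x / m))"
proof -
  have "(norm (chi p m t))\<^sup>2 = Re (chi (symm_pmf p) m t)" by (simp add: chi_symm)
  also have "\<dots> = measure_pmf.expectation (symm_pmf p) (\<lambda>x. cos (2 * pi * t * x / m))"
    unfolding chi_def by (subst integral_Re[symmetric]) auto
  finally show ?thesis
    by (subst Bochner_Integration.integral_diff)
      (auto intro!: measure_pmf.integrable_const_bound[where B = 1])
qed

text \<open>With a = |sin (x/2)| and b = |sin (y/2)| this is (a + b)^2 \<le> (1 + l) a^2 + (1 + 1/l)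
  b^2. Unlike the triangle inequality for the square root of \<open>1 - cos\<close>, this form is
  linear in both terms and so survives expectations and sums; the optimisation over \<open>l\<close>
  is postponed until after them.\<close>

lemma one_minus_cos_add_le:
  fixes l :: real
  assumes "l > 0"
  shows "1 - cos (x + y) \<le> (1 + l) * (1 - cos x) + (1 + 1 / l) * (1 - cos y)"
proof -
  have h: "1 - cos z = 2 * (sin (z / 2))\<^sup>2" for z :: real
    using cos_double_sin[of "z/2"] by simp
  let ?a = "sin (x/2)" and ?b = "sin (y/2)"
  have "\<bar>sin (x/2 + y/2)\<bar> \<le> \<bar>?a\<bar> + \<bar>?b\<bar>"
  proof -
    have "\<bar>sin (x/2 + y/2)\<bar> \<le> \<bar>?a * cos (y/2)\<bar> + \<bar>cos (x/2) * ?b\<bar>"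
      unfolding sin_add by (rule abs_triangle_ineq)
    also have "\<dots> \<le> \<bar>?a\<bar> + \<bar>?b\<bar>"
      unfolding abs_mult by (intro add_mono mult_left_le mult_left_le_one_le) auto
    finally show ?thesis .
  qed
  then have "(sin ((x+y)/2))\<^sup>2 \<le> (\<bar>?a\<bar> + \<bar>?b\<bar>)\<^sup>2"
    by (metis abs_ge_zero add_divide_distrib power2_abs power_mono)
  also have "\<dots> \<le> (1 + l) * ?a\<^sup>2 + (1 + 1 / l) * ?b\<^sup>2"
  proof -
    have "0 \<le> (l * \<bar>?a\<bar> - \<bar>?b\<bar>)\<^sup>2 / l" using assms by simp
    also have "\<dots> = (1 + l) * ?a\<^sup>2 + (1 + 1 / l) * ?b\<^sup>2 - (\<bar>?a\<bar> + \<bar>?b\<bar>)\<^sup>2"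
      using assms by (simp add: power2_eq_square field_simps flip: abs_mult)
    finally show ?thesis by simp
  qed
  finally show ?thesis unfolding h by (simp add: algebra_simps)
qed

subsection \<open>The Fourier comparison\<close>

lemma finite_attains_max:
  fixes f :: "'a \<Rightarrow> real"
  assumes "finite A" "A \<noteq> {}"
  shows "\<exists>a\<in>A. \<forall>x\<in>A. f x \<le> f a"
proof -
  have "Max (f ` A) \<in> f ` A" using assms by (intro Max_in) auto
  then obtain a where "a \<in> A" "Max (f ` A) = f a" by blast
  then show ?thesis using assms by (metis Max_ge finite_imageI image_eqI)
qed

text \<open>If the sublevel counts of \<open>g\<close> on \<open>B\<close> dominate those of \<open>f\<close> on \<open>A\<close>, then \<open>A\<close>
  can be matched into \<open>B\<close> without increasing the level.\<close>

lemma sum_le_by_sublevel_counts: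
  fixes f :: "'a \<Rightarrow> real" and g :: "'b \<Rightarrow> real" and F :: "'a \<Rightarrow> real" and G :: "'b \<Rightarrow> real"
  assumes "finite A" "finite B"
    and "\<And>r. card {x\<in>A. f x \<le> r} \<le> card {y\<in>B. g y \<le> r}"
    and "\<And>x y. x \<in> A \<Longrightarrow> y \<in> B \<Longrightarrow> g y \<le> f x \<Longrightarrow> F x \<le> G y"
    and "\<And>y. y \<in> B \<Longrightarrow> 0 \<le> G y"
  shows "sum F A \<le> sum G B"
  using assms
proof (induction "card A" arbitrary: A B)
  case 0
  then show ?case by (simp add: sum_nonneg)
next
  case (Suc n)
  then have ne: "A \<noteq> {}" by auto
  obtain a where a: "a \<in> A" "\<forall>x\<in>A. f x \<le> f a"
    using ne Suc.prems(1) by (metis finite_attains_max)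
  have Aa: "{x\<in>A. f x \<le> f a} = A" using a by auto
  define C where "C = {y\<in>B. g y \<le> f a}"
  have CA: "card A \<le> card C" using Suc.prems(3)[of "f a"] by (simp add: Aa C_def)
  then have "C \<noteq> {}" using Suc(2) by auto
  moreover have "finite C" using Suc.prems by (simp add: C_def)
  ultimately obtain b where b: "b \<in> C" "\<forall>y\<in>C. g y \<le> g b"
    by (metis finite_attains_max)
  have bB: "b \<in> B" "g b \<le> f a" using b by (auto simp: C_def)
  \<comment> \<open>Removing the top element \<open>a\<close> together with the highest
    \<open>b\<close> not above it preserves the domination of sublevel counts.\<close>
  have "sum F (A - {a}) \<le> sum G (B - {b})"
  proof (rule Suc.hyps(1))
    show "n = card (A - {a})" using a Suc.hyps(2) Suc.prems(1) by simp
    fix r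
    have eA: "{x \<in> A - {a}. f x \<le> r} = {x \<in> A. f x \<le> r} - {a}" and eB: "{y \<in> B - {b}. g y \<le> r} = {y \<in> B. g y \<le> r} - {b}"
      by auto
    have fin: "finite {x \<in> A. f x \<le> r}" "finite {y \<in> B. g y \<le> r}" using Suc.prems by auto
    show "card {x \<in> A - {a}. f x \<le> r} \<le> card {y \<in> B - {b}. g y \<le> r}"
    proof (cases "g b \<le> r")
      case False
      then have "card {y \<in> B - {b}. g y \<le> r} = card {y \<in> B. g y \<le> r}" unfolding eB by simp
      moreover have "card {x \<in> A - {a}. f x \<le> r} \<le> card {x \<in> A. f x \<le> r}"
        using fin by (intro card_mono) auto
      ultimately show ?thesis using Suc.prems(3)[of r] by simp
    next
      case True
      then have cB: "card {y \<in> B - {b}. g y \<le> r} = card {y \<in> B. g y \<le> r} - 1"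
        unfolding eB using fin bB by simp
      show ?thesis
      proof (cases "f a \<le> r")
        case True
        then have "card {x \<in> A - {a}. f x \<le> r} = card {x \<in> A. f x \<le> r} - 1"
          unfolding eA using fin a by simp
        then show ?thesis using cB Suc.prems(3)[of r] by simp
      next
        case False
        \<comment> \<open>Here \<open>g b \<le> r < f a\<close>, and no element of \<open>C\<close>
          exceeds the level \<open>g b\<close>; so all of \<open>C\<close>, at least
          \<open>card A\<close> elements, lies below \<open>r\<close>, which leaves room for
          removing \<open>b\<close>.\<close>
        have "C \<subseteq> {y \<in> B. g y \<le> r}" using b(2) True by (auto simp: C_def)
        then have "card A \<le> card {y \<in> B. g y \<le> r}" using CA fin card_mono by (metis le_trans)
        moreover have "card {x \<in> A - {a}. f x \<le> r} \<le> card (A - {a})"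
          using Suc.prems(1) by (intro card_mono) auto
        ultimately show ?thesis using cB a Suc.prems(1) by simp
      qed
    qed
  qed (use Suc.prems in auto)
  moreover have "F a \<le> G b" using Suc.prems(4) a bB by auto
  ultimately show ?case
    using a bB Suc.prems(1,2) by (simp add: sum.remove)
qed

text \<open>A seminorm on the cyclic group of prime order \<open>p\<close> moves in steps of size at most \<open>r\<close> along
  the multiples of a nonzero element of norm at most \<open>r\<close>, so every annulus of width \<open>r\<close>
  below the maximum is hit; translates of the \<open>r\<close>-ball by points of separated annuli are disjoint.\<close>

lemma seminorm_ball_growth:
  fixes N :: "int \<Rightarrow> real" and p :: nat and r R :: real
  assumes p: "prime p"
    and per: "\<And>s t. s mod int p = t mod int p \<Longrightarrow> N s = N t"
    and N0: "N 0 = 0" and N_minus: "\<And>t. N (- t) = N t"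
    and N_add: "\<And>s t. N (s + t) \<le> N s + N t"
    and R: "N tmax = R" "0 < R" and r: "3 * real k * r \<le> R"
  shows "k * card {t\<in>{1..<int p}. N t \<le> r} \<le> card {t\<in>{0..<int p}. N t \<le> 3 * real k * r}"
proof (cases "{t\<in>{1..<int p}. N t \<le> r} = {}")
  case True
  then show ?thesis by (simp only: True card.empty)
next
  case False
  then obtain t0 where t0: "t0 \<in> {1..<int p}" "N t0 \<le> r" by blast
  have N_nonneg: "0 \<le> N t" for t using N_add[of t "-t"] by (simp add: N_minus N0)
  have N_diff: "N (s + t) \<ge> N s - N t" for s t
    using N_add[of "s + t" "- t"] by (simp add: N_minus)
  have mult_le: "N (int j * t0) \<le> real j * N t0" for j
  proof (induction j)
    case (Suc j)
    have "N (int (Suc j) * t0) \<le> N (int j * t0) + N t0"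
      using N_add[of "int j * t0" t0] by (simp add: algebra_simps)
    then show ?case using Suc by (simp add: algebra_simps)
  qed (simp add: N0)
  have p0: "p > 0" using p prime_gt_0_nat by blast
  \<comment> \<open>As \<open>p\<close> is prime, \<open>t0\<close> is invertible modulo
    \<open>p\<close>, so some multiple of it is congruent to \<open>tmax\<close>.\<close>
  obtain m :: nat where m: "N (int m * t0) = R"
  proof -
    have "\<not> int p dvd t0" using t0 zdvd_not_zless by auto
    then have "coprime t0 (int p)" using p prime_imp_coprime[of "int p" t0] by (simp add: coprime_commute)
    then obtain c where c: "[t0 * c = 1] (mod int p)" using cong_solve_coprime_int by blast
    define m where "m = nat ((c * tmax) mod int p)"
    have "int m = (c * tmax) mod int p" using p0 by (simp add: m_def)
    then have "[int m * t0 = c * tmax * t0] (mod int p)" by (simp add: cong_def mod_mult_left_eq)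
    also have "c * tmax * t0 = (t0 * c) * tmax" by (simp add: mult_ac)
    also have "[(t0 * c) * tmax = 1 * tmax] (mod int p)" using c by (rule cong_scalar_right)
    finally have "(int m * t0) mod int p = tmax mod int p" by (simp add: cong_def)
    from per[OF this] R show thesis by (intro that[of m]) simp
  qed
  have rpos: "r > 0"
  proof (rule ccontr)
    assume "\<not> r > 0"
    then have "N t0 = 0" using t0 N_nonneg[of t0] by simp
    then show False using mult_le[of m] m R by simp
  qed
  have hit: "\<exists>x. s \<le> N x \<and> N x < s + r" if s: "0 \<le> s" "s \<le> R" for s
  proof -
    define j where "j = (LEAST j. s \<le> N (int j * t0))"
    have j: "s \<le> N (int j * t0)" unfolding j_def by (rule LeastI[of _ m]) (use m s in simp)
    show ?thesis
    proof (cases j)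
      case 0
      then show ?thesis using j s rpos N0 by (intro exI[of _ 0]) auto
    next
      case (Suc i)
      then have "\<not> s \<le> N (int i * t0)" unfolding j_def using not_less_Least by (metis lessI)
      then have "N (int j * t0) < s + r"
        using N_add[of "int i * t0" t0] t0 Suc by (simp add: algebra_simps)
      then show ?thesis using j by blast
    qed
  qed
  \<comment> \<open>Why the spacing is \<open>3 * r\<close>: the translate of the
    \<open>r\<close>-ball by \<open>x l\<close> has norms from \<open>3 * r * l - r\<close> to below
    \<open>3 * r * l + 2 * r\<close>, and these ranges are disjoint for different
    \<open>l\<close>.\<close>
  have "\<exists>x. \<forall>l<k. 3 * r * l \<le> N (x l) \<and> N (x l) < 3 * r * l + r"
  proof -
    have "\<forall>l<k. \<exists>x. 3 * r * l \<le> N x \<and> N x < 3 * r * l + r"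
    proof (intro allI impI)
      fix l assume l: "l < k"
      have "3 * r * real l \<le> 3 * r * real k" using l rpos by (intro mult_left_mono) auto
      also have "\<dots> \<le> R" using r by (simp add: mult_ac)
      finally show "\<exists>x. 3 * r * l \<le> N x \<and> N x < 3 * r * l + r"
        using rpos by (intro hit) auto
    qed
    then show ?thesis by (metis)
  qed
  then obtain x where x: "\<And>l. l < k \<Longrightarrow> 3 * r * l \<le> N (x l)" "\<And>l. l < k \<Longrightarrow> N (x l) < 3 * r * l + r"
    by blast
  let ?B = "{t\<in>{1..<int p}. N t \<le> r}"
  let ?g = "\<lambda>(l, t). (x l + t) mod int p"
  have Ng: "3 * r * l - r \<le> N (?g (l, t))" "N (?g (l, t)) < 3 * r * l + 2 * r" if "l < k" "t \<in> ?B" for l t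
  proof -
    have "N (?g (l, t)) = N (x l + t)" by (simp add: per[of "(x l + t) mod int p" "x l + t"])
    then show "3 * r * l - r \<le> N (?g (l, t))" "N (?g (l, t)) < 3 * r * l + 2 * r"
      using N_diff[of "x l" t] N_add[of "x l" t] x[OF that(1)] that(2) by auto
  qed
  have "inj_on ?g ({..<k} \<times> ?B)"
  proof (rule inj_onI)
    fix u v assume uv: "u \<in> {..<k} \<times> ?B" "v \<in> {..<k} \<times> ?B" "?g u = ?g v"
    obtain l t l' t' where lt: "u = (l, t)" "v = (l', t')" by (cases u, cases v) auto
    have b: "l < k" "t \<in> ?B" "l' < k" "t' \<in> ?B" using uv lt by auto
    have "\<not> l < l'" if "l < k" "t \<in> ?B" "l' < k" "t' \<in> ?B" "?g (l, t) = ?g (l', t')" for l l' :: nat and t t'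
    proof
      assume "l < l'"
      then have "3 * r * real (l + 1) \<le> 3 * r * l'" using rpos by (intro mult_left_mono) auto
      then show False using Ng(2)[OF that(1,2)] Ng(1)[OF that(3,4)] that(5) by (simp add: algebra_simps)
    qed
    from this[of l t l' t'] this[of l' t' l t] have "l = l'" using b uv(3) lt by (simp add: not_less)
    then have "(x l + t) mod int p = (x l + t') mod int p" using uv(3) lt by simp
    then have "int p dvd t - t'" by (simp add: mod_eq_dvd_iff)
    moreover have "\<bar>t - t'\<bar> < int p" using b by auto
    ultimately have "t = t'" by (metis dvd_imp_le_int eq_iff_diff_eq_0 not_le abs_of_nat)
    then show "u = v" using lt \<open>l = l'\<close> by simp
  qed
  then have "k * card ?B = card (?g ` ({..<k} \<times> ?B))"
    by (simp add: card_image card_cartesian_product)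
  also have "\<dots> \<le> card {t\<in>{0..<int p}. N t \<le> 3 * real k * r}"
  proof (intro card_mono)
    show "?g ` ({..<k} \<times> ?B) \<subseteq> {t\<in>{0..<int p}. N t \<le> 3 * real k * r}"
    proof
      fix y assume "y \<in> ?g ` ({..<k} \<times> ?B)"
      then obtain l t where lt: "l < k" "t \<in> ?B" "y = ?g (l, t)" by auto
      have "r * real (l + 1) \<le> r * k" using lt(1) rpos by (intro mult_left_mono) auto
      then have "N y \<le> 3 * real k * r" using Ng(2)[OF lt(1,2)] lt(3) rpos by (simp add: algebra_simps)
      then show "y \<in> {t\<in>{0..<int p}. N t \<le> 3 * real k * r}" using lt(3) p0 by simp
    qed
    show "finite {t\<in>{0..<int p}. N t \<le> 3 * real k * r}" by (rule finite_subset[of _ "{0..<int p}"]) auto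
  qed
  finally show ?thesis .
qed

lemma exp_minus_2_le:
  fixes x :: real
  assumes "0 \<le> x" "x \<le> 1/2"
  shows "exp (- 2 * x) \<le> 1 - x"
proof -
  have "1 \<le> (1 - x) * (1 + 2 * x)" using mult_nonneg_nonneg[of x "1 - 2 * x"] assms by (simp add: algebra_simps)
  also have "\<dots> \<le> (1 - x) * exp (2 * x)" using exp_ge_add_one_self[of "2 * x"] assms by (intro mult_left_mono) auto
  finally show ?thesis by (simp add: exp_minus field_simps)
qed

lemma le_exp_half_square:
  fixes c :: real
  assumes "0 \<le> c"
  shows "c \<le> exp (- (1 - c\<^sup>2) / 2)"
proof (rule power2_le_imp_le)
  have "c\<^sup>2 \<le> exp (c\<^sup>2 - 1)" using exp_ge_add_one_self[of "c\<^sup>2 - 1"] by simp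
  also have "\<dots> = (exp (- (1 - c\<^sup>2) / 2))\<^sup>2" by (simp add: power2_eq_square flip: exp_add)
  finally show "c\<^sup>2 \<le> (exp (- (1 - c\<^sup>2) / 2))\<^sup>2" .
qed simp

text \<open>The infimum over \<open>l\<close> of the right-hand side is (sqrt a + sqrt b)^2, reached
  at l = sqrt b / sqrt a when both are positive.\<close>

lemma sqrt_triangle_from_weighted:
  fixes a b c :: real
  assumes "0 \<le> a" "0 \<le> b" "\<And>l. l > 0 \<Longrightarrow> c \<le> (1 + l) * a + (1 + 1 / l) * b"
  shows "sqrt c \<le> sqrt a + sqrt b"
proof -
  have "c \<le> (sqrt a + sqrt b)\<^sup>2"
  proof (rule field_le_epsilon)
    fix e :: real assume e: "e > 0"
    \<comment> \<open>The shift \<open>d\<close> keeps the quotient used for \<open>l\<close>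
      defined and positive when \<open>a\<close> or \<open>b\<close> is 0; its cost
      \<open>d * (sqrt a + sqrt b)\<close> is at most \<open>e\<close>.\<close>
    define d where "d = e / (sqrt a + sqrt b + 1)"
    have s: "sqrt a \<ge> 0" "sqrt b \<ge> 0" using assms by auto
    have d: "d > 0" using e s by (auto simp: d_def intro!: divide_pos_pos add_nonneg_pos)
    have de: "d * (sqrt a + sqrt b) \<le> e"
    proof -
      have "e * (sqrt a + sqrt b) \<le> e * (sqrt a + sqrt b + 1)" using e by (intro mult_left_mono) auto
      moreover have "sqrt a + sqrt b + 1 > 0" using s by linarith
      ultimately show ?thesis by (simp add: d_def pos_divide_le_eq)
    qed
    let ?A = "sqrt a + d" and ?B = "sqrt b + d"
    have AB: "?A > 0" "?B > 0" using add_nonneg_pos[OF s(1) d] add_nonneg_pos[OF s(2) d] by auto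
    have "?B / ?A * a \<le> ?B * sqrt a"
    proof -
      have "a = sqrt a * sqrt a" using assms by simp
      also have "\<dots> \<le> ?A * sqrt a" using s d by (intro mult_right_mono) auto
      finally have "?B * a \<le> ?B * (?A * sqrt a)" using AB by (intro mult_left_mono) auto
      then show ?thesis using AB by (simp add: pos_divide_le_eq mult_ac)
    qed
    moreover have "?A / ?B * b \<le> ?A * sqrt b"
    proof -
      have "b = sqrt b * sqrt b" using assms by simp
      also have "\<dots> \<le> ?B * sqrt b" using s d by (intro mult_right_mono) auto
      finally have "?A * b \<le> ?A * (?B * sqrt b)" using AB by (intro mult_left_mono) auto
      then show ?thesis using AB by (simp add: pos_divide_le_eq mult_ac)
    qed
    moreover have "c \<le> (1 + ?B / ?A) * a + (1 + 1 / (?B / ?A)) * b"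
      using AB by (intro assms(3)) simp
    ultimately have "c \<le> a + b + ?B * sqrt a + ?A * sqrt b" by (simp add: algebra_simps)
    also have "\<dots> = (sqrt a + sqrt b)\<^sup>2 + d * (sqrt a + sqrt b)"
      using assms by (simp add: power2_eq_square algebra_simps)
    also have "\<dots> \<le> (sqrt a + sqrt b)\<^sup>2 + e" using de by simp
    finally show "c \<le> (sqrt a + sqrt b)\<^sup>2 + e" .
  qed
  then have "sqrt c \<le> sqrt ((sqrt a + sqrt b)\<^sup>2)" by (rule real_sqrt_le_mono)
  then show ?thesis using assms by simp
qed

text \<open>The square root \<open>N\<close> of \<psi> is a seminorm on the integers modulo
  \<open>p\<close>. The true transform has norm at most exp (- \<psi> / 2), the lazy one is at least
  exp (- 2 \<mu> \<psi>). Ball growth matches each nonzero frequency of small norm with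
  \<open>k\<close> frequencies of norm at most \<open>3 * k\<close> times as large, hence with
  \<psi> at most 9 k^2 times as large; the value \<mu> = 1 / (36 k^2) makes the two exponentials
  meet. Frequency 0 yields \<open>1 / p\<close>, and the frequencies of large norm yield the
  exponential error.\<close>

lemma halasz_comparison_mod_prime:
  fixes a :: "'i \<Rightarrow> int" and q :: "int pmf" and k p :: nat
  assumes I: "finite I" and p: "prime p" and k: "k \<ge> 1"
  defines "\<delta> \<equiv> measure_pmf.prob (symm_pmf q) {x. \<not> int p dvd x}"
    and "s \<equiv> card {i\<in>I. \<not> int p dvd a i}"
    and "\<mu> \<equiv> 1 / (36 * (real k)\<^sup>2)"
  shows "measure_pmf.prob (Pi_pmf I 0 (\<lambda>_. q)) {x. int p dvd (\<Sum>i\<in>I. a i * x i)}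
    \<le> 1 / p + measure_pmf.prob (Pi_pmf I 0 (\<lambda>_. lazy_pmf \<mu> q)) {x. int p dvd (\<Sum>i\<in>I. a i * x i)} / k
      + exp (- (s * \<delta>) / (18 * (real k)\<^sup>2))" (is "?PX \<le> 1 / p + ?PY / k + _")
proof -
  define u where "u = (\<lambda>t. 1 - (norm (chi q p t))\<^sup>2)"
  define \<psi> where "\<psi> = (\<lambda>t. \<Sum>i\<in>I. u (a i * t))"
  define N where "N = (\<lambda>t. sqrt (\<psi> t))"
  have p0: "p > 0" using p prime_gt_0_nat by blast
  have k0: "real k > 0" using k by simp
  have u01: "0 \<le> u t" "u t \<le> 1" for t
    using norm_chi_le[of q p t] by (auto simp: u_def power_le_one)
  have \<psi>0: "0 \<le> \<psi> t" for t unfolding \<psi>_def by (intro sum_nonneg u01)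
  have Nsq: "(N t)\<^sup>2 = \<psi> t" for t using \<psi>0 by (simp add: N_def)
  have N_nonneg: "0 \<le> N t" for t using \<psi>0 by (simp add: N_def)
  have per: "N s = N t" if "s mod int p = t mod int p" for s t
  proof -
    have "u (a i * s) = u (a i * t)" for i
      unfolding u_def using that p0 by (subst chi_periodic[where s = "a i * t"]) (auto intro: mod_mult_cong)
    then show ?thesis by (simp add: N_def \<psi>_def)
  qed
  have N0: "N 0 = 0" by (simp add: N_def \<psi>_def u_def chi_def)
  have Nm: "N (- t) = N t" for t by (simp add: N_def \<psi>_def u_def chi_minus)
  have u_add: "u (s + t) \<le> (1 + l) * u s + (1 + 1 / l) * u t" if "l > 0" for s t l
  proof -
    let ?c = "\<lambda>t x. 2 * pi * real_of_int t * real_of_int x / p"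
    have int: "integrable (symm_pmf q) (\<lambda>x. 1 - cos (?c t x))" for t
      by (rule integrable_bounded_pmf[where B = 2]) (smt (verit) cos_ge_minus_one cos_le_one real_norm_def)
    have "u (s + t) = measure_pmf.expectation (symm_pmf q) (\<lambda>x. 1 - cos (?c (s + t) x))"
      unfolding u_def one_minus_norm_chi ..
    also have "\<dots> \<le> measure_pmf.expectation (symm_pmf q) (\<lambda>x. (1 + l) * (1 - cos (?c s x)) + (1 + 1 / l) * (1 - cos (?c t x)))"
    proof (intro integral_mono int Bochner_Integration.integrable_add integrable_mult_right)
      fix x
      have "?c (s + t) x = ?c s x + ?c t x" by (simp add: ring_distribs add_divide_distrib)
      then show "1 - cos (?c (s + t) x) \<le> (1 + l) * (1 - cos (?c s x)) + (1 + 1 / l) * (1 - cos (?c t x))"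
        using one_minus_cos_add_le[OF that] by simp
    qed
    also have "\<dots> = (1 + l) * u s + (1 + 1 / l) * u t"
      unfolding u_def one_minus_norm_chi
      by (simp only: Bochner_Integration.integral_add[OF integrable_mult_right[OF int] integrable_mult_right[OF int]] integral_mult_right_zero)
    finally show ?thesis .
  qed
  have Nadd: "N (s + t) \<le> N s + N t" for s t
    unfolding N_def
  proof (rule sqrt_triangle_from_weighted[OF \<psi>0 \<psi>0])
    fix l :: real assume "l > 0"
    then have "\<psi> (s + t) \<le> (\<Sum>i\<in>I. (1 + l) * u (a i * s) + (1 + 1 / l) * u (a i * t))"
      unfolding \<psi>_def by (intro sum_mono) (simp add: distrib_left u_add)
    then show "\<psi> (s + t) \<le> (1 + l) * \<psi> s + (1 + 1 / l) * \<psi> t"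
      by (simp add: \<psi>_def sum.distrib sum_distrib_left)
  qed
  \<comment> \<open>By inversion, the mean over \<open>t\<close> of the squared norm of
    \<open>chi\<close> at \<open>a i * t\<close> is the probability that \<open>p\<close> divides
    \<open>a i * x\<close> for a symmetrised \<open>x\<close>. The resulting mean of \<psi> is a
    lower bound for its maximum R^2.\<close>
  have sum_\<psi>: "(\<Sum>t<p. \<psi> (int t)) = p * (s * \<delta>)"
  proof -
    have "(\<Sum>t<p. u (a i * int t)) = p * (if int p dvd a i then 0 else \<delta>)" for i
    proof -
      let ?m = "map_pmf (\<lambda>x. a i * x) (symm_pmf q)"
      have "complex_of_real ((norm (chi q p (a i * int t)))\<^sup>2) = chi ?m p (int t)" for t
        unfolding chi_symm[symmetric] by (simp add: chi_def mult_ac)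
      then have "complex_of_real (\<Sum>t<p. u (a i * int t)) = of_nat p - (\<Sum>t<p. chi ?m p (int t))"
        by (simp add: u_def sum_subtractf)
      also have "(\<Sum>t<p. chi ?m p (int t)) = of_nat p * complex_of_real (measure_pmf.prob ?m {x. int p dvd x})"
        using p0 by (simp add: prob_dvd_eq del: measure_map_pmf)
      finally have "complex_of_real (\<Sum>t<p. u (a i * int t)) = complex_of_real (p - p * measure_pmf.prob ?m {x. int p dvd x})"
        by simp
      then have 1: "(\<Sum>t<p. u (a i * int t)) = p * (1 - measure_pmf.prob ?m {x. int p dvd x})"
        by (simp only: of_real_eq_iff right_diff_distrib mult_1_right)
      have "measure_pmf.prob ?m {x. int p dvd x} = measure_pmf.prob (symm_pmf q) {x. int p dvd a i * x}"
        by (simp add: vimage_def)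
      moreover have "1 - measure_pmf.prob (symm_pmf q) {x. int p dvd a i * x} = measure_pmf.prob (symm_pmf q) (- {x. int p dvd a i * x})"
        using measure_pmf.prob_compl[of "{x. int p dvd a i * x}" "symm_pmf q"] by (simp add: Compl_eq_Diff_UNIV)
      moreover have "- {x. int p dvd a i * x} = (if int p dvd a i then {} else {x. \<not> int p dvd x})"
        using p by (auto simp: prime_dvd_mult_iff)
      ultimately show ?thesis using 1 by (simp add: \<delta>_def)
    qed
    then have "(\<Sum>i\<in>I. \<Sum>t<p. u (a i * int t)) = (\<Sum>i\<in>I. p * (if int p dvd a i then 0 else \<delta>))"
      by simp
    also have "\<dots> = p * (s * \<delta>)"
      using I by (simp add: s_def sum.If_cases Int_def flip: sum_distrib_left)
    finally show ?thesis unfolding \<psi>_def by (subst sum.swap) simp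
  qed
  have "\<exists>t\<in>{..<p}. \<forall>t'\<in>{..<p}. N (int t') \<le> N (int t)" using p0 by (intro finite_attains_max) auto
  then obtain tm where tm: "tm < p" "\<And>t. t < p \<Longrightarrow> N (int t) \<le> N (int tm)" by auto
  define R where "R = N (int tm)"
  have R2: "s * \<delta> \<le> R\<^sup>2"
  proof -
    have "p * (s * \<delta>) \<le> (\<Sum>t<p. R\<^sup>2)"
      unfolding sum_\<psi>[symmetric] Nsq[symmetric] R_def by (intro sum_mono power_mono N_nonneg tm(2)) simp
    then show ?thesis using p0 by simp
  qed
  show ?thesis
  proof (cases "R > 0")
    case False
    then have "s * \<delta> \<le> 0" using R2 N_nonneg[of "int tm"] by (simp add: R_def)
    then have "1 \<le> exp (- (s * \<delta>) / (18 * (real k)\<^sup>2))" by (simp add: divide_nonpos_nonneg)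
    moreover have "?PX \<le> 1" "0 \<le> 1 / p" "0 \<le> ?PY / k" by auto
    ultimately show ?thesis by linarith
  next
    case True
    define E where "E = (\<lambda>t. exp (- \<psi> t / 2))"
    define E' where "E' = (\<lambda>t. exp (- \<psi> t / (18 * (real k)\<^sup>2)))"
    define S where "S = {t\<in>{1..<int p}. 3 * real k * N t \<le> R}"
    define S' where "S' = {t\<in>{1..<int p}. R < 3 * real k * N t}"
    \<comment> \<open>The factor \<open>{..<k}\<close> counts each frequency of \<open>S\<close>
      with multiplicity \<open>k\<close>; this is the origin of the division by \<open>k\<close> in
      the claim.\<close>
    have growth: "(\<Sum>(l, t)\<in>{..<k} \<times> S. E t) \<le> (\<Sum>t\<in>{0..<int p}. E' t)"
    proof (rule sum_le_by_sublevel_counts[where f = "\<lambda>(l, t). N t" and g = "\<lambda>t. N t / (3 * real k)"])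
      fix r :: real
      \<comment> \<open>Ball growth needs \<open>3 * real k * r'\<close> not to exceed
        \<open>R\<close>; truncating at \<open>R / (3 * real k)\<close> loses nothing, as
        \<open>S\<close> contains no larger norms.\<close>
      define r' where "r' = min r (R / (3 * real k))"
      have r': "3 * real k * r' \<le> R" using k0 by (simp add: r'_def min_def field_simps)
      have "{x \<in> {..<k} \<times> S. (case x of (l, t) \<Rightarrow> N t) \<le> r} = {..<k} \<times> {t\<in>{1..<int p}. N t \<le> r'}"
        using k0 by (auto simp: S_def r'_def field_simps)
      then have "card {x \<in> {..<k} \<times> S. (case x of (l, t) \<Rightarrow> N t) \<le> r} = k * card {t\<in>{1..<int p}. N t \<le> r'}"
        by (simp add: card_cartesian_product)
      also have "\<dots> \<le> card {t\<in>{0..<int p}. N t \<le> 3 * real k * r'}"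
        by (rule seminorm_ball_growth[OF p per N0 Nm Nadd R_def[symmetric] True r'])
      also have "\<dots> \<le> card {t\<in>{0..<int p}. N t / (3 * real k) \<le> r}"
      proof (rule card_mono)
        have *: "3 * real k * r' \<le> 3 * real k * r" using k0 by (intro mult_left_mono) (auto simp: r'_def)
        show "{t\<in>{0..<int p}. N t \<le> 3 * real k * r'} \<subseteq> {t\<in>{0..<int p}. N t / (3 * real k) \<le> r}"
        proof
          fix t assume t: "t \<in> {t\<in>{0..<int p}. N t \<le> 3 * real k * r'}"
          then have "N t \<le> 3 * real k * r" using * by simp
          then show "t \<in> {t\<in>{0..<int p}. N t / (3 * real k) \<le> r}"
            using t k0 by (simp add: pos_divide_le_eq mult_ac)
        qed
        show "finite {t\<in>{0..<int p}. N t / (3 * real k) \<le> r}" by (rule finite_subset[of _ "{0..<int p}"]) auto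
      qed
      finally show "card {x \<in> {..<k} \<times> S. (case x of (l, t) \<Rightarrow> N t) \<le> r} \<le> card {t\<in>{0..<int p}. N t / (3 * real k) \<le> r}" .
    next
      fix x y assume "N y / (3 * real k) \<le> (case x of (l, t) \<Rightarrow> N t)"
      then obtain l t where x: "x = (l, t)" and le: "N y / (3 * real k) \<le> N t" by (cases x) auto
      have "(N y / (3 * real k))\<^sup>2 \<le> (N t)\<^sup>2" using le N_nonneg k0 by (intro power_mono) auto
      then have "\<psi> y / (9 * (real k)\<^sup>2) \<le> \<psi> t" by (simp add: power_divide power_mult_distrib Nsq)
      then have "\<psi> y / (18 * (real k)\<^sup>2) \<le> \<psi> t / 2" by (simp add: field_simps)
      then show "(case x of (l, t) \<Rightarrow> E t) \<le> E' y" by (simp add: x E_def E'_def)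
    next
      show "finite ({..<k} \<times> S)" unfolding S_def by (intro finite_cartesian_product finite_subset[of "{t \<in> {1..<int p}. 3 * real k * N t \<le> R}" "{1..<int p}"]) auto
    qed (auto simp: E'_def)
    have fS: "finite S" "finite S'" "S \<inter> S' = {}" "{1..<int p} = S \<union> S'"
      by (rule finite_subset[of _ "{1..<int p}"]; auto simp: S_def S'_def)+ (auto simp: S_def S'_def)
    have growth': "(\<Sum>t\<in>S. E t) \<le> (\<Sum>t\<in>{0..<int p}. E' t) / k"
      using growth k0 by (simp add: sum.cartesian_product[symmetric] field_simps)
    have tail: "(\<Sum>t\<in>S'. E t) \<le> p * exp (- (s * \<delta>) / (18 * (real k)\<^sup>2))"
    proof -
      have "E t \<le> exp (- (s * \<delta>) / (18 * (real k)\<^sup>2))" if "t \<in> S'" for t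
      proof -
        have "R\<^sup>2 \<le> (3 * real k * N t)\<^sup>2" using that True by (intro power_mono) (auto simp: S'_def)
        then have "s * \<delta> \<le> 9 * (real k)\<^sup>2 * \<psi> t" using R2 by (simp add: power_mult_distrib Nsq)
        then have "(s * \<delta>) / (18 * (real k)\<^sup>2) \<le> \<psi> t / 2" using k0 by (simp add: field_simps)
        then show ?thesis by (simp add: E_def)
      qed
      then have "(\<Sum>t\<in>S'. E t) \<le> card S' * exp (- (s * \<delta>) / (18 * (real k)\<^sup>2))"
        by (rule sum_bounded_above)
      also have "\<dots> \<le> p * exp (- (s * \<delta>) / (18 * (real k)\<^sup>2))"
      proof -
        have "card S' \<le> card {0..<int p}" by (intro card_mono) (auto simp: S'_def)
        then show ?thesis by (intro mult_right_mono) auto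
      qed
      finally show ?thesis .
    qed
    have "(\<Sum>t\<in>{0..<int p}. E t) = E 0 + (\<Sum>t\<in>{1..<int p}. E t)"
    proof -
      have e: "{0..<int p} = insert 0 {1..<int p}" using p0 by auto
      show ?thesis unfolding e by (subst sum.insert) auto
    qed
    also have "(\<Sum>t\<in>{1..<int p}. E t) = (\<Sum>t\<in>S. E t) + (\<Sum>t\<in>S'. E t)"
      unfolding fS(4) using fS by (intro sum.union_disjoint) auto
    also have "E 0 \<le> 1" using \<psi>0[of 0] by (simp add: E_def)
    finally have sumE: "(\<Sum>t\<in>{0..<int p}. E t) \<le> 1 + (\<Sum>t\<in>{0..<int p}. E' t) / k + p * exp (- (s * \<delta>) / (18 * (real k)\<^sup>2))"
      using growth' tail by linarith
    have reidx: "(\<Sum>t\<in>{0..<int p}. f t) = (\<Sum>t<p. f (int t))" for f :: "int \<Rightarrow> real"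
      by (rule sum.reindex_bij_witness[of _ int nat]) auto
    have PX: "p * ?PX \<le> (\<Sum>t<p. E (int t))"
    proof -
      let ?L = "map_pmf (\<lambda>x. \<Sum>i\<in>I. a i * x i) (Pi_pmf I 0 (\<lambda>_. q))"
      have "complex_of_real (p * ?PX) = (\<Sum>t<p. chi ?L p (int t))"
        using prob_dvd_eq[OF p0, of ?L] p0 by (simp add: vimage_def)
      then have "norm (complex_of_real (p * ?PX)) \<le> (\<Sum>t<p. norm (chi ?L p (int t)))"
        by (simp only: norm_sum)
      also have "\<dots> \<le> (\<Sum>t<p. E (int t))"
      proof (rule sum_mono)
        fix t
        have "norm (chi ?L p (int t)) = (\<Prod>i\<in>I. norm (chi q p (a i * int t)))"
          unfolding chi_linear_form[OF I] prod_norm[symmetric] ..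
        also have "\<dots> \<le> (\<Prod>i\<in>I. exp (- u (a i * int t) / 2))"
          unfolding u_def by (intro prod_mono conjI le_exp_half_square) auto
        also have "\<dots> = E (int t)"
          using I by (simp add: E_def \<psi>_def exp_sum sum_divide_distrib flip: sum_negf)
        finally show "norm (chi ?L p (int t)) \<le> E (int t)" .
      qed
      finally show ?thesis by (simp add: norm_mult)
    qed
    have \<mu>: "0 \<le> \<mu>" "\<mu> \<le> 1/2"
    proof -
      have "1 \<le> (real k)\<^sup>2" using k by (simp add: one_le_power)
      then show "\<mu> \<le> 1/2" unfolding \<mu>_def by (intro frac_le) auto
    qed (simp add: \<mu>_def)
    have PY: "(\<Sum>t<p. E' (int t)) \<le> p * ?PY"
    proof -
      let ?L = "map_pmf (\<lambda>x. \<Sum>i\<in>I. a i * x i) (Pi_pmf I 0 (\<lambda>_. lazy_pmf \<mu> q))"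
      have "chi ?L p (int t) = complex_of_real (\<Prod>i\<in>I. 1 - \<mu> * u (a i * int t))" for t
        unfolding chi_linear_form[OF I] using \<mu> by (simp add: chi_lazy u_def algebra_simps)
      then have "complex_of_real (p * ?PY) = complex_of_real (\<Sum>t<p. \<Prod>i\<in>I. 1 - \<mu> * u (a i * int t))"
        using prob_dvd_eq[OF p0, of ?L] p0 by (simp add: vimage_def)
      then have "p * ?PY = (\<Sum>t<p. \<Prod>i\<in>I. 1 - \<mu> * u (a i * int t))" by (simp only: of_real_eq_iff)
      moreover have "E' (int t) \<le> (\<Prod>i\<in>I. 1 - \<mu> * u (a i * int t))" for t
      proof -
        have "E' (int t) = (\<Prod>i\<in>I. exp (- 2 * (\<mu> * u (a i * int t))))"
          using I by (simp add: E'_def \<psi>_def \<mu>_def exp_sum[symmetric] sum_divide_distrib sum_negf)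
        also have "\<dots> \<le> (\<Prod>i\<in>I. 1 - \<mu> * u (a i * int t))"
        proof (intro prod_mono conjI exp_minus_2_le)
          fix i show "0 \<le> \<mu> * u (a i * int t)" using \<mu> u01 by simp
          show "\<mu> * u (a i * int t) \<le> 1/2" using mult_mono[of \<mu> "1/2" "u (a i * int t)" 1] \<mu> u01 by simp
        qed simp
        finally show ?thesis .
      qed
      ultimately show ?thesis by (simp add: sum_mono)
    qed
    have "p * ?PX \<le> 1 + p * ?PY / k + p * exp (- (s * \<delta>) / (18 * (real k)\<^sup>2))"
      using PX sumE divide_right_mono[OF PY, of "real k"] k0 by (simp add: reidx)
    also have "\<dots> = p * (1 / p + ?PY / k + exp (- (s * \<delta>) / (18 * (real k)\<^sup>2)))"
      using p0 by (simp add: distrib_left)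
    finally show ?thesis using p0 by (simp only: mult_le_cancel_left_pos of_nat_0_less_iff)
  qed
qed

section \<open>From divisibility by large primes to vanishing over the integers\<close>

lemma prob_dvd_tendsto:
  fixes q :: "int pmf" and P :: "nat \<Rightarrow> nat"
  assumes P: "\<And>n. n < P n"
  shows "(\<lambda>n. measure_pmf.prob q {x. int (P n) dvd x}) \<longlonglongrightarrow> measure_pmf.prob q {0}"
proof -
  define A where "A = (\<lambda>n. {x::int. int n < \<bar>x\<bar>})"
  have "(\<lambda>n. measure_pmf.prob q (A n)) \<longlonglongrightarrow> measure_pmf.prob q (\<Inter>n. A n)"
    by (intro measure_pmf.finite_Lim_measure_decseq) (auto simp: A_def decseq_def)
  moreover have "(\<Inter>n. A n) = {}"
  proof -
    have "x \<notin> A (nat \<bar>x\<bar>)" for x by (simp add: A_def)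
    then show ?thesis by blast
  qed
  ultimately have A: "(\<lambda>n. measure_pmf.prob q (A n)) \<longlonglongrightarrow> 0" by simp
  have upper: "measure_pmf.prob q {x. int (P n) dvd x} \<le> measure_pmf.prob q {0} + measure_pmf.prob q (A n)" for n
  proof -
    have "{x. int (P n) dvd x} \<subseteq> {0} \<union> A n"
    proof
      fix x assume x: "x \<in> {x. int (P n) dvd x}"
      show "x \<in> {0} \<union> A n"
      proof (cases "x = 0")
        case False
        then have "int (P n) \<le> \<bar>x\<bar>" using x dvd_imp_le_int[of x "int (P n)"] by simp
        then show ?thesis using P[of n] by (simp add: A_def)
      qed simp
    qed
    then have "measure_pmf.prob q {x. int (P n) dvd x} \<le> measure_pmf.prob q ({0} \<union> A n)"
      by (intro measure_pmf.finite_measure_mono) auto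
    also have "\<dots> \<le> measure_pmf.prob q {0} + measure_pmf.prob q (A n)"
      by (rule measure_Un_le) auto
    finally show ?thesis .
  qed
  have lower: "measure_pmf.prob q {0} \<le> measure_pmf.prob q {x. int (P n) dvd x}" for n
    by (intro measure_pmf.finite_measure_mono) auto
  show ?thesis
  proof (rule tendsto_sandwich[OF _ _ tendsto_const])
    show "(\<lambda>n. measure_pmf.prob q {0} + measure_pmf.prob q (A n)) \<longlonglongrightarrow> measure_pmf.prob q {0}"
      using tendsto_add[OF tendsto_const A, of "measure_pmf.prob q {0}"] by simp
  qed (use upper lower in auto)
qed

text \<open>No single prime serves an unbounded law, so the primes tend to infinity:
  \<open>1 / p\<close> disappears, divisibility of the linear form becomes its vanishing, and
  \<delta> tends to the probability that the symmetrised variable is nonzero, which is at least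
  \<alpha>.\<close>

lemma halasz_comparison:
  fixes a :: "'i \<Rightarrow> int" and q :: "int pmf" and k :: nat and \<alpha> :: real
  assumes I: "finite I" and k: "k \<ge> 1" and \<alpha>: "\<And>x. pmf q x \<le> 1 - \<alpha>" "\<alpha> \<le> 1"
  shows "measure_pmf.prob (Pi_pmf I 0 (\<lambda>_. q)) {x. (\<Sum>i\<in>I. a i * x i) = 0}
    \<le> measure_pmf.prob (Pi_pmf I 0 (\<lambda>_. lazy_pmf (1 / (36 * (real k)\<^sup>2)) q)) {x. (\<Sum>i\<in>I. a i * x i) = 0} / k
      + exp (- (card {i\<in>I. a i \<noteq> 0} * \<alpha>) / (18 * (real k)\<^sup>2))"
proof -
  let ?\<mu> = "1 / (36 * (real k)\<^sup>2)"
  have "\<exists>p::nat. prime p \<and> n < p" for n using bigger_prime by blast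
  then obtain P :: "nat \<Rightarrow> nat" where P: "\<And>n. prime (P n)" "\<And>n. n < P n" by metis
  define LX where "LX = map_pmf (\<lambda>x. \<Sum>i\<in>I. a i * x i) (Pi_pmf I 0 (\<lambda>_. q))"
  define LY where "LY = map_pmf (\<lambda>x. \<Sum>i\<in>I. a i * x i) (Pi_pmf I 0 (\<lambda>_. lazy_pmf ?\<mu> q))"
  define s where "s = card {i\<in>I. a i \<noteq> 0}"
  define \<delta> where "\<delta> = (\<lambda>n. measure_pmf.prob (symm_pmf q) {x. \<not> int (P n) dvd x})"
  have \<delta>: "\<delta> n = 1 - measure_pmf.prob (symm_pmf q) {x. int (P n) dvd x}" for n
    using measure_pmf.prob_compl[of "{x. int (P n) dvd x}" "symm_pmf q"]
    by (simp add: \<delta>_def Compl_eq_Diff_UNIV[symmetric] Collect_neg_eq)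
  have \<delta>_lim: "\<delta> \<longlonglongrightarrow> 1 - measure_pmf.prob (symm_pmf q) {0}"
    unfolding \<delta> [abs_def] by (intro tendsto_diff tendsto_const prob_dvd_tendsto P(2))
  have PS: "real (Suc n) \<le> real (P n)" for n using P(2)[of n] by linarith
  have inv_lim: "(\<lambda>n. 1 / real (P n)) \<longlonglongrightarrow> 0"
  proof (rule tendsto_sandwich[OF _ _ tendsto_const LIMSEQ_inverse_real_of_nat])
    show "\<forall>\<^sub>F n in sequentially. 1 / real (P n) \<le> inverse (real (Suc n))"
      unfolding inverse_eq_divide using PS by (intro always_eventually allI frac_le) auto
  qed auto
  have ev: "\<forall>\<^sub>F n in sequentially. measure_pmf.prob LX {0} \<le> 1 / real (P n)
      + measure_pmf.prob LY {x. int (P n) dvd x} / k + exp (- (s * \<delta> n) / (18 * (real k)\<^sup>2))"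
  proof -
    \<comment> \<open>A prime exceeding every \<open>\<bar>a i\<bar>\<close> divides a coefficient
      only if that coefficient is 0, so the count of contributing coefficients is eventually
      exact.\<close>
    obtain M where M: "\<And>i. i \<in> I \<Longrightarrow> \<bar>a i\<bar> \<le> int M"
    proof
      fix i assume "i \<in> I"
      then have "nat \<bar>a i\<bar> \<le> (\<Sum>i\<in>I. nat \<bar>a i\<bar>)" using I by (intro member_le_sum) auto
      then show "\<bar>a i\<bar> \<le> int (\<Sum>i\<in>I. nat \<bar>a i\<bar>)" by (simp only: nat_le_iff)
    qed
    have "measure_pmf.prob LX {0} \<le> 1 / real (P n)
      + measure_pmf.prob LY {x. int (P n) dvd x} / k + exp (- (s * \<delta> n) / (18 * (real k)\<^sup>2))" if "n \<ge> M" for n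
    proof -
      have "{i\<in>I. \<not> int (P n) dvd a i} = {i\<in>I. a i \<noteq> 0}"
      proof -
        have "int (P n) dvd a i \<longleftrightarrow> a i = 0" if "i \<in> I" for i
          using M[OF that] P(2)[of n] \<open>n \<ge> M\<close> dvd_imp_le_int[of "a i" "int (P n)"] by auto
        then show ?thesis by auto
      qed
      then have "measure_pmf.prob LX {x. int (P n) dvd x} \<le> 1 / real (P n)
        + measure_pmf.prob LY {x. int (P n) dvd x} / k + exp (- (s * \<delta> n) / (18 * (real k)\<^sup>2))"
        using halasz_comparison_mod_prime[OF I P(1)[of n] k, of q a]
        by (simp add: LX_def LY_def s_def \<delta>_def vimage_def)
      moreover have "measure_pmf.prob LX {0} \<le> measure_pmf.prob LX {x. int (P n) dvd x}"
        by (intro measure_pmf.finite_measure_mono) auto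
      ultimately show ?thesis by linarith
    qed
    then show ?thesis unfolding eventually_sequentially by blast
  qed
  have "measure_pmf.prob LX {0} \<le> 0 + measure_pmf.prob LY {0} / k
      + exp (- (s * (1 - measure_pmf.prob (symm_pmf q) {0})) / (18 * (real k)\<^sup>2))"
  proof (rule tendsto_lowerbound[OF _ ev])
    show "(\<lambda>n. 1 / real (P n) + measure_pmf.prob LY {x. int (P n) dvd x} / k + exp (- (s * \<delta> n) / (18 * (real k)\<^sup>2)))
      \<longlonglongrightarrow> 0 + measure_pmf.prob LY {0} / k + exp (- (s * (1 - measure_pmf.prob (symm_pmf q) {0})) / (18 * (real k)\<^sup>2))"
      using k by (intro tendsto_add inv_lim tendsto_divide prob_dvd_tendsto P(2) tendsto_const tendsto_exp tendsto_minus tendsto_mult \<delta>_lim) auto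
  qed simp
  also have "exp (- (s * (1 - measure_pmf.prob (symm_pmf q) {0})) / (18 * (real k)\<^sup>2)) \<le> exp (- (s * \<alpha>) / (18 * (real k)\<^sup>2))"
  proof -
    have "\<alpha> \<le> 1 - measure_pmf.prob (symm_pmf q) {0}"
      using pmf_symm_le[OF \<alpha>, of 0] by (simp add: measure_pmf_single)
    then have "s * \<alpha> \<le> s * (1 - measure_pmf.prob (symm_pmf q) {0})" by (intro mult_left_mono) auto
    then show ?thesis by (simp add: divide_right_mono)
  qed
  finally show ?thesis by (simp add: LX_def LY_def s_def vimage_def)
qed

subsection \<open>Columns of the Laplacian\<close>

definition col_pmf :: "nat \<Rightarrow> int pmf \<Rightarrow> nat \<Rightarrow> (nat \<Rightarrow> int) pmf" where
  "col_pmf n p j = Pi_pmf ({..<n} - {j}) 0 (\<lambda>_. p)"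

definition lap_col :: "nat \<Rightarrow> nat \<Rightarrow> (nat \<Rightarrow> int) \<Rightarrow> nat \<Rightarrow> rat" where
  "lap_col n j x = (\<lambda>i. if i < n then (if i = j then \<Sum>l\<in>{..<n} - {j}. of_int (x l) else - of_int (x i)) else 0)"

text \<open>Only differences of \<open>w\<close> enter. Normals matter up to an additive constant,
  which is why sparsity is measured as deviation from some value \<open>v\<close>.\<close>

lemma dotp_lap_col:
  assumes "j < n"
  shows "dotp n w (lap_col n j x) = (\<Sum>i\<in>{..<n} - {j}. of_int (x i) * (w j - w i))"
proof -
  have "dotp n w (lap_col n j x) = w j * lap_col n j x j + (\<Sum>i\<in>{..<n} - {j}. w i * lap_col n j x i)"
    unfolding dotp_def using assms by (simp add: sum.remove)
  also have "(\<Sum>i\<in>{..<n} - {j}. w i * lap_col n j x i) = (\<Sum>i\<in>{..<n} - {j}. - (w i * of_int (x i)))"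
    by (intro sum.cong) (auto simp: lap_col_def)
  finally show ?thesis using assms
    by (simp add: lap_col_def sum_distrib_left sum_negf right_diff_distrib sum_subtractf mult.commute)
qed

lemma lap_col_in_sum0:
  assumes "j < n"
  shows "lap_col n j x \<in> sum0 n"
  using dotp_lap_col[OF assms, of "\<lambda>_. 1" x] by (auto simp: sum0_def dotp_def lap_col_def)

text \<open>The diagonal entry is a function of the others and is dropped; the remaining
  \<open>n - 1\<close> coordinates are independent.\<close>

lemma prob_lap_col_span_le:
  assumes "j < n" "finite G" "card G \<le> m" "\<And>x. pmf p x \<le> \<rho>" "0 \<le> \<rho>" "\<rho> \<le> 1"
  shows "measure_pmf.prob (col_pmf n p j) {x. lap_col n j x \<in> ratfun.span G} \<le> \<rho> ^ (n - 1 - m)"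
proof -
  have "measure_pmf.prob (col_pmf n p j) {x. lap_col n j x \<in> ratfun.span G}
    \<le> measure_pmf.prob (col_pmf n p j) {x. \<exists>v\<in>ratfun.span G. \<forall>i\<in>{..<n} - {j}. v i = - of_int (x i)}"
  proof (intro measure_pmf.finite_measure_mono subsetI)
    fix x assume "x \<in> {x. lap_col n j x \<in> ratfun.span G}"
    moreover have "\<forall>i\<in>{..<n} - {j}. lap_col n j x i = - of_int (x i)" by (auto simp: lap_col_def)
    ultimately show "x \<in> {x. \<exists>v\<in>ratfun.span G. \<forall>i\<in>{..<n} - {j}. v i = - of_int (x i)}" by blast
  qed auto
  also have "\<dots> \<le> \<rho> ^ (card ({..<n} - {j}) - m)"
    unfolding col_pmf_def using assms by (intro prob_span_le) (auto simp: inj_def)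
  finally show ?thesis using assms(1) by simp
qed

lemma common_denominator:
  fixes u :: "'i \<Rightarrow> rat"
  assumes "finite I"
  obtains D :: int and a :: "'i \<Rightarrow> int" where "D \<noteq> 0" "\<And>i. i \<in> I \<Longrightarrow> of_int D * u i = of_int (a i)"
proof -
  have "\<exists>D::int. D \<noteq> 0 \<and> (\<forall>i\<in>I. \<exists>a::int. of_int D * u i = of_int a)"
    using assms
  proof (induction I rule: finite_induct)
    case empty
    then show ?case by (intro exI[of _ 1]) auto
  next
    case (insert i I)
    then obtain D :: int where D: "D \<noteq> 0" "\<forall>i\<in>I. \<exists>a::int. of_int D * u i = of_int a" by blast
    obtain c d where cd: "quotient_of (u i) = (c, d)" by (cases "quotient_of (u i)")
    have u: "u i = of_int c / of_int d" "d > 0"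
      using quotient_of_div[OF cd] quotient_of_denom_pos[OF cd] by auto
    have "\<exists>a::int. of_int (D * d) * u l = of_int a" if l: "l \<in> insert i I" for l
    proof (cases "l = i")
      case True
      then show ?thesis using u by (intro exI[of _ "D * c"]) simp
    next
      case False
      then obtain a :: int where "of_int D * u l = of_int a" using D l by blast
      then show ?thesis by (intro exI[of _ "a * d"]) (simp add: mult_ac)
    qed
    moreover have "D * d \<noteq> 0" using D u by simp
    ultimately show ?case by blast
  qed
  then show thesis using that by metis
qed

text \<open>Clearing denominators turns the differences \<open>w j - w i\<close> into integer
  coefficients, at least \<open>b\<close> of which are nonzero.\<close>

lemma prob_lap_col_orthogonal_le:
  fixes w :: "nat \<Rightarrow> rat" and k :: nat and \<alpha> :: real
  assumes j: "j < n" and k: "k \<ge> 1" and \<alpha>: "\<And>x. pmf q x \<le> 1 - \<alpha>" "0 \<le> \<alpha>" "\<alpha> \<le> 1"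
    and b: "b \<le> real (card {i\<in>{..<n}. w i \<noteq> w j})"
  shows "measure_pmf.prob (col_pmf n q j) {x. dotp n w (lap_col n j x) = 0}
    \<le> measure_pmf.prob (col_pmf n (lazy_pmf (1 / (36 * (real k)\<^sup>2)) q) j) {x. dotp n w (lap_col n j x) = 0} / k
      + exp (- (b * \<alpha>) / (18 * (real k)\<^sup>2))"
proof -
  let ?I = "{..<n} - {j}"
  obtain D a where Da: "D \<noteq> 0" "\<And>i. i \<in> ?I \<Longrightarrow> of_int D * (w j - w i) = of_int (a i)"
    using common_denominator[of ?I "\<lambda>i. w j - w i"] by (metis finite_Diff finite_lessThan)
  have eq: "dotp n w (lap_col n j x) = 0 \<longleftrightarrow> (\<Sum>i\<in>?I. a i * x i) = 0" for x
  proof -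
    have "of_int D * dotp n w (lap_col n j x) = (\<Sum>i\<in>?I. of_int (x i) * (of_int D * (w j - w i)))"
      unfolding dotp_lap_col[OF j] by (simp add: sum_distrib_left mult_ac)
    also have "\<dots> = (\<Sum>i\<in>?I. of_int (x i) * of_int (a i))" by (intro sum.cong refl) (simp add: Da)
    also have "\<dots> = of_int (\<Sum>i\<in>?I. a i * x i)" by (simp add: mult.commute)
    finally show ?thesis using Da(1) by (metis mult_eq_0_iff of_int_eq_0_iff)
  qed
  have "a i \<noteq> 0 \<longleftrightarrow> w i \<noteq> w j" if "i \<in> ?I" for i
    using Da(2)[OF that] Da(1) by (metis eq_iff_diff_eq_0 mult_eq_0_iff of_int_eq_0_iff)
  then have S: "{i\<in>?I. a i \<noteq> 0} = {i\<in>{..<n}. w i \<noteq> w j}" by auto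
  have "measure_pmf.prob (col_pmf n q j) {x. dotp n w (lap_col n j x) = 0}
    \<le> measure_pmf.prob (col_pmf n (lazy_pmf (1 / (36 * (real k)\<^sup>2)) q) j) {x. dotp n w (lap_col n j x) = 0} / k
      + exp (- (card {i\<in>{..<n}. w i \<noteq> w j} * \<alpha>) / (18 * (real k)\<^sup>2))"
    unfolding col_pmf_def eq S[symmetric] using k \<alpha> by (intro halasz_comparison) auto
  also have "exp (- (card {i\<in>{..<n}. w i \<noteq> w j} * \<alpha>) / (18 * (real k)\<^sup>2)) \<le> exp (- (b * \<alpha>) / (18 * (real k)\<^sup>2))"
    using mult_right_mono[OF b \<alpha>(2)] by (simp add: divide_right_mono)
  finally show ?thesis by simp
qed

section \<open>Matrices as independent columns, and the rank over the reals\<close>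

lemma Pi_pmf_columns:
  "Pi_pmf {(i, j). i < n \<and> j < n \<and> i \<noteq> j} 0 (\<lambda>_. p)
    = map_pmf (\<lambda>X (i, j). X j i) (Pi_pmf {..<n} (\<lambda>_. 0) (col_pmf n p))" (is "?L = ?R")
proof (rule pmf_eqI)
  fix f :: "nat \<times> nat \<Rightarrow> int"
  let ?O = "{(i, j). i < n \<and> j < n \<and> i \<noteq> j}"
  let ?h = "\<lambda>X (i, j). X j i" and ?X = "\<lambda>j i. f (i, j)"
  have fin: "finite ?O" by (rule finite_subset[of _ "{..<n} \<times> {..<n}"]) auto
  have inj: "inj (?h :: (nat \<Rightarrow> nat \<Rightarrow> int) \<Rightarrow> _)" by (auto simp: inj_def fun_eq_iff)
  have f: "f = ?h ?X" by auto
  have R: "pmf ?R f = pmf (Pi_pmf {..<n} (\<lambda>_. 0) (col_pmf n p)) ?X"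
    by (subst f, rule pmf_map_inj'[OF inj])
  show "pmf ?L f = pmf ?R f"
  proof (cases "\<forall>x. x \<notin> ?O \<longrightarrow> f x = 0")
    case True
    then have "pmf ?R f = (\<Prod>j<n. pmf (col_pmf n p j) (?X j))"
      unfolding R by (subst pmf_Pi') (auto simp: fun_eq_iff)
    also have "\<dots> = (\<Prod>j<n. \<Prod>i\<in>{..<n} - {j}. pmf p (f (i, j)))"
      unfolding col_pmf_def using True by (intro prod.cong refl pmf_Pi') auto
    also have "\<dots> = (\<Prod>(j, i)\<in>(SIGMA j:{..<n}. {..<n} - {j}). pmf p (f (i, j)))"
      by (rule prod.Sigma) auto
    also have "\<dots> = (\<Prod>x\<in>?O. pmf p (f x))"
      by (rule prod.reindex_bij_witness[of _ "\<lambda>(i, j). (j, i)" "\<lambda>(i, j). (j, i)"]) auto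
    also have "\<dots> = pmf ?L f" using fin True by (subst pmf_Pi') auto
    finally show ?thesis by simp
  next
    case False
    then obtain i j where ij: "(i, j) \<notin> ?O" "f (i, j) \<noteq> 0" by auto
    have "pmf ?L f = 0" using fin ij by (intro pmf_Pi_outside) blast+
    moreover have "pmf ?R f = 0"
    proof (cases "j < n")
      case True
      then have "pmf (col_pmf n p j) (?X j) = 0"
        unfolding col_pmf_def using ij by (intro pmf_Pi_outside exI[of _ i]) auto
      then show ?thesis unfolding R using True by (auto simp: pmf_Pi)
    next
      case False
      then show ?thesis unfolding R using ij
        by (intro pmf_Pi_outside exI[of _ j]) (auto simp: fun_eq_iff)
    qed
    ultimately show ?thesis by simp
  qed
qed

lemma random_matrix_columns:
  "random_matrix n p = map_pmf (\<lambda>X. mat n n (\<lambda>(i, j). if i = j then 0 else X j i))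
    (Pi_pmf {..<n} (\<lambda>_. 0) (col_pmf n p))"
  unfolding random_matrix_def Pi_pmf_columns by (simp add: pmf.map_comp o_def cong: if_cong)

lemma laplacian_entry:
  assumes "i < n" "j < n"
  shows "of_int (laplacian (mat n n (\<lambda>(i, j). if i = j then 0 else X j i)) $$ (i, j)) = lap_col n j (X j) i"
proof -
  have "(\<Sum>k<n. of_int (if k = i then 0 else X i k)) = (\<Sum>l\<in>{..<n} - {i}. rat_of_int (X i l))"
    by (rule sum.mono_neutral_cong_right) auto
  then show ?thesis using assms by (auto simp: laplacian_def lap_col_def)
qed

text \<open>Pairing a real kernel relation with a rational dual vector isolates one coordinate of
  the kernel vector, which is therefore 0. So rational independence already gives full rank over the
  reals.\<close>

lemma rank_laplacian_columns:
  fixes X :: "nat \<Rightarrow> nat \<Rightarrow> int" and n :: nat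
  defines "M \<equiv> mat n n (\<lambda>(i, j). if i = j then 0 else X j i)"
  assumes J: "J \<subseteq> {..<n}" "card J = m"
    and indep: "inj_on (\<lambda>j. lap_col n j (X j)) J" "ratfun.independent ((\<lambda>j. lap_col n j (X j)) ` J)"
  shows "vec_space.rank n (map_mat real_of_int (submatrix (laplacian M) UNIV J)) = m"
proof -
  define A where "A = map_mat real_of_int (submatrix (laplacian M) UNIV J)"
  have dims: "dim_row (laplacian M) = n" "dim_col (laplacian M) = n" by (auto simp: laplacian_def M_def)
  have cJ: "card {j. j < dim_col (laplacian M) \<and> j \<in> J} = m"
  proof -
    have "{j. j < dim_col (laplacian M) \<and> j \<in> J} = J" using J dims by auto
    then show ?thesis using J by simp
  qed
  have A: "A \<in> carrier_mat n m"
    unfolding A_def using cJ by (auto simp: dim_submatrix dims)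
  have finJ: "finite J" using J finite_subset by blast
  have pick: "pick J l \<in> J" if "l < m" for l using that J finJ pick_in_set_le by blast
  have pick_inj: "pick J l = pick J l' \<longleftrightarrow> l = l'" if "l < m" "l' < m" for l l'
    using that J(2) pick_mono_le by (metis linorder_neq_iff less_irrefl)
  have entry: "A $$ (i, l) = of_rat (lap_col n (pick J l) (X (pick J l)) i)" if "i < n" "l < m" for i l
  proof -
    have "A $$ (i, l) = real_of_int (laplacian M $$ (i, pick J l))"
      unfolding A_def using that cJ by (subst index_map_mat) (auto simp: dim_submatrix dims submatrix_index pick_UNIV)
    also have "\<dots> = of_rat (of_int (laplacian M $$ (i, pick J l)))" by simp
    also have "\<dots> = of_rat (lap_col n (pick J l) (X (pick J l)) i)"
      unfolding M_def using that pick[OF that(2)] J by (subst laplacian_entry) auto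
    finally show ?thesis .
  qed
  have inj: "v = 0\<^sub>v m" if v: "v \<in> carrier_vec m" "A *\<^sub>v v = 0\<^sub>v n" for v
  proof (rule eq_vecI)
    fix l assume "l < dim_vec (0\<^sub>v m)"
    then have l: "l < m" by simp
    obtain w where w: "dotp n w (lap_col n (pick J l) (X (pick J l))) = 1"
      "\<And>j. j \<in> J \<Longrightarrow> j \<noteq> pick J l \<Longrightarrow> dotp n w (lap_col n j (X j)) = 0"
      using dual_vector[OF indep _ pick[OF l], of n] by (auto simp: lap_col_def)
    have "(\<Sum>l'<m. A $$ (i, l') * v $ l') = 0" if "i < n" for i
    proof -
      have "(A *\<^sub>v v) $ i = (\<Sum>l'<m. A $$ (i, l') * v $ l')"
        using A v(1) that by (auto simp: scalar_prod_def lessThan_atLeast0 intro!: sum.cong)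
      then show ?thesis using v that by simp
    qed
    then have "0 = (\<Sum>i<n. of_rat (w i) * (\<Sum>l'<m. A $$ (i, l') * v $ l'))" by simp
    also have "\<dots> = (\<Sum>l'<m. (\<Sum>i<n. of_rat (w i) * A $$ (i, l')) * v $ l')"
      by (simp add: sum_distrib_left sum_distrib_right mult_ac) (rule sum.swap)
    also have "\<dots> = (\<Sum>l'<m. of_rat (dotp n w (lap_col n (pick J l') (X (pick J l')))) * v $ l')"
      by (intro sum.cong refl) (simp add: dotp_def entry of_rat_sum of_rat_mult)
    also have "\<dots> = (\<Sum>l'<m. if l' = l then v $ l' else 0)"
      using w pick pick_inj l by (intro sum.cong refl) auto
    also have "\<dots> = v $ l" using l by (simp add: sum.delta)
    finally show "v $ l = 0\<^sub>v m $ l" using l by simp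
  qed (use v in simp)
  have dist: "distinct (cols A)"
  proof -
    have "l = l'" if l: "l < m" "l' < m" and eq: "col A l = col A l'" for l l'
    proof -
      have "lap_col n (pick J l) (X (pick J l)) i = lap_col n (pick J l') (X (pick J l')) i" for i
      proof (cases "i < n")
        case True
        then have "A $$ (i, l) = A $$ (i, l')" using eq A l by (metis carrier_matD index_col)
        then show ?thesis using True l by (simp add: entry)
      qed (simp add: lap_col_def)
      then have "lap_col n (pick J l) (X (pick J l)) = lap_col n (pick J l') (X (pick J l'))" by (rule ext)
      then have "pick J l = pick J l'" using inj_onD[OF indep(1)] pick l by blast
      then show ?thesis using pick_inj l by blast
    qed
    then show ?thesis using A by (auto simp: distinct_conv_nth)
  qed
  have "\<not> module.lin_dep class_ring (module_vec TYPE(real) n) (set (cols A))"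
    using vec_space.lin_depE[OF A _ dist] inj by metis
  then have "vec_space.rank n A = m"
    using vec_space.lin_indpt_full_rank[OF A dist] by blast
  then show ?thesis by (simp add: A_def)
qed

subsection \<open>Sparse normal vectors\<close>

text \<open>Up to a scalar, \<open>u\<close> is the only candidate with support in \<open>S\<close>
  that is orthogonal to the columns in \<open>K\<close>; that \<open>u\<close> itself is orthogonal
  is stated separately.\<close>

definition determines :: "nat \<Rightarrow> (nat \<Rightarrow> nat \<Rightarrow> rat) \<Rightarrow> nat set \<Rightarrow> nat set \<Rightarrow> (nat \<Rightarrow> rat) \<Rightarrow> bool" where
  "determines n c S K u \<longleftrightarrow> (\<forall>u'. (\<forall>i. u' i \<noteq> 0 \<longrightarrow> i \<in> S) \<longrightarrow> (\<forall>j\<in>K. dotp n u' (c j) = 0) \<longrightarrow> (\<exists>d. u' = qscale d u))"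

text \<open>Subtracting \<open>v\<close> from \<open>w\<close> preserves orthogonality to vectors of
  sum 0 and gives an annihilator of small support; let \<open>S\<close> be a minimal support. The
  rows indexed by \<open>S\<close> satisfy the relation \<open>u\<close>, so their rank is at most
  \<open>card S - 1\<close> and that many columns \<open>K\<close> imply all equations. A second
  solution, reduced by a multiple of \<open>u\<close> to vanish at \<open>i0\<close>, would have a
  smaller support.\<close>

lemma minimal_sparse_annihilator:
  fixes c :: "nat \<Rightarrow> nat \<Rightarrow> rat"
  assumes J: "finite J" "b \<le> card J" "\<And>j. j \<in> J \<Longrightarrow> c j \<in> sum0 n"
    and w: "\<And>j. j \<in> J \<Longrightarrow> dotp n w (c j) = 0" "\<exists>i<n. w i \<noteq> v" "card {i\<in>{..<n}. w i \<noteq> v} \<le> b"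
  obtains S K u where "S \<subseteq> {..<n}" "1 \<le> card S" "card S \<le> b" "K \<subseteq> J" "card K = card S - 1"
    "\<And>i. u i \<noteq> 0 \<longleftrightarrow> i \<in> S" "\<And>j. j \<in> J \<Longrightarrow> dotp n u (c j) = 0" "determines n c S K u"
proof -
  define P where "P = (\<lambda>S. S \<subseteq> {..<n} \<and> S \<noteq> {} \<and> (\<exists>u. (\<forall>i. u i \<noteq> 0 \<longleftrightarrow> i \<in> S) \<and> (\<forall>j\<in>J. dotp n u (c j) = 0)))"
  let ?S = "{i\<in>{..<n}. w i \<noteq> v}"
  have "P ?S"
  proof -
    define u where "u = (\<lambda>i. if i < n then w i - v else 0)"
    have "dotp n u (c j) = 0" if "j \<in> J" for j
    proof -
      have "dotp n u (c j) = dotp n w (c j) - v * (\<Sum>i<n. c j i)"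
        by (simp add: dotp_def u_def left_diff_distrib sum_subtractf sum_distrib_left)
      then show ?thesis using J(3)[OF that] w(1)[OF that] by (simp add: sum0_def)
    qed
    moreover have "u i \<noteq> 0 \<longleftrightarrow> i \<in> ?S" for i by (simp add: u_def)
    ultimately show ?thesis using w(2) unfolding P_def by blast
  qed
  define S where "S = arg_min card P"
  have PS: "P S" unfolding S_def by (rule arg_min_natI) fact
  have min: "card S \<le> card T" if "P T" for T unfolding S_def using that by (rule arg_min_nat_le)
  have Sb: "card S \<le> b" using min[OF \<open>P ?S\<close>] w(3) by simp
  have S: "S \<subseteq> {..<n}" "S \<noteq> {}" "finite S" using PS finite_subset by (auto simp: P_def)
  obtain u where u: "\<And>i. u i \<noteq> 0 \<longleftrightarrow> i \<in> S" "\<And>j. j \<in> J \<Longrightarrow> dotp n u (c j) = 0"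
    using PS unfolding P_def by blast
  obtain i0 where i0: "i0 \<in> S" using S by blast
  have cS: "card S \<ge> 1" using S by (simp add: Suc_le_eq card_gt_0_iff)
  \<comment> \<open>\<open>g i\<close> is row \<open>i\<close> of the matrix with columns
    \<open>c j\<close>, cut off outside \<open>J\<close>. The coordinate lemma is applied to rows,
    so the coordinates it selects are columns.\<close>
  define g where "g = (\<lambda>i j. if j \<in> J then c j i else (0::rat))"
  have dot: "dotp n x (c j) = (\<Sum>i\<in>S. x i * c j i)" if "\<And>i. x i \<noteq> 0 \<Longrightarrow> i \<in> S" for x j
    unfolding dotp_def using S that by (intro sum.mono_neutral_right) auto
  have comb: "(\<Sum>i\<in>S. qscale (x i) (g i)) j = (if j \<in> J then dotp n x (c j) else 0)"
    if "\<And>i. x i \<noteq> 0 \<Longrightarrow> i \<in> S" for x j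
    using dot[of x j, OF that] by (simp add: sum_fun_apply qscale_apply g_def)
  let ?G = "g ` (S - {i0})"
  have "finite ?G" "card ?G \<le> card S - 1"
    using S i0 card_image_le[of "S - {i0}" g] by auto
  then obtain D where D: "D \<subseteq> J" "card D \<le> card S - 1"
    "\<And>h. h \<in> ratfun.span ?G \<Longrightarrow> \<forall>j\<in>D. h j = 0 \<Longrightarrow> \<forall>j\<in>J. h j = 0"
    using span_determining_coordinates[of ?G "card S - 1" J] by metis
  \<comment> \<open>\<open>D\<close> may be smaller; padding it to exactly \<open>card S - 1\<close>
    columns lets the union bound range over sets of a single size.\<close>
  have "card S - 1 \<le> card J" using J(2) Sb by simp
  then obtain K where K: "D \<subseteq> K" "K \<subseteq> J" "card K = card S - 1"
    using exists_subset_between[OF D(2) _ D(1) J(1)] by metis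
  have gi: "g i \<in> ratfun.span ?G" if "i \<in> S" for i
  proof (cases "i = i0")
    case False
    then show ?thesis using that by (intro ratfun.span_base) auto
  next
    case True
    have "(\<Sum>i\<in>S. qscale (u i) (g i)) = 0"
      by (rule ext) (use u comb[of u] in auto)
    then have "qscale (u i0) (g i0) = - (\<Sum>i\<in>S - {i0}. qscale (u i) (g i))"
      using S i0 by (simp add: sum.remove eq_neg_iff_add_eq_0)
    also have "\<dots> \<in> ratfun.span ?G"
      by (intro ratfun.span_neg ratfun.span_sum ratfun.span_scale ratfun.span_base) auto
    finally have "qscale (1 / u i0) (qscale (u i0) (g i0)) \<in> ratfun.span ?G"
      by (rule ratfun.span_scale)
    moreover have "qscale (1 / u i0) (qscale (u i0) (g i0)) = g i0"
      using u(1)[of i0] i0 by (auto simp: fun_eq_iff qscale_apply)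
    ultimately show ?thesis using True by simp
  qed
  have "determines n c S K u"
    unfolding determines_def
  proof (intro allI impI)
    fix u' assume u': "\<forall>i. u' i \<noteq> 0 \<longrightarrow> i \<in> S" "\<forall>j\<in>K. dotp n u' (c j) = 0"
    define h where "h = (\<Sum>i\<in>S. qscale (u' i) (g i))"
    have hv: "h j = (if j \<in> J then dotp n u' (c j) else 0)" for j
      unfolding h_def using u' by (intro comb) auto
    have "h \<in> ratfun.span ?G"
      unfolding h_def by (intro ratfun.span_sum ratfun.span_scale gi)
    moreover have "\<forall>j\<in>D. h j = 0" using hv u'(2) K by auto
    ultimately have "\<forall>j\<in>J. h j = 0" using D(3) by blast
    then have u'J: "dotp n u' (c j) = 0" if "j \<in> J" for j using hv that by auto
    define d where "d = u' i0 / u i0"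
    define u'' where "u'' = u' - qscale d u"
    have u0: "u i0 \<noteq> 0" using u i0 by blast
    have "u'' = 0"
    proof (rule ccontr)
      assume nz: "u'' \<noteq> 0"
      let ?T = "{i. u'' i \<noteq> 0}"
      have T: "?T \<subseteq> S - {i0}"
      proof
        fix i assume i: "i \<in> ?T"
        have "i \<noteq> i0" using i u0 by (auto simp: u''_def d_def qscale_apply)
        moreover have "u' i \<noteq> 0 \<or> u i \<noteq> 0" using i by (auto simp: u''_def qscale_apply)
        ultimately show "i \<in> S - {i0}" using u'(1) u(1) by auto
      qed
      have "dotp n u'' (c j) = dotp n u' (c j) - d * dotp n u (c j)" for j
        by (simp add: dotp_def u''_def qscale_apply left_diff_distrib sum_subtractf sum_distrib_left mult.assoc)
      then have "P ?T"
        unfolding P_def using T S(1) nz u'J u(2) by (auto simp: fun_eq_iff intro!: exI[of _ u''])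
      then have "card S \<le> card ?T" by (rule min)
      also have "\<dots> \<le> card (S - {i0})" using T S by (intro card_mono) auto
      also have "\<dots> < card S" using S i0 by (intro psubset_card_mono) auto
      finally show False by simp
    qed
    then show "\<exists>d. u' = qscale d u" by (intro exI[of _ d]) (simp add: u''_def)
  qed
  then show thesis using that[of S K u] S(1) cS Sb K u by blast
qed

text \<open>Freeze the columns in \<open>S\<close> and \<open>K\<close>. Those in \<open>K\<close>
  fix the annihilator up to a scalar, so every other column must independently satisfy one fixed
  linear equation with \<open>card S\<close> nonzero coefficients; fewer than
  \<open>2 * card S\<close> columns are frozen.\<close>

lemma prob_sparse_annihilator_le:
  fixes \<alpha> :: real
  assumes J: "finite J" "J \<subseteq> {..<n}" and S: "S \<subseteq> {..<n}" "1 \<le> card S" and K: "K \<subseteq> J" "card K = card S - 1"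
    and p: "\<And>x. pmf p x \<le> 1 - \<alpha>" "0 \<le> \<alpha>" "\<alpha> \<le> 1"
  shows "measure_pmf.prob (Pi_pmf J (\<lambda>_. 0) (col_pmf n p)) {X. \<exists>u. (\<forall>i. u i \<noteq> 0 \<longleftrightarrow> i \<in> S)
      \<and> (\<forall>j\<in>J. dotp n u (lap_col n j (X j)) = 0) \<and> determines n (\<lambda>j. lap_col n j (X j)) S K u}
    \<le> max (3/4) (1 - \<alpha> * card S / 2) ^ (card J - 2 * card S)" (is "measure_pmf.prob _ {X. ?E X} \<le> ?\<rho> ^ _")
proof (rule Pi_pmf_conditioning[where B = "J - S - K"])
  let ?B = "J - S - K"
  have \<rho>: "0 \<le> ?\<rho>" "?\<rho> \<le> 1" using p by (auto simp: max_def)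
  then show "0 \<le> ?\<rho> ^ (card J - 2 * card S)" by simp
  fix f :: "nat \<Rightarrow> nat \<Rightarrow> int"
  let ?m = "\<lambda>g j. if j \<in> ?B then g j else f j"
  show "measure_pmf.prob (Pi_pmf ?B (\<lambda>_. 0) (col_pmf n p)) {g. ?E (?m g)} \<le> ?\<rho> ^ (card J - 2 * card S)"
  proof (cases "\<exists>g. ?E (?m g)")
    case False
    then have e: "{g. ?E (?m g)} = {}" by blast
    show ?thesis unfolding e using \<rho> by simp
  next
    case True
    then obtain t u0 where u0: "\<forall>i. u0 i \<noteq> 0 \<longleftrightarrow> i \<in> S" "\<forall>j\<in>J. dotp n u0 (lap_col n j (?m t j)) = 0"
      by blast
    define A where "A = (\<lambda>j. {x. dotp n u0 (lap_col n j x) = 0})"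
    have "{g. ?E (?m g)} \<subseteq> {g. \<forall>j\<in>?B. g j \<in> A j}"
    proof (intro subsetI CollectI ballI)
      fix g j assume g: "g \<in> {g. ?E (?m g)}" and j: "j \<in> ?B"
      then obtain u where u: "\<forall>i. u i \<noteq> 0 \<longleftrightarrow> i \<in> S" "\<forall>j\<in>J. dotp n u (lap_col n j (?m g j)) = 0"
        "determines n (\<lambda>j. lap_col n j (?m g j)) S K u" by blast
      have "dotp n u0 (lap_col n l (?m g l)) = 0" if "l \<in> K" for l
        using u0(2) K(1) that by (auto simp: subset_iff dest: bspec[of _ _ l])
      then obtain d where "u0 = qscale d u"
        using u(3) u0(1) unfolding determines_def by blast
      then have "dotp n u0 (lap_col n j (?m g j)) = d * dotp n u (lap_col n j (?m g j))"
        by (simp add: dotp_def qscale_apply sum_distrib_left mult_ac)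
      also have "dotp n u (lap_col n j (?m g j)) = 0" using u(2) j by blast
      finally show "g j \<in> A j" using j by (simp only: A_def mult_zero_right if_True mem_Collect_eq simp_thms)
    qed
    then have "measure_pmf.prob (Pi_pmf ?B (\<lambda>_. 0) (col_pmf n p)) {g. ?E (?m g)}
      \<le> measure_pmf.prob (Pi_pmf ?B (\<lambda>_. 0) (col_pmf n p)) {g. \<forall>j\<in>?B. g j \<in> A j}"
      by (intro measure_pmf.finite_measure_mono) auto
    also have "\<dots> = (\<Prod>j\<in>?B. measure_pmf.prob (col_pmf n p j) (A j))"
      using J by (intro Pi_pmf_box) auto
    also have "\<dots> \<le> (\<Prod>j\<in>?B. ?\<rho>)"
    proof (intro prod_mono conjI)
      fix j assume j: "j \<in> ?B"
      have jn: "j < n" using j J by auto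
      \<comment> \<open>For \<open>j\<close> outside \<open>S\<close> the diagonal entry is
        multiplied by \<open>u0 j = 0\<close>, so only the entries in the rows of \<open>S\<close>
        matter.\<close>
      have "dotp n u0 (lap_col n j x) = - (\<Sum>i\<in>S. of_int (x i) * u0 i)" for x
      proof -
        have "u0 j = 0" using j u0(1) by blast
        then have "dotp n u0 (lap_col n j x) = (\<Sum>i\<in>{..<n} - {j}. - (of_int (x i) * u0 i))"
          unfolding dotp_lap_col[OF jn] by simp
        also have "\<dots> = (\<Sum>i\<in>S. - (of_int (x i) * u0 i))"
          using S j u0(1) by (intro sum.mono_neutral_right) auto
        finally show ?thesis by (simp add: sum_negf)
      qed
      then have A: "A j = {x. (\<Sum>i\<in>S. of_int (x i) * u0 i) = 0}" by (auto simp: A_def)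
      have "measure_pmf.prob (col_pmf n p j) (A j) = measure_pmf.prob (Pi_pmf S 0 (\<lambda>_. p)) {x. (\<Sum>i\<in>S. of_int (x i) * u0 i) = 0}"
        unfolding A col_pmf_def
      proof (rule Pi_pmf_marginal)
        fix f g :: "nat \<Rightarrow> int" assume "\<And>i. i \<in> S \<Longrightarrow> f i = g i"
        then have "(\<Sum>i\<in>S. of_int (f i) * u0 i) = (\<Sum>i\<in>S. of_int (g i) * u0 i)" by (intro sum.cong) auto
        then show "((\<Sum>i\<in>S. of_int (f i) * u0 i) = 0) = ((\<Sum>i\<in>S. of_int (g i) * u0 i) = 0)" by simp
      qed (use S j in auto)
      also have "\<dots> \<le> ?\<rho>"
        using S u0(1) p finite_subset[OF S(1)] by (intro prob_linear_form_le) auto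
      finally show "measure_pmf.prob (col_pmf n p j) (A j) \<le> ?\<rho>" .
    qed simp
    also have "\<dots> = ?\<rho> ^ card ?B" by simp
    also have "\<dots> \<le> ?\<rho> ^ (card J - 2 * card S)"
    proof (rule power_decreasing[OF _ \<rho>])
      have "card J - card (S \<union> K) \<le> card (J - (S \<union> K))" by (rule diff_card_le_card_Diff) (use S K J finite_subset in blast)
      moreover have "card (S \<union> K) \<le> card S + card K" by (rule card_Un_le)
      moreover have "J - S - K = J - (S \<union> K)" by auto
      ultimately show "card J - 2 * card S \<le> card ?B" using K(2) by simp
    qed
    finally show ?thesis .
  qed
qed (use J in auto)

lemma prob_sparse_le:
  fixes \<alpha> :: real
  assumes J: "J \<subseteq> {..<n}" "b \<le> card J" and p: "\<And>x. pmf p x \<le> 1 - \<alpha>" "0 \<le> \<alpha>" "\<alpha> \<le> 1"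
  shows "measure_pmf.prob (Pi_pmf J (\<lambda>_. 0) (col_pmf n p)) {X. \<exists>w v. (\<forall>j\<in>J. dotp n w (lap_col n j (X j)) = 0)
      \<and> (\<exists>i<n. w i \<noteq> v) \<and> card {i\<in>{..<n}. w i \<noteq> v} \<le> b}
    \<le> (\<Sum>s=1..b. real (n choose s) * real (n choose (s - 1)) * max (3/4) (1 - \<alpha> * s / 2) ^ (card J - 2 * s))"
proof -
  have finJ: "finite J" using J finite_subset by blast
  let ?T = "\<lambda>s. {S. S \<subseteq> {..<n} \<and> card S = s} \<times> {K. K \<subseteq> J \<and> card K = s - 1}"
  let ?I = "SIGMA s:{1..b}. ?T s"
  let ?F = "\<lambda>S K. {X. \<exists>u. (\<forall>i. u i \<noteq> 0 \<longleftrightarrow> i \<in> S)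
      \<and> (\<forall>j\<in>J. dotp n u (lap_col n j (X j)) = 0) \<and> determines n (\<lambda>j. lap_col n j (X j)) S K u}"
  let ?b = "\<lambda>s. max (3/4) (1 - \<alpha> * real s / 2) ^ (card J - 2 * s)"
  have "finite {K. K \<subseteq> A \<and> card K = s}" if "finite A" for A :: "nat set" and s
    by (rule finite_subset[of _ "Pow A"]) (use that in auto)
  then have finT: "finite (?T s)" for s using finJ by (intro finite_cartesian_product) auto
  have "measure_pmf.prob (Pi_pmf J (\<lambda>_. 0) (col_pmf n p)) {X. \<exists>w v. (\<forall>j\<in>J. dotp n w (lap_col n j (X j)) = 0)
      \<and> (\<exists>i<n. w i \<noteq> v) \<and> card {i\<in>{..<n}. w i \<noteq> v} \<le> b} \<le> (\<Sum>x\<in>?I. ?b (fst x))"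
  proof (rule prob_union_le[where F = "\<lambda>(s, S, K). ?F S K"])
    show "finite ?I" by (rule finite_SigmaI[OF _ finT]) simp
    show "{X. \<exists>w v. (\<forall>j\<in>J. dotp n w (lap_col n j (X j)) = 0)
      \<and> (\<exists>i<n. w i \<noteq> v) \<and> card {i\<in>{..<n}. w i \<noteq> v} \<le> b} \<subseteq> (\<Union>x\<in>?I. case x of (s, S, K) \<Rightarrow> ?F S K)"
    proof
      fix X assume "X \<in> {X. \<exists>w v. (\<forall>j\<in>J. dotp n w (lap_col n j (X j)) = 0)
      \<and> (\<exists>i<n. w i \<noteq> v) \<and> card {i\<in>{..<n}. w i \<noteq> v} \<le> b}"
      then obtain w v where wv: "\<And>j. j \<in> J \<Longrightarrow> dotp n w (lap_col n j (X j)) = 0" "\<exists>i<n. w i \<noteq> v" "card {i\<in>{..<n}. w i \<noteq> v} \<le> b"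
        by blast
      have c0: "lap_col n j (X j) \<in> sum0 n" if "j \<in> J" for j using that J(1) by (intro lap_col_in_sum0) auto
      obtain S K u where su: "S \<subseteq> {..<n}" "1 \<le> card S" "card S \<le> b" "K \<subseteq> J" "card K = card S - 1"
        "\<And>i. u i \<noteq> 0 \<longleftrightarrow> i \<in> S" "\<And>j. j \<in> J \<Longrightarrow> dotp n u (lap_col n j (X j)) = 0" "determines n (\<lambda>j. lap_col n j (X j)) S K u"
        by (rule minimal_sparse_annihilator[where c = "\<lambda>j. lap_col n j (X j)" and n = n and w = w and v = v, OF finJ J(2) c0 wv]) (assumption, assumption, rule that)
      have "(card S, S, K) \<in> ?I" using su(1-5) by auto
      moreover have "X \<in> ?F S K" unfolding mem_Collect_eq
        by (intro exI[of _ u] conjI allI ballI su(6) su(7) su(8))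
      ultimately      show "X \<in> (\<Union>x\<in>?I. case x of (s, S, K) \<Rightarrow> ?F S K)" by (intro UN_I[of "(card S, S, K)"]) simp_all
    qed
    fix x assume "x \<in> ?I"
    then obtain s S K where x: "x = (s, S, K)" "1 \<le> s" "S \<subseteq> {..<n}" "card S = s" "K \<subseteq> J" "card K = s - 1" by auto
    then show "measure_pmf.prob (Pi_pmf J (\<lambda>_. 0) (col_pmf n p)) (case x of (s, S, K) \<Rightarrow> ?F S K) \<le> ?b (fst x)"
      using prob_sparse_annihilator_le[OF finJ J(1), of S K p \<alpha>] p by simp
  qed
  also have "(\<Sum>x\<in>?I. ?b (fst x)) = (\<Sum>s=1..b. \<Sum>y\<in>?T s. ?b s)"
    using finT by (subst sum.Sigma) (auto simp: case_prod_beta)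
  also have "\<dots> = (\<Sum>s=1..b. real (n choose s) * real (card J choose (s - 1)) * ?b s)"
    using finJ by (simp add: card_cartesian_product n_subsets)
  also have "\<dots> \<le> (\<Sum>s=1..b. real (n choose s) * real (n choose (s - 1)) * ?b s)"
  proof (intro sum_mono mult_right_mono mult_left_mono)
    have "card J \<le> n" using card_mono[OF _ J(1)] by simp
    then show "real (card J choose (s - 1)) \<le> real (n choose (s - 1))" for s
      by (simp add: binomial_right_mono)
  qed (auto intro!: zero_le_power simp: le_max_iff_disj)
  finally show ?thesis .
qed

subsection \<open>The swapping argument\<close>

text \<open>A fixed choice makes the hyperplane a function of \<open>B\<close> alone, so that it
  stays put when other columns are resampled.\<close>

definition completion :: "nat \<Rightarrow> (nat \<Rightarrow> rat) set \<Rightarrow> (nat \<Rightarrow> rat) set" where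
  "completion n B = (SOME F. F \<subseteq> sum0_basis n \<and> F \<inter> B = {} \<and> card F = n - 2 - card B \<and> ratfun.independent (B \<union> F)
    \<and> (\<exists>w. (\<forall>h\<in>sum0 n. h \<in> ratfun.span (B \<union> F) \<longleftrightarrow> dotp n w h = 0) \<and> (\<exists>h\<in>sum0 n. dotp n w h \<noteq> 0)))"

definition hyperplane :: "nat \<Rightarrow> (nat \<Rightarrow> rat) set \<Rightarrow> (nat \<Rightarrow> rat) set" where
  "hyperplane n B = ratfun.span (B \<union> completion n B)"

lemma completion:
  assumes "ratfun.independent B" "finite B" "B \<subseteq> sum0 n" "card B < n - 1"
  shows "completion n B \<subseteq> sum0_basis n" "completion n B \<inter> B = {}" "card (completion n B) = n - 2 - card B"
    "ratfun.independent (B \<union> completion n B)"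
    "\<exists>w. (\<forall>h\<in>sum0 n. h \<in> hyperplane n B \<longleftrightarrow> dotp n w h = 0) \<and> (\<exists>h\<in>sum0 n. dotp n w h \<noteq> 0)"
proof -
  obtain F w where "F \<subseteq> sum0_basis n" "F \<inter> B = {}" "card F = n - 2 - card B" "ratfun.independent (B \<union> F)"
    "\<And>h. h \<in> sum0 n \<Longrightarrow> h \<in> ratfun.span (B \<union> F) \<longleftrightarrow> dotp n w h = 0" "\<exists>h\<in>sum0 n. dotp n w h \<noteq> 0"
    by (rule hyperplane_completion[OF assms], rule that)
  then have "\<exists>F. F \<subseteq> sum0_basis n \<and> F \<inter> B = {} \<and> card F = n - 2 - card B \<and> ratfun.independent (B \<union> F)
    \<and> (\<exists>w. (\<forall>h\<in>sum0 n. h \<in> ratfun.span (B \<union> F) \<longleftrightarrow> dotp n w h = 0) \<and> (\<exists>h\<in>sum0 n. dotp n w h \<noteq> 0))"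
    by blast
  from someI_ex[OF this] show "completion n B \<subseteq> sum0_basis n" "completion n B \<inter> B = {}" "card (completion n B) = n - 2 - card B"
    "ratfun.independent (B \<union> completion n B)"
    "\<exists>w. (\<forall>h\<in>sum0 n. h \<in> hyperplane n B \<longleftrightarrow> dotp n w h = 0) \<and> (\<exists>h\<in>sum0 n. dotp n w h \<noteq> 0)"
    unfolding completion_def[symmetric] hyperplane_def[symmetric] by blast+
qed

text \<open>Fubini as a lower bound; \<open>inv\<close> says that \<open>Q\<close> and
  \<open>R\<close> ignore the value at \<open>x\<close>, so the new coordinate is independent of
  what they read off \<open>f\<close>.\<close>

lemma prob_Pi_insert_ge:
  assumes A: "finite A" "x \<notin> A" and c: "0 \<le> c"
    and inv: "\<And>f y. Q (f(x := y)) = Q f" "\<And>f y z. R (f(x := y)) z = R f z"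
    and R: "\<And>f. Q f \<Longrightarrow> c \<le> measure_pmf.prob (p x) {z. R f z}"
  shows "measure_pmf.prob (Pi_pmf A d p) {f. Q f} * c \<le> measure_pmf.prob (Pi_pmf (insert x A) d p) {f. Q f \<and> R f (f x)}"
proof -
  have "ennreal (measure_pmf.prob (Pi_pmf A d p) {f. Q f} * c) = (\<integral>\<^sup>+f. indicator {f. Q f} f * ennreal c \<partial>Pi_pmf A d p)"
    using c by (simp add: nn_integral_multc ennreal_mult measure_pmf.emeasure_eq_measure)
  also have "\<dots> \<le> (\<integral>\<^sup>+f. (\<integral>\<^sup>+z. indicator {f. Q f} f * indicator {z. R f z} z \<partial>p x) \<partial>Pi_pmf A d p)"
  proof (intro nn_integral_mono)
    fix f
    have "ennreal c \<le> (\<integral>\<^sup>+z. indicator {z. R f z} z \<partial>p x)" if "Q f"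
      using R[OF that] by (simp add: measure_pmf.emeasure_eq_measure ennreal_leI)
    then show "indicator {f. Q f} f * ennreal c \<le> (\<integral>\<^sup>+z. indicator {f. Q f} f * indicator {z. R f z} z \<partial>p x)"
      by (auto simp: indicator_def)
  qed
  also have "\<dots> = (\<integral>\<^sup>+(f, z). indicator {f. Q f} f * indicator {z. R f z} z \<partial>pair_pmf (Pi_pmf A d p) (p x))"
    by (simp add: nn_integral_pair_pmf')
  also have "\<dots> = (\<integral>\<^sup>+(z, f). indicator {f. Q f} f * indicator {z. R f z} z \<partial>pair_pmf (p x) (Pi_pmf A d p))"
    by (subst pair_commute_pmf) (simp add: case_prod_unfold)
  also have "\<dots> = (\<integral>\<^sup>+f. indicator {f. Q f \<and> R f (f x)} f \<partial>Pi_pmf (insert x A) d p)"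
    unfolding Pi_pmf_insert[OF A] nn_integral_map_pmf
    by (intro nn_integral_cong) (auto simp: indicator_def inv)
  also have "\<dots> = ennreal (measure_pmf.prob (Pi_pmf (insert x A) d p) {f. Q f \<and> R f (f x)})"
    by (simp add: measure_pmf.emeasure_eq_measure)
  finally show ?thesis by simp
qed

text \<open>Sample one vector at a time: it lies in \<open>V\<close> with probability q, and in the
  span of \<open>F\<close> and its predecessors with probability at most \<delta> \<le> q / 2; so it
  is a fresh vector of \<open>V\<close> with probability at least q / 2.\<close>

lemma prob_independent_in_subspace_ge:
  fixes C :: "'b \<Rightarrow> 'i \<Rightarrow> rat" and \<delta> :: real
  assumes F: "finite F" "ratfun.independent F" "card F + r \<le> m"
    and \<delta>: "\<And>G. finite G \<Longrightarrow> card G \<le> m \<Longrightarrow> measure_pmf.prob p {x. C x \<in> ratfun.span G} \<le> \<delta>"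
    and q: "2 * \<delta> \<le> measure_pmf.prob p {x. C x \<in> V}"
  shows "(measure_pmf.prob p {x. C x \<in> V} / 2) ^ r \<le> measure_pmf.prob (Pi_pmf {..<r} d (\<lambda>_. p))
    {Y. (\<forall>l<r. C (Y l) \<in> V) \<and> inj_on (\<lambda>l. C (Y l)) {..<r} \<and> (\<lambda>l. C (Y l)) ` {..<r} \<inter> F = {}
      \<and> ratfun.independent ((\<lambda>l. C (Y l)) ` {..<r} \<union> F)}"
  using F(3)
proof (induction r)
  case 0
  then show ?case using F by simp
next
  case (Suc r)
  let ?q = "measure_pmf.prob p {x. C x \<in> V}"
  define I where "I = (\<lambda>(r::nat) Y. (\<forall>l<r. C (Y l) \<in> V) \<and> inj_on (\<lambda>l. C (Y l)) {..<r} \<and> (\<lambda>l. C (Y l)) ` {..<r} \<inter> F = {}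
      \<and> ratfun.independent ((\<lambda>l. C (Y l)) ` {..<r} \<union> F))"
  let ?G = "\<lambda>Y. (\<lambda>l. C (Y l)) ` {..<r} \<union> F"
  let ?R = "\<lambda>Y z. C z \<in> V \<and> C z \<notin> ratfun.span (?G Y)"
  have "(?q / 2) ^ Suc r \<le> measure_pmf.prob (Pi_pmf {..<r} d (\<lambda>_. p)) {Y. I r Y} * (?q / 2)"
    unfolding power_Suc2 I_def using Suc.IH Suc.prems by (intro mult_right_mono) auto
  also have "\<dots> \<le> measure_pmf.prob (Pi_pmf (insert r {..<r}) d (\<lambda>_. p)) {Y. I r Y \<and> ?R Y (Y r)}"
  proof (rule prob_Pi_insert_ge)
    fix Y :: "nat \<Rightarrow> 'b" and y z
    have im: "(\<lambda>l. C ((Y(r := y)) l)) ` {..<r} = (\<lambda>l. C (Y l)) ` {..<r}" by (intro image_cong) auto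
    have inj: "inj_on (\<lambda>l. C ((Y(r := y)) l)) {..<r} = inj_on (\<lambda>l. C (Y l)) {..<r}" by (intro inj_on_cong) auto
    show "I r (Y(r := y)) = I r Y" unfolding I_def im inj by simp
    show "?R (Y(r := y)) z = ?R Y z" unfolding im ..
  next
    fix Y :: "nat \<Rightarrow> 'b"
    have "card (?G Y) \<le> card ((\<lambda>l. C (Y l)) ` {..<r}) + card F" by (rule card_Un_le)
    also have "\<dots> \<le> r + card F" using card_image_le[of "{..<r}" "\<lambda>l. C (Y l)"] by simp
    finally have "measure_pmf.prob p {x. C x \<in> ratfun.span (?G Y)} \<le> \<delta>"
      using Suc.prems F(1) by (intro \<delta>) auto
    moreover have "?q \<le> measure_pmf.prob p ({z. ?R Y z} \<union> {x. C x \<in> ratfun.span (?G Y)})"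
      by (intro measure_pmf.finite_measure_mono) auto
    moreover have "\<dots> \<le> measure_pmf.prob p {z. ?R Y z} + measure_pmf.prob p {x. C x \<in> ratfun.span (?G Y)}"
      by (rule measure_Un_le) auto
    ultimately show "?q / 2 \<le> measure_pmf.prob p {z. ?R Y z}" using q by linarith
  qed auto
  also have "\<dots> \<le> measure_pmf.prob (Pi_pmf (insert r {..<r}) d (\<lambda>_. p)) {Y. I (Suc r) Y}"
  proof (intro measure_pmf.finite_measure_mono subsetI CollectI)
    fix Y assume "Y \<in> {Y. I r Y \<and> ?R Y (Y r)}"
    then have Y: "I r Y" "C (Y r) \<in> V" "C (Y r) \<notin> ratfun.span (?G Y)" by auto
    have nG: "C (Y r) \<notin> ?G Y" using Y(3) ratfun.span_base by metis
    have "ratfun.independent (insert (C (Y r)) (?G Y))"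
      using Y(1,3) by (intro ratfun.independent_insertI) (auto simp: I_def)
    moreover have "(\<lambda>l. C (Y l)) ` {..<Suc r} \<union> F = insert (C (Y r)) (?G Y)"
      by (auto simp: lessThan_Suc)
    moreover have "(\<lambda>l. C (Y l)) ` {..<Suc r} \<inter> F = {}" using Y(1) nG by (auto simp: I_def lessThan_Suc)
    moreover have "inj_on (\<lambda>l. C (Y l)) {..<Suc r}" using Y(1) nG by (auto simp: I_def lessThan_Suc)
    moreover have "\<forall>l<Suc r. C (Y l) \<in> V" using Y(1,2) by (auto simp: I_def less_Suc_eq)
    ultimately show "I (Suc r) Y" unfolding I_def by simp
  qed auto
  finally show ?case by (simp only: I_def lessThan_Suc)
qed

lemma nn_integral_pmf_swap:
  "(\<integral>\<^sup>+x. \<integral>\<^sup>+y. f x y \<partial>measure_pmf B \<partial>measure_pmf A) = (\<integral>\<^sup>+y. \<integral>\<^sup>+x. f x y \<partial>measure_pmf A \<partial>measure_pmf B)"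
proof -
  have "(\<integral>\<^sup>+x. \<integral>\<^sup>+y. f x y \<partial>measure_pmf B \<partial>measure_pmf A) = (\<integral>\<^sup>+z. f (fst z) (snd z) \<partial>pair_pmf A B)"
    by (simp add: nn_integral_pair_pmf')
  also have "\<dots> = (\<integral>\<^sup>+z. f (snd z) (fst z) \<partial>pair_pmf B A)"
    by (subst pair_commute_pmf) (simp add: case_prod_unfold)
  also have "\<dots> = (\<integral>\<^sup>+y. \<integral>\<^sup>+x. f x y \<partial>measure_pmf A \<partial>measure_pmf B)"
    by (simp add: nn_integral_pair_pmf')
  finally show ?thesis .
qed

text \<open>The swapping argument of Kahn, Komlos and Szemeredi. If the hyperplane \<open>V\<close> spanned by the columns
  (and fixed vectors \<open>F\<close>) is hit by the lazy column with probability \<open>q\<close> and by the true columns with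
  probability at most \<open>2 q / k\<close>, then \<open>r\<close> lazy columns can replace \<open>r\<close> of the true ones in spanning \<open>V\<close>,
  and the freed columns contribute a factor \<open>(2 q / k) ^ r\<close> against the cost \<open>(2 / q) ^ r\<close>.\<close>

lemma prob_swap_le:
  fixes p p' :: "int pmf" and k r :: nat and \<delta> :: real
  assumes L: "L \<subseteq> {..<n}" "i < n" "i \<notin> L" "js < n" "r \<le> card L" "card L < n - 1" and k: "k \<ge> 2"
    and \<delta>: "\<And>G. finite G \<Longrightarrow> card G \<le> n - 2 - card L + r \<Longrightarrow>
      measure_pmf.prob (col_pmf n p' js) {x. lap_col n js x \<in> ratfun.span G} \<le> \<delta>"
  defines "q \<equiv> \<lambda>V. measure_pmf.prob (col_pmf n p' js) {x. lap_col n js x \<in> V}"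
  defines "good \<equiv> \<lambda>V. 0 < q V \<and> 2 * \<delta> \<le> q V \<and>
    (\<forall>j\<in>insert i L. measure_pmf.prob (col_pmf n p j) {x. lap_col n j x \<in> V} \<le> 2 * q V / k)"
  shows "measure_pmf.prob (Pi_pmf (insert i L) (\<lambda>_. 0) (col_pmf n p))
      {X. inj_on (\<lambda>j. lap_col n j (X j)) L \<and> ratfun.independent ((\<lambda>j. lap_col n j (X j)) ` L)
        \<and> lap_col n i (X i) \<in> hyperplane n ((\<lambda>j. lap_col n j (X j)) ` L)
        \<and> good (hyperplane n ((\<lambda>j. lap_col n j (X j)) ` L))} \<le> 4 ^ n * (4 / real k) ^ r"
proof -
  have finL: "finite L" using L finite_subset by blast
  let ?A = "insert i L"
  let ?PX = "Pi_pmf ?A (\<lambda>_. 0) (col_pmf n p)"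
  let ?PY = "Pi_pmf {..<r} (\<lambda>_. 0) (\<lambda>_. col_pmf n p' js)"
  define cX where "cX = (\<lambda>X j. lap_col n j (X j))"
  define cY where "cY = (\<lambda>Y (l::nat). lap_col n js (Y l))"
  define bad where "bad = {X. inj_on (cX X) L \<and> ratfun.independent (cX X ` L)
    \<and> cX X i \<in> hyperplane n (cX X ` L) \<and> good (hyperplane n (cX X ` L))}"
  \<comment> \<open>The index set of the union bound: the true columns \<open>K\<close> that are
    kept and the completing vectors \<open>F\<close>, each with at most \<open>2 ^ n\<close>
    possibilities.\<close>
  define T where "T = {K. K \<subseteq> L \<and> card K + r = card L} \<times> Pow (sum0_basis n)"
  define W where "W = (\<lambda>(K, F) X Y. ratfun.span (cX X ` K \<union> cY Y ` {..<r} \<union> F))"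
  \<comment> \<open>The inverse of the lower bound \<open>(q V / 2) ^ r\<close> for drawing
    \<open>r\<close> usable lazy columns; with this weight the indicator of \<open>bad\<close> is
    dominated by an average over \<open>Y\<close>.\<close>
  define wt where "wt = (\<lambda>V. ennreal ((2 / q V) ^ r))"
  define g where "g = (\<lambda>(K, F) X Y. if good (W (K, F) X Y) \<and> (\<forall>j\<in>?A - K. cX X j \<in> W (K, F) X Y) then wt (W (K, F) X Y) else 0)"
  define I where "I = (\<lambda>V F Y. (\<forall>l<r. cY Y l \<in> V) \<and> inj_on (cY Y) {..<r} \<and> cY Y ` {..<r} \<inter> F = {}
      \<and> ratfun.independent (cY Y ` {..<r} \<union> F))"
  have finT: "finite T"
  proof -
    have "finite {K. K \<subseteq> L \<and> card K + r = card L}" by (rule finite_subset[of _ "Pow L"]) (use finL in auto)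
    then show ?thesis by (simp add: T_def)
  qed
  have cardT: "card T \<le> 4 ^ n"
  proof -
    have "card {K. K \<subseteq> L \<and> card K + r = card L} \<le> card (Pow L)" using finL by (intro card_mono) auto
    also have "\<dots> = 2 ^ card L" using finL by (simp add: card_Pow)
    also have "\<dots> \<le> 2 ^ n" using card_mono[OF _ L(1)] by (intro power_increasing) auto
    finally have 1: "card {K. K \<subseteq> L \<and> card K + r = card L} \<le> 2 ^ n" .
    have "card (Pow (sum0_basis n)) = 2 ^ card (sum0_basis n)" by (simp add: card_Pow)
    also have "\<dots> \<le> 2 ^ n" using card_sum0_basis[of n] by (intro power_increasing) auto
    finally have "card T \<le> 2 ^ n * 2 ^ n" unfolding T_def card_cartesian_product using 1 by (intro mult_mono) auto
    also have "\<dots> = (4::nat) ^ n" by (simp flip: power_mult_distrib)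
    finally show ?thesis .
  qed
  have key: "indicator bad X \<le> (\<integral>\<^sup>+Y. (\<Sum>t\<in>T. g t X Y) \<partial>?PY)" for X
  proof (cases "X \<in> bad")
    case True
    define B where "B = cX X ` L"
    define V where "V = hyperplane n B"
    define F where "F = completion n B"
    have X: "inj_on (cX X) L" "ratfun.independent B" "cX X i \<in> V" "good V"
      using True by (auto simp: bad_def B_def V_def)
    have B: "finite B" "B \<subseteq> sum0 n" "card B = card L"
      using finL L lap_col_in_sum0 X(1) by (auto simp: B_def cX_def card_image subset_iff)
    have F: "F \<subseteq> sum0_basis n" "F \<inter> B = {}" "card F = n - 2 - card L" "ratfun.independent (B \<union> F)"
      using completion[OF X(2) B(1,2)] B(3) L by (auto simp: F_def)
    have finF: "finite F" using finite_subset[OF F(1)] by simp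
    have VBF: "V = ratfun.span (B \<union> F)" by (simp add: V_def F_def hyperplane_def)
    have q: "0 < q V" "2 * \<delta> \<le> q V" using X(4) by (auto simp: good_def)
    have indF: "ratfun.independent F" using F(4) by (rule ratfun.independent_mono) (rule Un_upper2)
    have PI: "(q V / 2) ^ r \<le> measure_pmf.prob ?PY {Y. I V F Y}"
      unfolding I_def cY_def q_def
      using F(3) q(2) indF finF \<delta>
      by (intro prob_independent_in_subspace_ge[where m = "n - 2 - card L + r" and \<delta> = \<delta>]) (auto simp: q_def)
    have "1 = ennreal ((2 / q V) ^ r * (q V / 2) ^ r)" using q by (simp flip: power_mult_distrib)
    also have "\<dots> \<le> ennreal ((2 / q V) ^ r * measure_pmf.prob ?PY {Y. I V F Y})"
      using q PI by (intro ennreal_leI mult_left_mono) auto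
    also have "\<dots> = (\<integral>\<^sup>+Y. wt V * indicator {Y. I V F Y} Y \<partial>?PY)"
      using q by (simp add: wt_def nn_integral_cmult ennreal_mult measure_pmf.emeasure_eq_measure)
    also have "\<dots> \<le> (\<integral>\<^sup>+Y. (\<Sum>t\<in>T. g t X Y) \<partial>?PY)"
    proof (intro nn_integral_mono)
      fix Y
      show "wt V * indicator {Y. I V F Y} Y \<le> (\<Sum>t\<in>T. g t X Y)"
      proof (cases "I V F Y")
        case False
        then show ?thesis by simp
      next
        case True
        have fY: "finite (cY Y ` {..<r})" by simp
        have YV: "cY Y ` {..<r} \<subseteq> ratfun.span (cX X ` L \<union> F)" using True VBF by (auto simp: I_def B_def)
        have Yd: "cY Y ` {..<r} \<inter> F = {}" "ratfun.independent (cY Y ` {..<r} \<union> F)" using True by (auto simp: I_def)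
        have cYr: "card (cY Y ` {..<r}) = r" using True by (simp add: I_def card_image)
        obtain K where K: "K \<subseteq> L" "card K + card (cY Y ` {..<r}) = card L"
          "ratfun.span (cX X ` K \<union> cY Y ` {..<r} \<union> F) = ratfun.span (cX X ` L \<union> F)"
          using steinitz_completion[OF X(1) finL finF _ _ fY Yd YV] F(2,4) unfolding B_def by metis
        have WV: "W (K, F) X Y = V" using K(3) VBF by (simp add: W_def B_def)
        have "cX X j \<in> V" if "j \<in> ?A" for j
        proof (cases "j = i")
          case False
          then show ?thesis unfolding VBF using that by (intro ratfun.span_base) (auto simp: B_def)
        qed (use X(3) in simp)
        then have "g (K, F) X Y = wt V" using X(4) by (auto simp: g_def WV)
        moreover have "(K, F) \<in> T" using K cYr F(1) by (auto simp: T_def)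
        ultimately have "wt V \<le> (\<Sum>t\<in>T. g t X Y)" using finT by (metis member_le_sum zero_le)
        then show ?thesis using True by simp
      qed
    qed
    finally show ?thesis using True by simp
  qed simp
  have bound: "(\<integral>\<^sup>+X. g t X Y \<partial>?PX) \<le> ennreal ((4 / real k) ^ r)" if t: "t \<in> T" for t Y
  proof -
    obtain K F where tKF: "t = (K, F)" and K: "K \<subseteq> L" "card K + r = card L" using t by (auto simp: T_def)
    let ?B = "?A - K"
    show ?thesis
    proof (rule Pi_pmf_conditioning_nn[where B = ?B])
      fix f :: "nat \<Rightarrow> nat \<Rightarrow> int"
      let ?m = "\<lambda>h j. if j \<in> ?B then h j else f j"
      \<comment> \<open>\<open>W\<close> involves only the kept columns, so \<open>V\<close> is
        fixed while the columns outside \<open>K\<close> are resampled.\<close>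
      define V where "V = W (K, F) f Y"
      have "cX (?m h) ` K = cX f ` K" for h by (intro image_cong) (auto simp: cX_def)
      then have WV: "W t (?m h) Y = V" for h by (simp only: W_def V_def tKF case_prod_conv)
      have cB: "card ?B = Suc r"
      proof -
        have "card ?B = card ?A - card K" using K finL finite_subset by (intro card_Diff_subset) auto
        then show ?thesis using K L finL by simp
      qed
      show "(\<integral>\<^sup>+h. g t (?m h) Y \<partial>Pi_pmf ?B (\<lambda>_. 0) (col_pmf n p)) \<le> ennreal ((4 / real k) ^ r)"
      proof (cases "good V")
        case False
        then have "g t (?m h) Y = 0" for h using WV[of h] by (simp only: g_def tKF case_prod_conv simp_thms if_False)
        then show ?thesis by simp
      next
        case True
        let ?E = "{h. \<forall>j\<in>?B. h j \<in> {x. lap_col n j x \<in> V}}"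
        have gE: "g t (?m h) Y = wt V * indicator ?E h" for h
        proof -
          have "(\<forall>j\<in>?B. cX (?m h) j \<in> V) \<longleftrightarrow> h \<in> ?E" by (auto simp: cX_def)
          then show ?thesis using WV[of h] True
            by (simp only: g_def tKF case_prod_conv simp_thms indicator_def of_bool_def) simp
        qed
        have q: "0 < q V" using True by (simp add: good_def)
        have q1: "q V \<le> 1" by (simp add: q_def)
        have "measure_pmf.prob (Pi_pmf ?B (\<lambda>_. 0) (col_pmf n p)) ?E
          = (\<Prod>j\<in>?B. measure_pmf.prob (col_pmf n p j) {x. lap_col n j x \<in> V})"
          using finL by (intro Pi_pmf_box) auto
        also have "\<dots> \<le> (\<Prod>j\<in>?B. 2 * q V / k)"
          using True by (intro prod_mono) (auto simp: good_def)
        also have "\<dots> = (2 * q V / k) ^ r * (2 * q V / k)" by (simp only: prod_constant cB power_Suc2)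
        \<comment> \<open>Column \<open>i\<close> comes on top of the \<open>r\<close> freed
          columns; its factor is at most 1 and is given up.\<close>
        also have "\<dots> \<le> (2 * q V / k) ^ r * 1"
          using q q1 k by (intro mult_left_mono) (auto simp: divide_le_eq)
        finally have PE: "measure_pmf.prob (Pi_pmf ?B (\<lambda>_. 0) (col_pmf n p)) ?E \<le> (2 * q V / k) ^ r" by simp
        have "(\<integral>\<^sup>+h. g t (?m h) Y \<partial>Pi_pmf ?B (\<lambda>_. 0) (col_pmf n p))
          = wt V * ennreal (measure_pmf.prob (Pi_pmf ?B (\<lambda>_. 0) (col_pmf n p)) ?E)"
          unfolding gE by (simp add: nn_integral_cmult measure_pmf.emeasure_eq_measure)
        also have "\<dots> \<le> wt V * ennreal ((2 * q V / k) ^ r)"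
          using PE by (intro mult_left_mono ennreal_leI) auto
        also have "\<dots> = ennreal ((2 / q V) ^ r * (2 * q V / k) ^ r)"
          unfolding wt_def using q by (intro ennreal_mult[symmetric]) auto
        also have "(2 / q V) ^ r * (2 * q V / k) ^ r = (4 / real k) ^ r"
          using q by (simp flip: power_mult_distrib)
        finally show ?thesis .
      qed
    qed (use finL in auto)
  qed
  have "ennreal (measure_pmf.prob ?PX bad) = (\<integral>\<^sup>+X. indicator bad X \<partial>?PX)"
    by (simp add: measure_pmf.emeasure_eq_measure)
  also have "\<dots> \<le> (\<integral>\<^sup>+X. \<integral>\<^sup>+Y. (\<Sum>t\<in>T. g t X Y) \<partial>?PY \<partial>?PX)"
    by (intro nn_integral_mono key)
  also have "\<dots> = (\<integral>\<^sup>+Y. \<integral>\<^sup>+X. (\<Sum>t\<in>T. g t X Y) \<partial>?PX \<partial>?PY)"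
    by (rule nn_integral_pmf_swap)
  also have "\<dots> = (\<integral>\<^sup>+Y. (\<Sum>t\<in>T. \<integral>\<^sup>+X. g t X Y \<partial>?PX) \<partial>?PY)"
    by (subst nn_integral_sum) auto
  also have "\<dots> \<le> (\<integral>\<^sup>+Y. (\<Sum>t\<in>T. ennreal ((4 / real k) ^ r)) \<partial>?PY)"
    by (intro nn_integral_mono sum_mono bound)
  also have "\<dots> = ennreal (card T * (4 / real k) ^ r)"
    by (simp add: measure_pmf.emeasure_space_1 ennreal_mult ennreal_of_nat_eq_real_of_nat)
  also have "\<dots> \<le> ennreal (4 ^ n * (4 / real k) ^ r)"
    using cardT by (intro ennreal_leI mult_right_mono) (auto simp flip: of_nat_power_eq_of_nat_cancel_iff of_nat_le_iff)
  finally show ?thesis unfolding bad_def cX_def by (subst (asm) ennreal_le_iff) auto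
qed

subsection \<open>The singularity bound\<close>

lemma prob_new_column_in_span_le:
  fixes \<alpha> :: real
  assumes L: "finite L" "i \<notin> L" "i < n" and p: "\<And>x. pmf p x \<le> 1 - \<alpha>" "0 \<le> \<alpha>" "\<alpha> \<le> 1"
  shows "measure_pmf.prob (Pi_pmf (insert i L) (\<lambda>_. 0) (col_pmf n p))
    {X. lap_col n i (X i) \<in> ratfun.span ((\<lambda>j. lap_col n j (X j)) ` L)} \<le> (1 - \<alpha>) ^ (n - 1 - card L)"
proof (rule Pi_pmf_conditioning[where B = "{i}"])
  fix f :: "nat \<Rightarrow> nat \<Rightarrow> int"
  let ?G = "(\<lambda>j. lap_col n j (f j)) ` L"
  have im: "(\<lambda>j. lap_col n j (if j \<in> {i} then g j else f j)) ` L = ?G" for g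
    using L(2) by (intro image_cong) auto
  have "{g. lap_col n i (if i \<in> {i} then g i else f i) \<in> ratfun.span ((\<lambda>j. lap_col n j (if j \<in> {i} then g j else f j)) ` L)}
    = {g. \<forall>j\<in>{i}. g j \<in> {x. lap_col n j x \<in> ratfun.span ?G}}"
    unfolding im by simp
  then have "measure_pmf.prob (Pi_pmf {i} (\<lambda>_. 0) (col_pmf n p))
      {g. lap_col n i (if i \<in> {i} then g i else f i) \<in> ratfun.span ((\<lambda>j. lap_col n j (if j \<in> {i} then g j else f j)) ` L)}
    = measure_pmf.prob (col_pmf n p i) {x. lap_col n i x \<in> ratfun.span ?G}"
    by (simp only: Pi_pmf_box finite.intros) simp
  also have "\<dots> \<le> (1 - \<alpha>) ^ (n - 1 - card L)"
    using L p card_image_le[OF L(1)] by (intro prob_lap_col_span_le) auto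
  finally show "measure_pmf.prob (Pi_pmf {i} (\<lambda>_. 0) (col_pmf n p))
      {g. lap_col n i (if i \<in> {i} then g i else f i) \<in> ratfun.span ((\<lambda>j. lap_col n j (if j \<in> {i} then g j else f j)) ` L)}
    \<le> (1 - \<alpha>) ^ (n - 1 - card L)" .
qed (use L p in auto)

text \<open>Without sparse normals the comparison holds for every column with error
  \<open>e\<close>. If column \<open>i\<close> hits the hyperplane with probability at most
  \<open>2 * e\<close>, exposing it last suffices. Otherwise the comparison forces a lazy
  probability above \<open>k * e\<close>, the error is absorbed into a factor 2, and swapping
  applies. Columns of different index have different laws, so the index \<open>js\<close> of largest
  lazy probability supplies all lazy columns; the union over \<open>js\<close> gives the factor
  \<open>n\<close>.\<close>

lemma prob_first_dependence_le:
  fixes \<alpha> e \<mu> :: real and k r h b :: nat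
  defines "\<mu> \<equiv> 1 / (36 * (real k)\<^sup>2)"
  defines "e \<equiv> exp (- (real b * \<alpha>) / (18 * (real k)\<^sup>2))"
  assumes L: "L \<subseteq> {..<n}" "i < n" "i \<notin> L" "card L < n - 1" "h \<le> card L" "r \<le> h" and k: "k \<ge> 2"
    and p: "\<And>x. pmf p x \<le> 1 - \<alpha>" "0 \<le> \<alpha>" "\<alpha> \<le> 1"
    and \<delta>: "2 * (1 - \<mu> * \<alpha>) ^ (h - r) \<le> real k * e"
  shows "measure_pmf.prob (Pi_pmf (insert i L) (\<lambda>_. 0) (col_pmf n p))
    {X. inj_on (\<lambda>j. lap_col n j (X j)) L \<and> ratfun.independent ((\<lambda>j. lap_col n j (X j)) ` L)
      \<and> lap_col n i (X i) \<in> ratfun.span ((\<lambda>j. lap_col n j (X j)) ` L)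
      \<and> (\<forall>w v. (\<forall>j\<in>L. dotp n w (lap_col n j (X j)) = 0) \<longrightarrow> (\<exists>i<n. w i \<noteq> v) \<longrightarrow> b < card {i\<in>{..<n}. w i \<noteq> v})}
    \<le> 2 * e + n * (4 ^ n * (4 / real k) ^ r)" (is "measure_pmf.prob ?PX ?E \<le> _")
proof -
  have finL: "finite L" using L finite_subset by blast
  define \<delta> where "\<delta> = (1 - \<mu> * \<alpha>) ^ (h - r)"
  have k0: "real k > 0" using k by simp
  have \<mu>: "0 \<le> \<mu>" "\<mu> \<le> 1/2"
  proof -
    have "1 \<le> (real k)\<^sup>2" using k by (simp add: one_le_power)
    then show "\<mu> \<le> 1/2" unfolding \<mu>_def by (intro frac_le) auto
  qed (simp add: \<mu>_def)
  have \<mu>\<alpha>: "0 \<le> 1 - \<mu> * \<alpha>" "1 - \<mu> * \<alpha> \<le> 1" using mult_mono[of \<mu> "1/2" \<alpha> 1] \<mu> p by auto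
  define p' where "p' = lazy_pmf \<mu> p"
  define \<pi> where "\<pi> = (\<lambda>j V. measure_pmf.prob (col_pmf n p j) {x. lap_col n j x \<in> V})"
  define q where "q = (\<lambda>j V. measure_pmf.prob (col_pmf n p' j) {x. lap_col n j x \<in> V})"
  define good where "good = (\<lambda>js V. 0 < q js V \<and> 2 * \<delta> \<le> q js V \<and> (\<forall>j\<in>insert i L. \<pi> j V \<le> 2 * q js V / k))"
  define V where "V = (\<lambda>X. hyperplane n ((\<lambda>j. lap_col n j (X j)) ` L))"
  define A where "A = {X. lap_col n i (X i) \<in> V X \<and> \<pi> i (V X) \<le> 2 * e}"
  define D where "D = (\<lambda>js. {X. inj_on (\<lambda>j. lap_col n j (X j)) L \<and> ratfun.independent ((\<lambda>j. lap_col n j (X j)) ` L)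
        \<and> lap_col n i (X i) \<in> V X \<and> good js (V X)})"
  have e0: "e > 0" by (simp add: e_def)
  have PA: "measure_pmf.prob ?PX A \<le> 2 * e"
    unfolding A_def
  proof (rule Pi_pmf_conditioning[where B = "{i}"])
    fix f :: "nat \<Rightarrow> nat \<Rightarrow> int"
    let ?m = "\<lambda>g j. if j \<in> {i} then g j else f j"
    have "(\<lambda>j. lap_col n j (?m g j)) ` L = (\<lambda>j. lap_col n j (f j)) ` L" for g
      using L(3) by (intro image_cong) auto
    then have Vm: "V (?m g) = V f" for g by (simp only: V_def)
    show "measure_pmf.prob (Pi_pmf {i} (\<lambda>_. 0) (col_pmf n p)) {g. lap_col n i (?m g i) \<in> V (?m g) \<and> \<pi> i (V (?m g)) \<le> 2 * e} \<le> 2 * e"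
    proof (cases "\<pi> i (V f) \<le> 2 * e")
      case True
      have "{g. lap_col n i (?m g i) \<in> V (?m g) \<and> \<pi> i (V (?m g)) \<le> 2 * e} = {g. \<forall>j\<in>{i}. g j \<in> {x. lap_col n j x \<in> V f}}"
        unfolding Vm using True by simp
      then have "measure_pmf.prob (Pi_pmf {i} (\<lambda>_. 0) (col_pmf n p)) {g. lap_col n i (?m g i) \<in> V (?m g) \<and> \<pi> i (V (?m g)) \<le> 2 * e} = \<pi> i (V f)"
        unfolding \<pi>_def by (simp only: Pi_pmf_box finite.intros) simp
      then show ?thesis using True by simp
    next
      case False
      then show ?thesis unfolding Vm using e0 by simp
    qed
  qed (use finL e0 in auto)
  have PD: "measure_pmf.prob ?PX (D js) \<le> 4 ^ n * (4 / real k) ^ r" if "js < n" for js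
    unfolding D_def V_def good_def q_def \<pi>_def
  proof (rule prob_swap_le)
    fix G :: "(nat \<Rightarrow> rat) set" assume G: "finite G" "card G \<le> n - 2 - card L + r"
    have "measure_pmf.prob (col_pmf n p' js) {x. lap_col n js x \<in> ratfun.span G} \<le> (1 - \<mu> * \<alpha>) ^ (n - 1 - (n - 2 - card L + r))"
      using that G \<mu>\<alpha> pmf_lazy_le[OF p \<mu>] by (intro prob_lap_col_span_le) (auto simp: p'_def)
    \<comment> \<open>The exponent equals \<open>card L + 1 - r\<close>, hence exceeds
      \<open>h - r\<close>.\<close>
    also have "\<dots> \<le> \<delta>"
      unfolding \<delta>_def using L by (intro power_decreasing \<mu>\<alpha>) auto
    finally show "measure_pmf.prob (col_pmf n p' js) {x. lap_col n js x \<in> ratfun.span G} \<le> \<delta>" .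
  qed (use L that k in auto)
  have "?E \<subseteq> A \<union> (\<Union>js\<in>{..<n}. D js)"
  proof
    fix X assume "X \<in> ?E"
    let ?B = "(\<lambda>j. lap_col n j (X j)) ` L"
    have X: "inj_on (\<lambda>j. lap_col n j (X j)) L" "ratfun.independent ?B" "lap_col n i (X i) \<in> ratfun.span ?B"
      "\<And>w v. (\<forall>j\<in>L. dotp n w (lap_col n j (X j)) = 0) \<Longrightarrow> (\<exists>i<n. w i \<noteq> v) \<Longrightarrow> b < card {i\<in>{..<n}. w i \<noteq> v}"
      using \<open>X \<in> ?E\<close> by blast+
    have B: "finite ?B" "?B \<subseteq> sum0 n" "card ?B = card L"
      using finL L lap_col_in_sum0 X(1) by (auto simp: card_image subset_iff)
    obtain w where w: "\<And>h. h \<in> sum0 n \<Longrightarrow> h \<in> V X \<longleftrightarrow> dotp n w h = 0" "\<exists>h\<in>sum0 n. dotp n w h \<noteq> 0"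
      using completion(5)[OF X(2) B(1,2)] B(3) L(4) unfolding V_def by auto
    have sp: "ratfun.span ?B \<subseteq> V X" unfolding V_def hyperplane_def by (intro ratfun.span_mono) auto
    have iV: "lap_col n i (X i) \<in> V X" using X(3) sp by blast
    have orth: "\<forall>j\<in>L. dotp n w (lap_col n j (X j)) = 0"
    proof
      fix j assume j: "j \<in> L"
      then have "lap_col n j (X j) \<in> ratfun.span ?B" by (intro ratfun.span_base) auto
      then show "dotp n w (lap_col n j (X j)) = 0" using w(1) sp B(2) j by blast
    qed
    \<comment> \<open>A constant vector is orthogonal to all of \<open>sum0 n\<close>, so it cannot
      be the normal of a proper hyperplane. Hence the sparsity hypothesis applies to every
      \<open>v\<close>, in particular to each \<open>w j\<close>.\<close>
    have nonconst: "\<exists>i<n. w i \<noteq> v" for v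
    proof (rule ccontr)
      assume c: "\<not> ?thesis"
      have "dotp n w h = 0" if "h \<in> sum0 n" for h
      proof -
        have "dotp n w h = (\<Sum>i<n. v * h i)" unfolding dotp_def using c by (intro sum.cong) auto
        also have "\<dots> = v * (\<Sum>i<n. h i)" by (simp only: sum_distrib_left)
        finally show ?thesis using that by (simp add: sum0_def)
      qed
      then show False using w(2) by blast
    qed
    have set_eq: "{x. lap_col n j x \<in> V X} = {x. dotp n w (lap_col n j x) = 0}" if "j < n" for j
      using w(1) lap_col_in_sum0[OF that] by blast
    have cmp: "\<pi> j (V X) \<le> q j (V X) / k + e" if "j < n" for j
    proof -
      have "real b \<le> real (card {i\<in>{..<n}. w i \<noteq> w j})" using X(4)[OF orth nonconst[of "w j"]] by simp
      then show ?thesis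
        unfolding \<pi>_def q_def set_eq[OF that] e_def p'_def \<mu>_def
        using that k p by (intro prob_lap_col_orthogonal_le) auto
    qed
    show "X \<in> A \<union> (\<Union>js\<in>{..<n}. D js)"
    proof (cases "\<pi> i (V X) \<le> 2 * e")
      case True
      then show ?thesis using iV by (simp add: A_def)
    next
      case False
      have "\<exists>js\<in>{..<n}. \<forall>j\<in>{..<n}. q j (V X) \<le> q js (V X)"
        using L(2) by (intro finite_attains_max) auto
      then obtain js where js: "js < n" "\<And>j. j < n \<Longrightarrow> q j (V X) \<le> q js (V X)" by auto
      have dv: "q j (V X) / k \<le> q js (V X) / k" if "j < n" for j
        using js(2)[OF that] k0 by (simp add: divide_right_mono)
      have "e < q js (V X) / k" using False cmp[OF L(2)] dv[OF L(2)] by linarith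
      then have big: "k * e < q js (V X)" using k0 by (simp add: pos_less_divide_eq mult.commute)
      have "\<pi> j (V X) \<le> 2 * q js (V X) / k" if "j < n" for j
        using cmp[OF that] dv[OF that] \<open>e < q js (V X) / k\<close> by simp
      moreover have "0 < k * e" using k0 e0 by simp
      ultimately have "good js (V X)"
        unfolding good_def using big \<delta> L by (auto simp: \<delta>_def)
      then have "X \<in> D js" using X iV by (simp add: D_def)
      then show ?thesis using js(1) by blast
    qed
  qed
  then have "measure_pmf.prob ?PX ?E \<le> measure_pmf.prob ?PX (A \<union> (\<Union>js\<in>{..<n}. D js))"
    by (intro measure_pmf.finite_measure_mono) auto
  also have "\<dots> \<le> measure_pmf.prob ?PX A + measure_pmf.prob ?PX (\<Union>js\<in>{..<n}. D js)"
    by (rule measure_Un_le) auto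
  also have "measure_pmf.prob ?PX (\<Union>js\<in>{..<n}. D js) \<le> (\<Sum>js\<in>{..<n}. 4 ^ n * (4 / real k) ^ r)"
    by (rule prob_union_le[where F = D]) (use PD in auto)
  finally show ?thesis using PA by simp
qed

text \<open>Sparse normals are excluded only once, for the shortest initial segment
  \<open>J0\<close> with at least \<open>h\<close> columns, since a normal to a longer segment is
  also normal to \<open>J0\<close>. The rest is a union over the position of the first
  dependence.\<close>

lemma prob_dependent_columns_le:
  fixes \<alpha> e \<mu> :: real and k r h b :: nat
  defines "\<mu> \<equiv> 1 / (36 * (real k)\<^sup>2)"
  defines "e \<equiv> exp (- (real b * \<alpha>) / (18 * (real k)\<^sup>2))"
  assumes J: "J \<subseteq> {..<n}" "card J = n - 1" and h: "r \<le> h" "b \<le> h" and k: "k \<ge> 2"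
    and p: "\<And>x. pmf p x \<le> 1 - \<alpha>" "0 \<le> \<alpha>" "\<alpha> \<le> 1"
    and \<delta>: "2 * (1 - \<mu> * \<alpha>) ^ (h - r) \<le> real k * e"
  shows "measure_pmf.prob (Pi_pmf J (\<lambda>_. 0) (col_pmf n p))
    {X. \<not> (inj_on (\<lambda>j. lap_col n j (X j)) J \<and> ratfun.independent ((\<lambda>j. lap_col n j (X j)) ` J))}
    \<le> (\<Sum>s=1..b. real (n choose s) * real (n choose (s - 1)) * max (3/4) (1 - \<alpha> * s / 2) ^ (h - 2 * s))
      + n * ((1 - \<alpha>) ^ (n - h) + 2 * e + n * (4 ^ n * (4 / real k) ^ r))"
proof -
  let ?P = "Pi_pmf J (\<lambda>_. 0) (col_pmf n p)"
  let ?c = "\<lambda>X j. lap_col n j (X j)"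
  have finJ: "finite J" using J finite_subset by blast
  define L where "L = (\<lambda>i. {j\<in>J. j < i})"
  have finL: "finite (L i)" for i using finJ by (simp add: L_def)
  have cL: "card (L i) < n - 1" if "i \<in> J" for i
    unfolding J(2)[symmetric] L_def using that finJ by (intro psubset_card_mono) auto
  have insJ: "insert i (L i) \<subseteq> J" if "i \<in> J" for i using that by (auto simp: L_def)
  \<comment> \<open>The value \<open>{}\<close> is only a default: \<open>J0\<close> is called upon
    just for positions with at least \<open>h\<close> predecessors.\<close>
  define J0 where "J0 = (if \<exists>i\<in>J. h \<le> card (L i) then L (LEAST i. i \<in> J \<and> h \<le> card (L i)) else {})"
  have J0: "J0 \<subseteq> L i" "h \<le> card J0" if "i \<in> J" "h \<le> card (L i)" for i
  proof -
    let ?i0 = "LEAST i. i \<in> J \<and> h \<le> card (L i)"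
    have "?i0 \<in> J \<and> h \<le> card (L ?i0)" by (rule LeastI[of _ i]) (use that in simp)
    moreover have "?i0 \<le> i" by (rule Least_le) (use that in simp)
    ultimately show "J0 \<subseteq> L i" "h \<le> card J0" using that by (auto simp: J0_def L_def)
  qed
  have J0J: "J0 \<subseteq> J" by (auto simp: J0_def L_def)
  define Sp where "Sp = (if h \<le> card J0 then {X. \<exists>w v. (\<forall>j\<in>J0. dotp n w (?c X j) = 0)
      \<and> (\<exists>i<n. w i \<noteq> v) \<and> card {i\<in>{..<n}. w i \<noteq> v} \<le> b} else {})"
  define Sm where "Sm = (\<lambda>i. {X. ?c X i \<in> ratfun.span (?c X ` L i)})"
  define Lg where "Lg = (\<lambda>i. {X. inj_on (?c X) (L i) \<and> ratfun.independent (?c X ` L i)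
      \<and> ?c X i \<in> ratfun.span (?c X ` L i)
      \<and> (\<forall>w v. (\<forall>j\<in>L i. dotp n w (?c X j) = 0) \<longrightarrow> (\<exists>i<n. w i \<noteq> v) \<longrightarrow> b < card {i\<in>{..<n}. w i \<noteq> v})})"
  define G where "G = (\<lambda>i. if h \<le> card (L i) then Lg i else Sm i)"
  let ?S = "\<Sum>s=1..b. real (n choose s) * real (n choose (s - 1)) * max (3/4) (1 - \<alpha> * s / 2) ^ (h - 2 * s)"
  have \<rho>: "0 \<le> max (3/4) (1 - \<alpha> * real s / 2)" "max (3/4) (1 - \<alpha> * real s / 2) \<le> 1" for s
    using p by (auto simp: max_def)
  have S0: "0 \<le> ?S" using \<rho> by (intro sum_nonneg mult_nonneg_nonneg zero_le_power) auto
  have PSp: "measure_pmf.prob ?P Sp \<le> ?S"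
  proof (cases "h \<le> card J0")
    case True
    have "measure_pmf.prob ?P Sp = measure_pmf.prob (Pi_pmf J0 (\<lambda>_. 0) (col_pmf n p)) {X. \<exists>w v. (\<forall>j\<in>J0. dotp n w (?c X j) = 0)
      \<and> (\<exists>i<n. w i \<noteq> v) \<and> card {i\<in>{..<n}. w i \<noteq> v} \<le> b}"
      unfolding Sp_def if_P[OF True] by (rule Pi_pmf_marginal[OF finJ J0J]) simp
    also have "\<dots> \<le> (\<Sum>s=1..b. real (n choose s) * real (n choose (s - 1)) * max (3/4) (1 - \<alpha> * s / 2) ^ (card J0 - 2 * s))"
      using J0J J(1) True h p by (intro prob_sparse_le) auto
    also have "\<dots> \<le> ?S"
      using True by (intro sum_mono mult_left_mono power_decreasing \<rho>) auto
    finally show ?thesis .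
  next
    case False
    then show ?thesis using S0 by (simp add: Sp_def)
  qed
  have PG: "measure_pmf.prob ?P (G i) \<le> (1 - \<alpha>) ^ (n - h) + 2 * e + n * (4 ^ n * (4 / real k) ^ r)" if i: "i \<in> J" for i
  proof -
    have iL: "i \<notin> L i" "i < n" "L i \<subseteq> {..<n}" using i J by (auto simp: L_def)
    have \<alpha>0: "0 \<le> (1 - \<alpha>) ^ (n - h)" and e0: "0 \<le> e" and t0: "0 \<le> n * (4 ^ n * (4 / real k) ^ r)" using p by (auto simp: e_def)
    show ?thesis
    proof (cases "h \<le> card (L i)")
      case True
      have "measure_pmf.prob ?P (Lg i) = measure_pmf.prob (Pi_pmf (insert i (L i)) (\<lambda>_. 0) (col_pmf n p)) (Lg i)"
        unfolding Lg_def
      proof (rule Pi_pmf_marginal[OF finJ insJ[OF i]])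
        fix f g :: "nat \<Rightarrow> nat \<Rightarrow> int"
        assume fg: "\<And>j. j \<in> insert i (L i) \<Longrightarrow> f j = g j"
        have 1: "?c f ` L i = ?c g ` L i" using fg by (intro image_cong) auto
        have 2: "inj_on (?c f) (L i) = inj_on (?c g) (L i)" using fg by (intro inj_on_cong) auto
        have 3: "(\<forall>j\<in>L i. dotp n w (?c f j) = 0) = (\<forall>j\<in>L i. dotp n w (?c g j) = 0)" for w using fg by auto
        show "(inj_on (?c f) (L i) \<and> ratfun.independent (?c f ` L i)
          \<and> ?c f i \<in> ratfun.span (?c f ` L i)
          \<and> (\<forall>w v. (\<forall>j\<in>L i. dotp n w (?c f j) = 0) \<longrightarrow> (\<exists>i<n. w i \<noteq> v) \<longrightarrow> b < card {i\<in>{..<n}. w i \<noteq> v}))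
          = (inj_on (?c g) (L i) \<and> ratfun.independent (?c g ` L i)
          \<and> ?c g i \<in> ratfun.span (?c g ` L i)
          \<and> (\<forall>w v. (\<forall>j\<in>L i. dotp n w (?c g j) = 0) \<longrightarrow> (\<exists>i<n. w i \<noteq> v) \<longrightarrow> b < card {i\<in>{..<n}. w i \<noteq> v}))"
          unfolding 1 2 3 fg[OF insertI1] ..
      qed
      also have "\<dots> \<le> 2 * e + n * (4 ^ n * (4 / real k) ^ r)"
        unfolding Lg_def e_def
        using iL cL[OF i] True h k p \<delta> by (intro prob_first_dependence_le[where h = h]) (auto simp: \<mu>_def e_def)
      finally show ?thesis using True \<alpha>0 by (simp add: G_def)
    next
      case False
      have "measure_pmf.prob ?P (Sm i) = measure_pmf.prob (Pi_pmf (insert i (L i)) (\<lambda>_. 0) (col_pmf n p)) (Sm i)"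
        unfolding Sm_def
      proof (rule Pi_pmf_marginal[OF finJ insJ[OF i]])
        fix f g :: "nat \<Rightarrow> nat \<Rightarrow> int"
        assume fg: "\<And>j. j \<in> insert i (L i) \<Longrightarrow> f j = g j"
        have 1: "?c f ` L i = ?c g ` L i" using fg by (intro image_cong) auto
        show "(?c f i \<in> ratfun.span (?c f ` L i)) = (?c g i \<in> ratfun.span (?c g ` L i))"
          unfolding 1 fg[OF insertI1] ..
      qed
      also have "\<dots> \<le> (1 - \<alpha>) ^ (n - 1 - card (L i))"
        unfolding Sm_def using iL finL p by (intro prob_new_column_in_span_le) auto
      \<comment> \<open>There are at most \<open>h - 1\<close> predecessors here, so the exponent is
        at least \<open>n - h\<close>.\<close>
      also have "\<dots> \<le> (1 - \<alpha>) ^ (n - h)" using False p by (intro power_decreasing) auto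
      finally have *: "measure_pmf.prob ?P (Sm i) \<le> (1 - \<alpha>) ^ (n - h)" .
      have G: "G i = Sm i" using False by (simp add: G_def)
      show ?thesis unfolding G using * e0 t0 by linarith
    qed
  qed
  have "{X. \<not> (inj_on (?c X) J \<and> ratfun.independent (?c X ` J))} \<subseteq> Sp \<union> (\<Union>i\<in>J. G i)"
  proof
    fix X assume "X \<in> {X. \<not> (inj_on (?c X) J \<and> ratfun.independent (?c X ` J))}"
    then have ex: "\<exists>i. i \<in> J \<and> ?c X i \<in> ratfun.span (?c X ` L i)"
      using independent_family_ordered[OF finJ, of "?c X"] unfolding L_def by blast
    define i where "i = (LEAST i. i \<in> J \<and> ?c X i \<in> ratfun.span (?c X ` L i))"
    have i: "i \<in> J" "?c X i \<in> ratfun.span (?c X ` L i)"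
      using LeastI_ex[OF ex] unfolding i_def by blast+
    have min: "\<not> (j \<in> J \<and> ?c X j \<in> ratfun.span (?c X ` L j))" if "j < i" for j
      using not_less_Least that unfolding i_def by blast
    have "inj_on (?c X) (L i) \<and> ratfun.independent (?c X ` L i)"
    proof (rule independent_family_ordered[OF finL])
      fix j assume j: "j \<in> L i"
      then have "{l \<in> L i. l < j} = L j" by (auto simp: L_def)
      then show "?c X j \<notin> ratfun.span (?c X ` {l \<in> L i. l < j})" using min[of j] j by (simp add: L_def)
    qed
    then have ind: "inj_on (?c X) (L i)" "ratfun.independent (?c X ` L i)" by auto
    show "X \<in> Sp \<union> (\<Union>i\<in>J. G i)"
    proof (cases "h \<le> card (L i) \<and> X \<notin> Lg i")
      case False
      then have "X \<in> G i" using i by (auto simp: G_def Sm_def)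
      then show ?thesis using i by blast
    next
      case True
      then obtain w v where "\<forall>j\<in>L i. dotp n w (?c X j) = 0" "\<exists>i<n. w i \<noteq> v" "\<not> b < card {i\<in>{..<n}. w i \<noteq> v}"
        using i ind unfolding Lg_def by blast
      then have "X \<in> Sp" using J0[OF i(1)] True unfolding Sp_def by (auto simp: not_less)
      then show ?thesis by blast
    qed
  qed
  then have "measure_pmf.prob ?P {X. \<not> (inj_on (?c X) J \<and> ratfun.independent (?c X ` J))} \<le> measure_pmf.prob ?P (Sp \<union> (\<Union>i\<in>J. G i))"
    by (intro measure_pmf.finite_measure_mono) auto
  also have "\<dots> \<le> measure_pmf.prob ?P Sp + measure_pmf.prob ?P (\<Union>i\<in>J. G i)"
    by (rule measure_Un_le) auto
  also have "measure_pmf.prob ?P (\<Union>i\<in>J. G i) \<le> (\<Sum>i\<in>J. (1 - \<alpha>) ^ (n - h) + 2 * e + n * (4 ^ n * (4 / real k) ^ r))"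
    by (rule prob_union_le[where F = G]) (use finJ PG in auto)
  also have "\<dots> \<le> n * ((1 - \<alpha>) ^ (n - h) + 2 * e + n * (4 ^ n * (4 / real k) ^ r))"
    unfolding sum_constant using J(2) p by (intro mult_right_mono) (auto simp: e_def intro!: add_nonneg_nonneg)
  finally show ?thesis using PSp by simp
qed

section \<open>Elementary estimates and the choice of constants\<close>

lemma one_minus_power_le_exp:
  fixes x :: real
  assumes "x \<le> 1"
  shows "(1 - x) ^ N \<le> exp (- (x * N))"
proof -
  have "(1 - x) ^ N \<le> exp (- x) ^ N" using assms exp_ge_add_one_self[of "- x"] by (intro power_mono) auto
  also have "\<dots> = exp (- (x * N))" by (simp add: mult.commute flip: exp_of_nat_mult)
  finally show ?thesis .
qed

text \<open>One term of the expansion of (1 + 1/1024)^n bounds the binomial coefficient by exp (n /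
  1024) times 1024^s, and 1024^s \<le> exp (10 s) is absorbed because s is at most n / 2^20.\<close>

lemma binomial_le_exp:
  assumes "2 ^ 20 * s \<le> n"
  shows "real (n choose s) \<le> exp (n / 512)"
proof -
  have "real (n choose s) * (1 / 1024) ^ s \<le> (1 + 1 / 1024) ^ n"
  proof -
    have "s \<le> n" using assms by simp
    then have "real (n choose s) * (1 / 1024) ^ s * 1 ^ (n - s) \<le> (\<Sum>i\<le>n. real (n choose i) * (1 / 1024) ^ i * 1 ^ (n - i))"
      by (intro member_le_sum) auto
    also have "\<dots> = (1 / 1024 + 1) ^ n" by (rule binomial_ring[symmetric])
    finally show ?thesis by (simp only: power_one mult_1_right add.commute)
  qed
  also have "\<dots> \<le> exp (n / 1024)"
    using one_minus_power_le_exp[of "- 1 / 1024" n] by simp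
  finally have "real (n choose s) \<le> exp (n / 1024) * 1024 ^ s"
    by (simp add: power_divide field_simps)
  also have "(1024::real) ^ s \<le> exp (n / 1024)"
  proof -
    have "(2::real) ^ 10 \<le> exp 1 ^ 10" using exp_ge_add_one_self[of 1] by (intro power_mono) auto
    then have "(1024::real) ^ s \<le> exp 10 ^ s" by (intro power_mono) (auto simp flip: exp_of_nat_mult)
    also have "\<dots> = exp (10 * s)" by (simp add: mult.commute flip: exp_of_nat_mult)
    also have "\<dots> \<le> exp (n / 1024)"
    proof -
      have "real (2 ^ 20 * s) \<le> real n" using assms by (rule of_nat_mono)
      then have "2 ^ 20 * real s \<le> real n" by simp
      then show ?thesis by simp
    qed
    finally show ?thesis .
  qed
  then have "exp (n / 1024) * 1024 ^ s \<le> exp (n / 1024) * exp (n / 1024)" by (intro mult_left_mono) auto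
  also have "\<dots> = exp (n / 512)" by (simp flip: exp_add)
  finally show ?thesis .
qed

text \<open>For \<alpha> s \<le> 1/2 the binomials are at most n^(2 s - 1), and the logarithmic
  hypothesis makes n^(2 s) cost only half the decay exp (- \<alpha> s n / 16) of the power; the
  spare 1 / n pays for the later sum over s. For larger \<alpha> s the base is 3/4, and exp (- n /
  32) outweighs the entropy exp (n / 256).\<close>

lemma sparse_term_le:
  fixes \<alpha> :: real
  assumes n: "2 ^ 22 \<le> n" and s: "1 \<le> s" "2 ^ 20 * s \<le> n" and \<alpha>: "0 \<le> \<alpha>" "\<alpha> \<le> 1" "64 * ln n \<le> \<alpha> * n"
  shows "real (n choose s) * real (n choose (s - 1)) * max (3/4) (1 - \<alpha> * s / 2) ^ (n div 2 - 2 * s)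
    \<le> exp (- (\<alpha> * n) / 128) / n"
proof -
  define N where "N = n div 2 - 2 * s"
  have n0: "real n > 0" using n by simp
  have N: "real n / 8 \<le> N"
  proof -
    have "n \<le> 8 * N" using n s by (simp add: N_def)
    then show ?thesis by linarith
  qed
  show ?thesis
  proof (cases "\<alpha> * s / 2 \<le> 1/4")
    case True
    have "real (n choose s) \<le> n ^ s"
      using binomial_le_pow[of s n] s by (metis le_trans mult_le_mono1 nat_mult_1 of_nat_le_iff of_nat_power one_le_numeral one_le_power)
    moreover have "real (n choose (s - 1)) \<le> n ^ (s - 1)"
    proof -
      have "s - 1 \<le> n" using s by simp
      then have "n choose (s - 1) \<le> n ^ (s - 1)" by (rule binomial_le_pow)
      then show ?thesis by (metis of_nat_le_iff of_nat_power)
    qed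
    ultimately have "real (n choose s) * real (n choose (s - 1)) \<le> real n ^ s * real n ^ (s - 1)"
      by (intro mult_mono) auto
    also have "\<dots> = real n ^ (2 * s) / n"
    proof -
      have "2 * s = s + (s - 1) + 1" using s by simp
      then have "real n ^ (2 * s) = real n ^ s * real n ^ (s - 1) * real n" by (simp only: power_add power_one_right)
      then show ?thesis using n0 by simp
    qed
    also have "real n ^ (2 * s) = exp (2 * s * ln n)"
      using n0 exp_of_nat_mult[of "2 * s" "ln (real n)"] by (simp add: mult_ac)
    also have "\<dots> \<le> exp (\<alpha> * s * n / 32)"
    proof -
      have "real s * (64 * ln n) \<le> s * (\<alpha> * n)" using \<alpha> by (intro mult_left_mono) auto
      then show ?thesis by (simp add: mult_ac)
    qed
    finally have 1: "real (n choose s) * real (n choose (s - 1)) \<le> exp (\<alpha> * s * n / 32) / n"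
      using n0 by (simp add: divide_right_mono)
    have "max (3/4) (1 - \<alpha> * s / 2) ^ N = (1 - \<alpha> * s / 2) ^ N" using True by (simp add: max_def)
    also have "\<dots> \<le> exp (- (\<alpha> * s / 2 * N))" using True by (intro one_minus_power_le_exp) simp
    also have "\<dots> \<le> exp (- (\<alpha> * s * n / 16))"
    proof -
      have "\<alpha> * s / 2 * (real n / 8) \<le> \<alpha> * s / 2 * N" using N \<alpha> by (intro mult_left_mono) auto
      then show ?thesis by simp
    qed
    finally have "real (n choose s) * real (n choose (s - 1)) * max (3/4) (1 - \<alpha> * s / 2) ^ N
      \<le> exp (\<alpha> * s * n / 32) / n * exp (- (\<alpha> * s * n / 16))"
      using 1 by (intro mult_mono) auto
    also have "\<dots> = exp (- (\<alpha> * s * n / 32)) / n" by (simp flip: exp_add)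
    also have "\<dots> \<le> exp (- (\<alpha> * n) / 128) / n"
    proof -
      have "\<alpha> * n * 1 \<le> \<alpha> * n * s" using s \<alpha> by (intro mult_left_mono) auto
      moreover have "0 \<le> \<alpha> * n" using \<alpha> by simp
      ultimately have "\<alpha> * n / 128 \<le> \<alpha> * s * n / 32" by (simp add: mult_ac)
      then show ?thesis using n0 by (simp add: divide_right_mono)
    qed
    finally show ?thesis by (simp add: N_def)
  next
    case False
    have "real (n choose (s - 1)) \<le> exp (n / 512)" using s by (intro binomial_le_exp) simp
    then have "real (n choose s) * real (n choose (s - 1)) \<le> exp (n / 512) * exp (n / 512)"
      using binomial_le_exp[OF s(2)] by (intro mult_mono) auto
    also have "\<dots> = exp (n / 256)" by (simp flip: exp_add)
    finally have 1: "real (n choose s) * real (n choose (s - 1)) \<le> exp (n / 256)" .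
    have "max (3/4) (1 - \<alpha> * s / 2) ^ N = (1 - 1/4) ^ N" using False by (simp add: max_def)
    also have "\<dots> \<le> exp (- (1/4 * N))" by (intro one_minus_power_le_exp) simp
    also have "\<dots> \<le> exp (- (n / 32))" using N by simp
    finally have "real (n choose s) * real (n choose (s - 1)) * max (3/4) (1 - \<alpha> * s / 2) ^ N
      \<le> exp (n / 256) * exp (- (n / 32))"
      using 1 by (intro mult_mono) auto
    also have "\<dots> = exp (- (7 * n / 256))" by (simp flip: exp_add)
    also have "\<dots> \<le> exp (- (\<alpha> * n) / 128 - ln n)"
    proof -
      have "\<alpha> * n \<le> 1 * real n" using \<alpha> by (intro mult_right_mono) auto
      then show ?thesis using \<alpha>(3) by simp
    qed
    also have "\<dots> = exp (- (\<alpha> * n) / 128) / n" using n0 by (simp add: exp_diff)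
    finally show ?thesis by (simp add: N_def)
  qed
qed

text \<open>Choice of constants: 4 / k is 4^(-32) and \<open>r\<close> is about n / 4, so
  \<open>(4 / real k) ^ r\<close> is at most 4^(-4 n), against \<open>4 ^ n\<close> from the union
  bound and two factors n. The threshold \<open>b\<close>, about n / 2^20, is small enough for the
  entropy estimate on supports. The rate \<kappa> is that of \<open>e\<close> with \<open>b\<close>
  bounded below by n / 2^21; half of it is spent on a factor n.\<close>

lemma prob_dependent_columns_exp_le:
  fixes \<alpha> \<kappa> :: real and k :: nat
  defines "k \<equiv> 4 ^ 33"
  defines "\<kappa> \<equiv> 1 / (2 ^ 21 * (18 * (real k)\<^sup>2))"
  assumes n: "2 ^ 22 \<le> n" and J: "J \<subseteq> {..<n}" "card J = n - 1"
    and p: "\<And>x. pmf p x \<le> 1 - \<alpha>" "0 \<le> \<alpha>" "\<alpha> \<le> 1" and ln: "2 / \<kappa> * ln n \<le> \<alpha> * n"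
  shows "measure_pmf.prob (Pi_pmf J (\<lambda>_. 0) (col_pmf n p))
    {X. \<not> (inj_on (\<lambda>j. lap_col n j (X j)) J \<and> ratfun.independent ((\<lambda>j. lap_col n j (X j)) ` J))}
    \<le> 5 * exp (- (\<kappa> / 2 * \<alpha> * n))"
proof -
  define h where "h = n div 2"
  define r where "r = n div 4"
  define b where "b = n div 2 ^ 20"
  define \<mu> where "\<mu> = 1 / (36 * (real k)\<^sup>2)"
  define e where "e = exp (- (real b * \<alpha>) / (18 * (real k)\<^sup>2))"
  define x where "x = \<alpha> * n"
  define M where "M = 18 * (real k)\<^sup>2"
  have n0: "real n > 0" using n by simp
  have k2: "2 \<le> k" by (simp add: k_def)
  have M1: "1 \<le> M" using k2 by (simp add: M_def one_le_power mult_ge1_I)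
  have \<mu>M: "\<mu> = 1 / (2 * M)" and \<kappa>M: "\<kappa> = 1 / (2 ^ 21 * M)" and eM: "e = exp (- (real b * \<alpha>) / M)"
    by (auto simp: \<mu>_def M_def \<kappa>_def e_def)
  have \<kappa>: "0 < \<kappa>" "\<kappa> \<le> 1 / 2 ^ 21"
  proof -
    show "0 < \<kappa>" using M1 by (simp add: \<kappa>M)
    show "\<kappa> \<le> 1 / 2 ^ 21" unfolding \<kappa>M using M1 by (intro frac_le) auto
  qed
  have x0: "0 \<le> x" using p by (simp add: x_def)
  have xn: "x \<le> n" using mult_right_mono[OF p(3), of "real n"] by (simp add: x_def)
  have lnx: "ln n \<le> \<kappa> * x / 2" using ln \<kappa> by (simp add: x_def field_simps)
  have lnn: "0 \<le> ln (real n)" using n by simp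
  have n_exp: "real n \<le> exp (\<kappa> * x / 2)" using lnx n0 by (metis exp_le_cancel_iff exp_ln)
  have hr: "8 * b \<le> h - r" "r \<le> h" "b \<le> h" using n by (auto simp: h_def r_def b_def)
  have "2 * (1 - \<mu> * \<alpha>) ^ (h - r) \<le> real k * e"
  proof -
    have \<mu>\<alpha>: "0 \<le> \<mu> * \<alpha>" "\<mu> * \<alpha> \<le> 1"
    proof -
      have "\<mu> \<le> 1" unfolding \<mu>M using M1 by simp
      then show "\<mu> * \<alpha> \<le> 1" using p M1 by (intro mult_le_one) (auto simp: \<mu>M)
    qed (use p M1 in \<open>auto simp: \<mu>M\<close>)
    then have "(1 - \<mu> * \<alpha>) ^ (h - r) \<le> exp (- (\<mu> * \<alpha> * real (h - r)))" by (intro one_minus_power_le_exp)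
    also have "\<dots> \<le> e"
    proof -
      have "\<mu> * \<alpha> * real (2 * b) \<le> \<mu> * \<alpha> * real (h - r)"
        using hr \<mu>\<alpha> by (intro mult_left_mono of_nat_mono) auto
      moreover have "\<mu> * \<alpha> * real (2 * b) = real b * \<alpha> / M" by (simp add: \<mu>M)
      ultimately show ?thesis by (simp add: eM)
    qed
    finally have "2 * (1 - \<mu> * \<alpha>) ^ (h - r) \<le> 2 * e" by simp
    also have "\<dots> \<le> real k * e" using k2 by (intro mult_right_mono) (auto simp: e_def)
    finally show ?thesis .
  qed
  then have main: "measure_pmf.prob (Pi_pmf J (\<lambda>_. 0) (col_pmf n p))
    {X. \<not> (inj_on (\<lambda>j. lap_col n j (X j)) J \<and> ratfun.independent ((\<lambda>j. lap_col n j (X j)) ` J))}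
    \<le> (\<Sum>s=1..b. real (n choose s) * real (n choose (s - 1)) * max (3/4) (1 - \<alpha> * s / 2) ^ (h - 2 * s))
      + n * ((1 - \<alpha>) ^ (n - h) + 2 * e + n * (4 ^ n * (4 / real k) ^ r))"
    unfolding \<mu>_def e_def using J hr k2 p by (intro prob_dependent_columns_le) auto
  have T1: "(\<Sum>s=1..b. real (n choose s) * real (n choose (s - 1)) * max (3/4) (1 - \<alpha> * s / 2) ^ (h - 2 * s))
    \<le> exp (- (\<kappa> * x / 2))"
  proof -
    have "64 * ln n \<le> \<alpha> * n"
    proof -
      have "\<kappa> * x \<le> x / 2097152" using mult_right_mono[OF \<kappa>(2) x0] by simp
      then show ?thesis using lnx x0 unfolding x_def[symmetric] by linarith
    qed
    then have "(\<Sum>s=1..b. real (n choose s) * real (n choose (s - 1)) * max (3/4) (1 - \<alpha> * s / 2) ^ (h - 2 * s))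
      \<le> (\<Sum>s=1..b. exp (- (\<alpha> * n) / 128) / n)"
      unfolding h_def using n p by (intro sum_mono sparse_term_le) (auto simp: b_def)
    also have "\<dots> = b / n * exp (- x / 128)" by (simp add: x_def)
    also have "\<dots> \<le> 1 * exp (- x / 128)"
      using n0 by (intro mult_right_mono) (auto simp: b_def divide_le_eq)
    also have "\<dots> \<le> exp (- (\<kappa> * x / 2))"
      using mult_right_mono[OF \<kappa>(2) x0] x0 by simp
    finally show ?thesis .
  qed
  have T2: "n * (1 - \<alpha>) ^ (n - h) \<le> exp (- (\<kappa> * x / 2))"
  proof -
    have "(1 - \<alpha>) ^ (n - h) \<le> exp (- (\<alpha> * real (n - h)))" using p by (intro one_minus_power_le_exp)
    also have "\<dots> \<le> exp (- (x / 2))"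
    proof -
      have "real n / 2 \<le> real (n - h)" by (simp add: h_def)
      then have "\<alpha> * (real n / 2) \<le> \<alpha> * real (n - h)" using p by (intro mult_left_mono) auto
      then show ?thesis by (simp add: x_def)
    qed
    finally have "n * (1 - \<alpha>) ^ (n - h) \<le> exp (\<kappa> * x / 2) * exp (- (x / 2))"
      using n_exp p by (intro mult_mono) auto
    also have "\<dots> = exp (\<kappa> * x / 2 - x / 2)" by (simp flip: exp_add)
    also have "\<dots> \<le> exp (- (\<kappa> * x / 2))"
    proof -
      have "\<kappa> * x \<le> 1 / 2 ^ 21 * x" by (rule mult_right_mono[OF \<kappa>(2) x0])
      then have "\<kappa> * x / 2 - x / 2 \<le> - (\<kappa> * x / 2)" using x0 by simp
      then show ?thesis by simp
    qed
    finally show ?thesis .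
  qed
  have T3: "n * (2 * e) \<le> 2 * exp (- (\<kappa> * x / 2))"
  proof -
    have "e \<le> exp (- (\<kappa> * x))"
    proof -
      have "n \<le> 2 ^ 21 * b" using n by (simp add: b_def)
      then have "real n \<le> real (2 ^ 21 * b)" by (rule of_nat_mono)
      then have "real n / 2 ^ 21 * (\<alpha> / M) \<le> real b * (\<alpha> / M)"
        using p M1 by (intro mult_right_mono) auto
      moreover have "real n / 2 ^ 21 * (\<alpha> / M) = \<kappa> * x" by (simp add: \<kappa>M x_def)
      ultimately show ?thesis by (simp add: eM)
    qed
    then have "n * (2 * e) \<le> exp (\<kappa> * x / 2) * (2 * exp (- (\<kappa> * x)))"
      using n_exp by (intro mult_mono) (auto simp: e_def)
    also have "\<dots> = 2 * exp (- (\<kappa> * x / 2))" by (simp flip: exp_add)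
    finally show ?thesis .
  qed
  have T4: "n * (n * (4 ^ n * (4 / real k) ^ r)) \<le> exp (- (\<kappa> * x / 2))"
  proof -
    have "(4 / real k) ^ r = 1 / 4 ^ (32 * r)"
      by (simp add: k_def power_mult power_divide)
    also have "\<dots> \<le> 1 / 4 ^ (4 * n)"
      using n by (intro divide_left_mono power_increasing) (auto simp: r_def)
    finally have 4: "(4 / real k) ^ r \<le> 1 / 4 ^ (4 * n)" .
    have n4: "real n \<le> 4 ^ n"
    proof -
      have "n < 2 ^ n" by (rule less_exp)
      also have "(2::nat) ^ n \<le> 4 ^ n" by (rule power_mono) auto
      finally show ?thesis by (metis less_imp_le of_nat_le_iff of_nat_numeral of_nat_power)
    qed
    have "n * (n * (4 ^ n * (4 / real k) ^ r)) \<le> 4 ^ n * (4 ^ n * (4 ^ n * (1 / 4 ^ (4 * n))))"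
      using n4 4 by (intro mult_mono) auto
    also have "\<dots> = 1 / 4 ^ n"
    proof -
      have "(4::real) ^ (4 * n) = 4 ^ n * (4 ^ n * (4 ^ n * 4 ^ n))"
        by (simp flip: power_add)
      then show ?thesis by simp
    qed
    also have "\<dots> \<le> 1 / exp 1 ^ n"
      using exp_le by (intro divide_left_mono power_mono) auto
    also have "\<dots> = exp (- real n)" by (simp add: exp_minus inverse_eq_divide flip: exp_of_nat_mult)
    also have "\<dots> \<le> exp (- (\<kappa> * x / 2))"
    proof -
      have "\<kappa> * x \<le> 1 / 2 ^ 21 * x" by (rule mult_right_mono[OF \<kappa>(2) x0])
      then have "\<kappa> * x / 2 \<le> real n" using x0 xn by simp
      then show ?thesis by simp
    qed
    finally show ?thesis .
  qed
  have eq: "\<kappa> / 2 * \<alpha> * n = \<kappa> * x / 2" by (simp add: x_def)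
  \<comment> \<open>\<open>T3\<close> accounts for two of the five exponentials, the other three
    estimates for one each.\<close>
  show ?thesis unfolding eq using main[unfolded distrib_left] T1 T2 T3 T4 by linarith
qed

theorem corollary8p16:
  shows "\<exists>c\<^sub>0 K\<^sub>0 C\<^sub>0 :: real. c\<^sub>0 > 0 \<and> K\<^sub>0 > 0 \<and> C\<^sub>0 > 0 \<and>
    (\<forall>(n :: nat) (\<xi> :: int pmf) (\<alpha> :: real).
       n \<ge> 2 \<longrightarrow> max_prob \<xi> = 1 - \<alpha> \<longrightarrow> 1 - \<alpha> \<le> 1 - C\<^sub>0 * ln (real n) / real n \<longrightarrow>
       (\<forall>J. J \<subseteq> {..<n} \<and> card J = n - 1 \<longrightarrow>
          measure_pmf.prob (random_matrix n \<xi>)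
            {M. vec_space.rank n (map_mat real_of_int (submatrix (laplacian M) UNIV J)) = n - 1}
          \<ge> 1 - K\<^sub>0 * exp (- c\<^sub>0 * \<alpha> * real n)))"
proof -
  define \<kappa> :: real where "\<kappa> = 1 / (2 ^ 21 * (18 * (real (4 ^ 33))\<^sup>2))"
  have \<kappa>: "0 < \<kappa>" "2 ^ 22 \<le> 1 / \<kappa>" by (simp_all add: \<kappa>_def)
  have "1 - 5 * exp (- (\<kappa> / 2) * \<alpha> * real n) \<le> measure_pmf.prob (random_matrix n \<xi>)
      {M. vec_space.rank n (map_mat real_of_int (submatrix (laplacian M) UNIV J)) = n - 1}"
    if n: "2 \<le> n" and \<xi>: "max_prob \<xi> = 1 - \<alpha>" and \<alpha>n: "1 - \<alpha> \<le> 1 - 2 / \<kappa> * ln (real n) / real n"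
      and J: "J \<subseteq> {..<n}" "card J = n - 1" for n :: nat and \<xi> and \<alpha> :: real and J
  proof -
    have p: "pmf \<xi> x \<le> 1 - \<alpha>" for x using pmf_le_max_prob[of \<xi> x] \<xi> by simp
    have \<alpha>1: "\<alpha> \<le> 1" using p[of 0] pmf_nonneg[of \<xi> 0] by linarith
    have n0: "real n > 0" using n by simp
    have ln: "2 / \<kappa> * ln n \<le> \<alpha> * n" 
    proof -
      have "2 / \<kappa> * ln n / n \<le> \<alpha>" using \<alpha>n by simp
      then show ?thesis by (simp only: pos_divide_le_eq[OF n0])
    qed
    \<comment> \<open>As ln n is at least 1/2, the hypothesis gives \<alpha> n \<ge> 1 / \<kappa>
      \<ge> 2^22, and \<alpha> \<le> 1 then forces n \<ge> 2^22: no law satisfies the hypothesis for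
      smaller n.\<close>
    have ln2: "1 / 2 \<le> ln (real n)"
    proof -
      have "ln 2 \<le> ln (real n)" using n by simp
      then show ?thesis using ln2_ge_two_thirds by linarith
    qed
    have "2 / \<kappa> * (1 / 2) \<le> 2 / \<kappa> * ln n" using \<kappa>(1) ln2 by (intro mult_left_mono) auto
    then have big: "1 / \<kappa> \<le> \<alpha> * n" using ln by simp
    then have "0 < \<alpha> * n" using \<kappa>(1) by (smt (verit) divide_pos_pos)
    then have \<alpha>0: "0 \<le> \<alpha>" using n0 by (simp add: zero_less_mult_iff)
    have "2 ^ 22 \<le> \<alpha> * n" using big \<kappa>(2) by linarith
    also have "\<dots> \<le> n" using mult_right_mono[OF \<alpha>1, of "real n"] by simp
    finally have n22: "2 ^ 22 \<le> n" by (metis of_nat_le_iff of_nat_numeral of_nat_power)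
    define E where "E = {X. inj_on (\<lambda>j. lap_col n j (X j)) J \<and> ratfun.independent ((\<lambda>j. lap_col n j (X j)) ` J)}"
    let ?P = "Pi_pmf {..<n} (\<lambda>_. 0) (col_pmf n \<xi>)"
    have "measure_pmf.prob ?P (- E) = measure_pmf.prob (Pi_pmf J (\<lambda>_. 0) (col_pmf n \<xi>)) (- E)"
      unfolding E_def Collect_neg_eq[symmetric]
    proof (rule Pi_pmf_marginal)
      fix f g :: "nat \<Rightarrow> nat \<Rightarrow> int" assume fg: "\<And>j. j \<in> J \<Longrightarrow> f j = g j"
      have 1: "(\<lambda>j. lap_col n j (f j)) ` J = (\<lambda>j. lap_col n j (g j)) ` J" using fg by (intro image_cong) auto
      have 2: "inj_on (\<lambda>j. lap_col n j (f j)) J = inj_on (\<lambda>j. lap_col n j (g j)) J" using fg by (intro inj_on_cong) auto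
      show "(\<not> (inj_on (\<lambda>j. lap_col n j (f j)) J \<and> ratfun.independent ((\<lambda>j. lap_col n j (f j)) ` J)))
        = (\<not> (inj_on (\<lambda>j. lap_col n j (g j)) J \<and> ratfun.independent ((\<lambda>j. lap_col n j (g j)) ` J)))"
        unfolding 1 2 ..
    qed (use J in auto)
    also have "\<dots> \<le> 5 * exp (- (\<kappa> / 2 * \<alpha> * n))"
      unfolding E_def Collect_neg_eq[symmetric] \<kappa>_def
      by (rule prob_dependent_columns_exp_le[OF n22 J p \<alpha>0 \<alpha>1 ln[unfolded \<kappa>_def]])
    finally have "1 - 5 * exp (- (\<kappa> / 2) * \<alpha> * real n) \<le> measure_pmf.prob ?P E"
      using measure_pmf.prob_compl[of E ?P] by (simp add: Compl_eq_Diff_UNIV)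
    also have "\<dots> \<le> measure_pmf.prob (random_matrix n \<xi>)
      {M. vec_space.rank n (map_mat real_of_int (submatrix (laplacian M) UNIV J)) = n - 1}"
      unfolding random_matrix_columns measure_map_pmf E_def
      using rank_laplacian_columns[OF J] by (intro measure_pmf.finite_measure_mono) auto
    finally show ?thesis .
  qed
  then show ?thesis using \<kappa>(1)
    by (intro exI[of _ "\<kappa> / 2"] exI[of _ "5::real"] exI[of _ "2 / \<kappa>"]) simp
qed

end
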